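(* Let $(M,\varphi)$ be a connected nearly parallel $\mathrm{G}_2$-manifold with $d\varphi=4\,{\star\varphi}$, with an effective action of a three-torus $T^3$ preserving $\varphi$, generated by vector fields $U_1,U_2,U_3$, and let $\nu=\varphi(U_1,U_2,U_3)\colon M\to\mathbb{R}$ be the multi-moment map. Critical points of $\nu$ may be characterised as follows: (1) $x\in\nu^{-1}(0)$ is a critical point of $\nu$ if and only if $U_1,U_2,U_3$ are linearly dependent at $x$. (2) $x\in M\setminus\nu^{-1}(0)$ is a critical point of $\nu$ if and only if $\mathrm{Span}_x\{U_1,U_2,U_3\}$ is an associative three-plane in $T_xM$. Thus the $T^3$-orbits of critical points $x$ with $\nu(x)\neq0$ are associative, hence minimal, submanifolds of $M$.
   Context: A $\mathrm{G}_2$-structure on a $7$-manifold $M$ is a three-form $\varphi$ that at each point, in some coframe $e^1,\dots,e^7$, equals $e^{123}-e^1(e^{45}+e^{67})-e^2(e^{46}+e^{75})-e^3(e^{47}+e^{56})$ (with $e^{ijk}=e^i\wedge e^j\wedge e^k$, etc.). It determines a Riemannian metric $g$ and volume form by $6g(X,Y)\mathrm{vol}=(X\lrcorner\varphi)\wedge(Y\lrcorner\varphi)\wedge\varphi$, and hence a Hodge star $\star$. It is nearly parallel (normalised) if $d\varphi=4\,{\star\varphi}$. The vector fields $U_1,U_2,U_3$ on $M$ correspond to a basis of the Lie algebra of $T^3$. The cross-product on $TM$ is defined by $g(X\times Y,Z)=\varphi(X,Y,Z)$; a three-plane in $T_xM$ is associative if it is closed under the cross-product, and a three-dimensional submanifold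 is associative if all its tangent spaces are. Minimal means zero mean curvature with respect to $g$. *)

theory Defs
  imports "HOL-Analysis.Analysis"
begin

section \<open>Smooth maps and manifolds\<close>

text \<open>The predicates below are only applied to open sets.\<close>

primrec Ck_on :: "nat \<Rightarrow> 'a::real_normed_vector set \<Rightarrow> ('a \<Rightarrow> 'b::real_normed_vector) \<Rightarrow> bool" where
  "Ck_on 0 S f = continuous_on S f"
| "Ck_on (Suc k) S f = ((\<forall>x\<in>S. f differentiable (at x)) \<and>
     (\<forall>v. Ck_on k S (\<lambda>x. frechet_derivative f (at x) v)))"

definition smooth_on :: "'a::real_normed_vector set \<Rightarrow> ('a \<Rightarrow> 'b::real_normed_vector) \<Rightarrow> bool" where
  "smooth_on S f \<longleftrightarrow> (\<forall>k. Ck_on k S f)"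

type_synonym ('m, 'n) chart = "'m set \<times> ('m \<Rightarrow> real^'n)"

definition chart_inv :: "('m, 'n::finite) chart \<Rightarrow> real^'n \<Rightarrow> 'm" where
  "chart_inv c = inv_into (fst c) (snd c)"

definition chart_image :: "('m, 'n::finite) chart \<Rightarrow> (real^'n) set" where
  "chart_image c = snd c ` fst c"

text \<open>The manifold is the whole type \<open>'m\<close>; the Hausdorff and second countability axioms are
  carried by its type classes.\<close>

definition smooth_atlas ::
  "('m::{t2_space,second_countable_topology}, 'n::finite) chart set \<Rightarrow> bool" where
  "smooth_atlas A \<longleftrightarrow>
     (\<Union>c\<in>A. fst c) = UNIV \<and>
     (\<forall>c\<in>A. open (fst c) \<and> open (chart_image c) \<and>
        homeomorphism (fst c) (chart_image c) (snd c) (chart_inv c)) \<and>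
     (\<forall>c\<in>A. \<forall>d\<in>A. smooth_on (snd c ` (fst c \<inter> fst d)) (snd d \<circ> chart_inv c))"

text \<open>The tangent space at \<open>x\<close> is represented by \<open>real^'n\<close>, a vector being given by its components in
  one fixed chart \<open>chart_at A x\<close> around \<open>x\<close>.  Tensors at \<open>x\<close> are thus (multi)linear maps on \<open>real^'n\<close>.
  The reference chart jumps with \<open>x\<close>, so smoothness of fields is always tested after passing to the
  components in a chart that is kept fixed.\<close>

definition chart_at :: "('m, 'n::finite) chart set \<Rightarrow> 'm \<Rightarrow> ('m, 'n) chart" where
  "chart_at A x = (SOME c. c \<in> A \<and> x \<in> fst c)"

definition coord_at :: "('m, 'n::finite) chart set \<Rightarrow> 'm \<Rightarrow> real^'n" where
  "coord_at A x = snd (chart_at A x) x"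

definition coord_change ::
  "('m, 'n::finite) chart \<Rightarrow> ('m, 'n) chart \<Rightarrow> 'm \<Rightarrow> real^'n \<Rightarrow> real^'n" where
  "coord_change c d x = frechet_derivative (snd d \<circ> chart_inv c) (at (snd c x))"

definition tangent_map ::
  "('m, 'n::finite) chart set \<Rightarrow> ('m \<Rightarrow> 'm) \<Rightarrow> 'm \<Rightarrow> real^'n \<Rightarrow> real^'n" where
  "tangent_map A f x =
     frechet_derivative (snd (chart_at A (f x)) \<circ> f \<circ> chart_inv (chart_at A x)) (at (coord_at A x))"

definition critical_point :: "('m, 'n::finite) chart set \<Rightarrow> ('m \<Rightarrow> real) \<Rightarrow> 'm \<Rightarrow> bool" where
  "critical_point A f x \<longleftrightarrow>
     ((f \<circ> chart_inv (chart_at A x)) has_derivative (\<lambda>_. 0)) (at (coord_at A x))"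

definition vector_field_in_chart ::
  "('m, 'n::finite) chart set \<Rightarrow> ('m, 'n) chart \<Rightarrow> ('m \<Rightarrow> real^'n) \<Rightarrow> real^'n \<Rightarrow> real^'n" where
  "vector_field_in_chart A c Y p =
     (let x = chart_inv c p in coord_change (chart_at A x) c x (Y x))"

definition smooth_vector_field_on ::
  "('m, 'n::finite) chart set \<Rightarrow> 'm set \<Rightarrow> ('m \<Rightarrow> real^'n) \<Rightarrow> bool" where
  "smooth_vector_field_on A V Y \<longleftrightarrow>
     (\<forall>c\<in>A. smooth_on (snd c ` (fst c \<inter> V)) (vector_field_in_chart A c Y))"

section \<open>Differential three-forms\<close>

type_synonym 'n form2 = "real^'n \<Rightarrow> real^'n \<Rightarrow> real"
type_synonym 'n form3 = "real^'n \<Rightarrow> real^'n \<Rightarrow> real^'n \<Rightarrow> real"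
type_synonym 'n form4 = "real^'n \<Rightarrow> real^'n \<Rightarrow> real^'n \<Rightarrow> real^'n \<Rightarrow> real"

definition alternating3 :: "'n::finite form3 \<Rightarrow> bool" where
  "alternating3 \<omega> \<longleftrightarrow> (\<forall>v w. linear (\<lambda>u. \<omega> u v w)) \<and>
     (\<forall>u v w. \<omega> v u w = - \<omega> u v w \<and> \<omega> u w v = - \<omega> u v w)"

definition form3_in_chart ::
  "('m, 'n::finite) chart set \<Rightarrow> ('m, 'n) chart \<Rightarrow> ('m \<Rightarrow> 'n form3) \<Rightarrow> real^'n \<Rightarrow> 'n form3" where
  "form3_in_chart A c \<omega> p u v w =
     (let x = chart_inv c p; T = coord_change c (chart_at A x) x in \<omega> x (T u) (T v) (T w))"

definition smooth_3form :: "('m, 'n::finite) chart set \<Rightarrow> ('m \<Rightarrow> 'n form3) \<Rightarrow> bool" where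
  "smooth_3form A \<omega> \<longleftrightarrow> (\<forall>x. alternating3 (\<omega> x)) \<and>
     (\<forall>c\<in>A. \<forall>u v w. smooth_on (chart_image c) (\<lambda>p. form3_in_chart A c \<omega> p u v w))"

text \<open>The exterior derivative does not depend on the chart used to compute it; at \<open>x\<close> the reference
  chart is used, so that its value is again a form on the tangent space at \<open>x\<close>.\<close>

definition ext_deriv3 ::
  "('m, 'n::finite) chart set \<Rightarrow> ('m \<Rightarrow> 'n form3) \<Rightarrow> 'm \<Rightarrow> 'n form4" where
  "ext_deriv3 A \<omega> x v0 v1 v2 v3 =
     (let D = (\<lambda>v a b c. frechet_derivative
                 (\<lambda>p. form3_in_chart A (chart_at A x) \<omega> p a b c) (at (coord_at A x)) v)
      in D v0 v1 v2 v3 - D v1 v0 v2 v3 + D v2 v0 v1 v3 - D v3 v0 v1 v2)"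

section \<open>\<open>G\<^sub>2\<close>-structures\<close>

text \<open>The value of \<open>e\<^sup>i \<and> e\<^sup>j \<and> e\<^sup>k\<close>.  Wedge products are normalised throughout so that
  \<open>(e\<^sup>1 \<and> \<dots> \<and> e\<^sup>k) (v\<^sub>1, \<dots>, v\<^sub>k) = det (e\<^sup>i v\<^sub>j)\<close>.\<close>

definition e3 :: "7 \<Rightarrow> 7 \<Rightarrow> 7 \<Rightarrow> 7 form3" where
  "e3 i j k u v w =
     det (vector [vector [u$i, v$i, w$i], vector [u$j, v$j, w$j], vector [u$k, v$k, w$k]] :: real^3^3)"

definition phi0 :: "7 form3" where
  "phi0 u v w = e3 1 2 3 u v w
     - (e3 1 4 5 u v w + e3 1 6 7 u v w)
     - (e3 2 4 6 u v w + e3 2 7 5 u v w)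
     - (e3 3 4 7 u v w + e3 3 5 6 u v w)"

definition G2_form :: "7 form3 \<Rightarrow> bool" where
  "G2_form \<phi> \<longleftrightarrow> (\<exists>e :: real^7 \<Rightarrow> real^7. linear e \<and> bij e \<and>
     (\<forall>u v w. \<phi> u v w = phi0 (e u) (e v) (e w)))"

definition G2_structure :: "('m, 7) chart set \<Rightarrow> ('m \<Rightarrow> 7 form3) \<Rightarrow> bool" where
  "G2_structure A \<phi> \<longleftrightarrow> smooth_3form A \<phi> \<and> (\<forall>x. G2_form (\<phi> x))"

text \<open>\<open>\<alpha> \<and> \<beta> \<and> \<gamma>\<close> for forms of degree 2, 2, 3; seven arguments are collected as the rows of a matrix.\<close>

definition wedge223 :: "7 form2 \<Rightarrow> 7 form2 \<Rightarrow> 7 form3 \<Rightarrow> real^7^7 \<Rightarrow> real" where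
  "wedge223 \<alpha> \<beta> \<gamma> v =
     (\<Sum>p | p permutes (UNIV :: 7 set). of_int (sign p) *
        (\<alpha> (v $ p 1) (v $ p 2) * \<beta> (v $ p 3) (v $ p 4) * \<gamma> (v $ p 5) (v $ p 6) (v $ p 7)))
     / (fact 2 * fact 2 * fact 3)"

definition inner_product :: "'n::finite form2 \<Rightarrow> bool" where
  "inner_product g \<longleftrightarrow> (\<forall>v. linear (\<lambda>u. g u v)) \<and> (\<forall>u v. g u v = g v u) \<and> (\<forall>u. u \<noteq> 0 \<longrightarrow> g u u > 0)"

definition orthonormal_frame :: "'n::finite form2 \<Rightarrow> real^'n^'n \<Rightarrow> bool" where
  "orthonormal_frame g E \<longleftrightarrow> (\<forall>i j. g (E $ i) (E $ j) = (if i = j then 1 else 0))"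

text \<open>\<open>6 g(X,Y) vol = (X \<lrcorner> \<phi>) \<and> (Y \<lrcorner> \<phi>) \<and> \<phi>\<close>, where \<open>vol\<close> is a volume form of \<open>g\<close>.  For a
  \<open>G\<^sub>2\<close>-form \<open>\<phi>\<close> exactly one pair \<open>(g, vol)\<close> satisfies this.\<close>

definition G2_metric_volume :: "7 form3 \<Rightarrow> 7 form2 \<Rightarrow> (real^7^7 \<Rightarrow> real) \<Rightarrow> bool" where
  "G2_metric_volume \<phi> g vol \<longleftrightarrow> inner_product g \<and>
     (\<forall>E. orthonormal_frame g E \<longrightarrow> \<bar>vol E\<bar> = 1) \<and>
     (\<forall>X Y v. 6 * g X Y * vol v = wedge223 (\<phi> X) (\<phi> Y) \<phi> v)"

definition G2_metric :: "7 form3 \<Rightarrow> 7 form2" where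
  "G2_metric \<phi> = (THE g. \<exists>vol. G2_metric_volume \<phi> g vol)"

definition G2_volume :: "7 form3 \<Rightarrow> real^7^7 \<Rightarrow> real" where
  "G2_volume \<phi> = (THE vol. \<exists>g. G2_metric_volume \<phi> g vol)"

text \<open>The Hodge star in index notation, with respect to an oriented orthonormal frame (on which it
  does not depend):
  \<open>\<star>\<beta> = 1/3! \<Sum>\<^sub>i\<^sub>j\<^sub>k \<beta>(E\<^sub>i, E\<^sub>j, E\<^sub>k) vol(E\<^sub>i, E\<^sub>j, E\<^sub>k, \<hyphen>, \<hyphen>, \<hyphen>, \<hyphen>)\<close>.\<close>

definition hodge_star3 :: "7 form2 \<Rightarrow> (real^7^7 \<Rightarrow> real) \<Rightarrow> 7 form3 \<Rightarrow> 7 form4" where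
  "hodge_star3 g vol \<beta> u1 u2 u3 u4 =
     (let E = (SOME E. orthonormal_frame g E \<and> vol E = 1)
      in (\<Sum>i\<in>UNIV. \<Sum>j\<in>UNIV. \<Sum>k\<in>UNIV. \<beta> (E$i) (E$j) (E$k) *
            vol (vector [E$i, E$j, E$k, u1, u2, u3, u4])) / fact 3)"

definition nearly_parallel_G2 :: "('m, 7) chart set \<Rightarrow> ('m \<Rightarrow> 7 form3) \<Rightarrow> bool" where
  "nearly_parallel_G2 A \<phi> \<longleftrightarrow> G2_structure A \<phi> \<and>
     (\<forall>x u1 u2 u3 u4. ext_deriv3 A \<phi> x u1 u2 u3 u4 =
        4 * hodge_star3 (G2_metric (\<phi> x)) (G2_volume (\<phi> x)) (\<phi> x) u1 u2 u3 u4)"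

definition cross_product :: "7 form3 \<Rightarrow> real^7 \<Rightarrow> real^7 \<Rightarrow> real^7" where
  "cross_product \<phi> X Y = (THE W. \<forall>Z. G2_metric \<phi> W Z = \<phi> X Y Z)"

definition associative_plane :: "7 form3 \<Rightarrow> (real^7) set \<Rightarrow> bool" where
  "associative_plane \<phi> P \<longleftrightarrow> subspace P \<and> dim P = 3 \<and> (\<forall>X\<in>P. \<forall>Y\<in>P. cross_product \<phi> X Y \<in> P)"

section \<open>Submanifolds, associative and minimal\<close>

text \<open>Slice charts may be taken from the maximal atlas, i.e. any chart compatible with \<open>A\<close>.\<close>

definition embedded_submanifold ::
  "('m::{t2_space,second_countable_topology}, 'n::finite) chart set \<Rightarrow> nat \<Rightarrow> 'm set \<Rightarrow> bool" where
  "embedded_submanifold A k N \<longleftrightarrow>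
     (\<forall>y\<in>N. \<exists>c S. smooth_atlas (insert c A) \<and> y \<in> fst c \<and> subspace S \<and> dim S = k \<and>
        snd c ` (fst c \<inter> N) = chart_image c \<inter> S)"

definition submanifold_tangent ::
  "('m::topological_space, 'n::finite) chart set \<Rightarrow> 'm set \<Rightarrow> 'm \<Rightarrow> (real^'n) set" where
  "submanifold_tangent A N y =
     {v. \<exists>\<gamma> :: real \<Rightarrow> 'm. \<gamma> 0 = y \<and> (\<forall>s. \<gamma> s \<in> N) \<and> isCont \<gamma> 0 \<and>
         ((snd (chart_at A y) \<circ> \<gamma>) has_vector_derivative v) (at 0)}"

definition associative_submanifold ::
  "('m::{t2_space,second_countable_topology}, 7) chart set \<Rightarrow> ('m \<Rightarrow> 7 form3) \<Rightarrow> 'm set \<Rightarrow> bool" where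
  "associative_submanifold A \<phi> N \<longleftrightarrow> embedded_submanifold A 3 N \<and>
     (\<forall>y\<in>N. associative_plane (\<phi> y) (submanifold_tangent A N y))"

definition metric_in_chart ::
  "('m, 'n::finite) chart set \<Rightarrow> ('m, 'n) chart \<Rightarrow> ('m \<Rightarrow> 'n form2) \<Rightarrow> real^'n \<Rightarrow> 'n form2" where
  "metric_in_chart A c g p u v =
     (let x = chart_inv c p; T = coord_change c (chart_at A x) x in g x (T u) (T v))"

text \<open>\<open>\<Gamma>(u,v)\<close> in the reference chart at \<open>y\<close>:
  \<open>2 g(\<Gamma>(u,v), w) = D\<^sub>u g(v,w) + D\<^sub>v g(u,w) - D\<^sub>w g(u,v)\<close>.\<close>

definition christoffel ::
  "('m, 'n::finite) chart set \<Rightarrow> ('m \<Rightarrow> 'n form2) \<Rightarrow> 'm \<Rightarrow> real^'n \<Rightarrow> real^'n \<Rightarrow> real^'n" where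
  "christoffel A g y u v =
     (let D = (\<lambda>a b c. frechet_derivative
                 (\<lambda>p. metric_in_chart A (chart_at A y) g p b c) (at (coord_at A y)) a)
      in THE G. \<forall>w. 2 * g y G w = D u v w + D v u w - D w u v)"

text \<open>The Levi-Civita derivative \<open>\<nabla>\<^sub>v Y\<close> at \<open>y\<close>.\<close>

definition cov_deriv ::
  "('m, 'n::finite) chart set \<Rightarrow> ('m \<Rightarrow> 'n form2) \<Rightarrow> 'm \<Rightarrow> real^'n \<Rightarrow> ('m \<Rightarrow> real^'n) \<Rightarrow> real^'n" where
  "cov_deriv A g y v Y =
     frechet_derivative (vector_field_in_chart A (chart_at A y) Y) (at (coord_at A y)) v
     + christoffel A g y v (Y y)"

definition normal_part :: "'n::finite form2 \<Rightarrow> (real^'n) set \<Rightarrow> real^'n \<Rightarrow> real^'n" where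
  "normal_part h T W = (THE n. (\<forall>t\<in>T. h n t = 0) \<and> W - n \<in> T)"

text \<open>\<open>II(v,w) = (\<nabla>\<^sub>v Y)\<^sup>\<bottom>\<close> for any local vector field \<open>Y\<close> tangent to \<open>N\<close> along \<open>N\<close> with \<open>Y y = w\<close>.\<close>

definition second_fundamental_form ::
  "('m::topological_space, 'n::finite) chart set \<Rightarrow> ('m \<Rightarrow> 'n form2) \<Rightarrow> 'm set \<Rightarrow> 'm
     \<Rightarrow> real^'n \<Rightarrow> real^'n \<Rightarrow> real^'n" where
  "second_fundamental_form A g N y v w =
     (THE n. \<exists>V Y. open V \<and> y \<in> V \<and> smooth_vector_field_on A V Y \<and>
        (\<forall>x\<in>V \<inter> N. Y x \<in> submanifold_tangent A N x) \<and> Y y = w \<and>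
        n = normal_part (g y) (submanifold_tangent A N y) (cov_deriv A g y v Y))"

definition orthonormal_basis_of :: "'n::finite form2 \<Rightarrow> (real^'n) set \<Rightarrow> (real^'n) set \<Rightarrow> bool" where
  "orthonormal_basis_of h T B \<longleftrightarrow> finite B \<and> span B = T \<and>
     (\<forall>a\<in>B. \<forall>b\<in>B. h a b = (if a = b then 1 else 0))"

definition mean_curvature ::
  "('m::topological_space, 'n::finite) chart set \<Rightarrow> ('m \<Rightarrow> 'n form2) \<Rightarrow> 'm set \<Rightarrow> 'm \<Rightarrow> real^'n" where
  "mean_curvature A g N y =
     (\<Sum>e\<in>(SOME B. orthonormal_basis_of (g y) (submanifold_tangent A N y) B).
        second_fundamental_form A g N y e e)"

definition minimal_submanifold ::
  "('m::{t2_space,second_countable_topology}, 'n::finite) chart set \<Rightarrow> ('m \<Rightarrow> 'n form2)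
     \<Rightarrow> nat \<Rightarrow> 'm set \<Rightarrow> bool" where
  "minimal_submanifold A g k N \<longleftrightarrow>
     embedded_submanifold A k N \<and> (\<forall>y\<in>N. mean_curvature A g N y = 0)"

section \<open>Torus actions\<close>

text \<open>\<open>T\<^sup>3 = U(1)\<^sup>3\<close>, with the componentwise product of \<open>complex^3\<close> and Lie algebra \<open>real^3\<close>.\<close>

definition torus3 :: "(complex^3) set" where
  "torus3 = {z. \<forall>i. cmod (z $ i) = 1}"

definition torus_exp :: "real^3 \<Rightarrow> complex^3" where
  "torus_exp t = (\<chi> i. cis (t $ i))"

text \<open>As \<open>torus_exp\<close> is a surjective local diffeomorphism onto the torus, smoothness of the action map
  \<open>T\<^sup>3 \<times> M \<rightarrow> M\<close> is tested after composition with it.\<close>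

definition smooth_torus_action ::
  "('m::topological_space, 'n::finite) chart set \<Rightarrow> (complex^3 \<Rightarrow> 'm \<Rightarrow> 'm) \<Rightarrow> bool" where
  "smooth_torus_action A act \<longleftrightarrow>
     (\<forall>x. act 1 x = x) \<and>
     (\<forall>z\<in>torus3. \<forall>w\<in>torus3. \<forall>x. act (z * w) x = act z (act w x)) \<and>
     continuous_on UNIV (\<lambda>(t, x). act (torus_exp t) x) \<and>
     (\<forall>c\<in>A. \<forall>d\<in>A. smooth_on
        {(t, p). p \<in> chart_image c \<and> act (torus_exp t) (chart_inv c p) \<in> fst d}
        (\<lambda>(t, p). snd d (act (torus_exp t) (chart_inv c p))))"

definition effective_action :: "(complex^3 \<Rightarrow> 'm \<Rightarrow> 'm) \<Rightarrow> bool" where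
  "effective_action act \<longleftrightarrow> (\<forall>z\<in>torus3. (\<forall>x. act z x = x) \<longrightarrow> z = 1)"

definition preserves_3form ::
  "('m, 'n::finite) chart set \<Rightarrow> (complex^3 \<Rightarrow> 'm \<Rightarrow> 'm) \<Rightarrow> ('m \<Rightarrow> 'n form3) \<Rightarrow> bool" where
  "preserves_3form A act \<omega> \<longleftrightarrow>
     (\<forall>z\<in>torus3. \<forall>x u v w. let T = tangent_map A (act z) x in
        \<omega> (act z x) (T u) (T v) (T w) = \<omega> x u v w)"

definition fundamental_field ::
  "('m, 'n::finite) chart set \<Rightarrow> (complex^3 \<Rightarrow> 'm \<Rightarrow> 'm) \<Rightarrow> real^3 \<Rightarrow> 'm \<Rightarrow> real^'n" where
  "fundamental_field A act \<xi> x =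
     vector_derivative (\<lambda>s. snd (chart_at A x) (act (torus_exp (s *\<^sub>R \<xi>)) x)) (at 0)"

definition torus_orbit :: "(complex^3 \<Rightarrow> 'm \<Rightarrow> 'm) \<Rightarrow> 'm \<Rightarrow> 'm set" where
  "torus_orbit act x = (\<lambda>z. act z x) ` torus3"

text \<open>Linear dependence of the family \<open>(u, v, w)\<close>; unlike for the set \<open>{u, v, w}\<close>, repeated vectors
  count as dependent.\<close>

definition linearly_dependent3 :: "'a::real_vector \<Rightarrow> 'a \<Rightarrow> 'a \<Rightarrow> bool" where
  "linearly_dependent3 u v w \<longleftrightarrow>
     (\<exists>a b c. (a, b, c) \<noteq> (0, 0, 0) \<and> a *\<^sub>R u + b *\<^sub>R v + c *\<^sub>R w = 0)"

end

theory Submission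
  imports Defs
begin

text \<open>Since the flows of the commuting fields \<open>U\<^sub>i\<close> preserve \<open>\<phi>\<close>, Cartan's formula gives
  \<open>d\<nu>(w) = d\<phi>(w, U\<^sub>1, U\<^sub>2, U\<^sub>3) = 4 \<star>\<phi>(w, U\<^sub>1, U\<^sub>2, U\<^sub>3)\<close>.  For \<open>u\<close> normal to \<open>v\<close> and \<open>w\<close>, the vector dual to
  \<open>\<star>\<phi>(\<hyphen>, u, v, w)\<close> is \<open>u \<times> (v \<times> w)\<close>; for independent vectors it vanishes exactly when \<open>v \<times> w\<close> is a
  multiple of \<open>u\<close>, that is, when the span is associative, and then \<open>\<phi>(u, v, w) \<noteq> 0\<close>.

  At a critical point with \<open>\<nu> \<noteq> 0\<close> choose generators \<open>V\<^sub>1, V\<^sub>2, V\<^sub>3\<close> that are orthonormal there.  The function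
  \<open>|V\<^sub>1|\<^sup>2|V\<^sub>2|\<^sup>2|V\<^sub>3|\<^sup>2 - \<phi>(V\<^sub>1, V\<^sub>2, V\<^sub>3)\<^sup>2\<close> is nonnegative and vanishes at the point, and \<open>\<phi>(V\<^sub>1, V\<^sub>2, V\<^sub>3)\<close> is critical
  there, so \<open>\<Sum> |V\<^sub>i|\<^sup>2\<close> is critical too.  As the \<open>V\<^sub>i\<close> are Killing fields, \<open>\<nabla>\<close> of \<open>V\<^sub>i\<close> along itself is
  \<open>- grad |V\<^sub>i|\<^sup>2 / 2\<close>, hence these derivatives sum to zero and so does the mean curvature of the orbit.\<close>

section \<open>Algebra of the standard \<open>G\<^sub>2\<close>-form\<close>

text \<open>Pointwise statements are moved to \<open>phi0\<close> by a linear bijection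
  \<open>e\<close> with \<open>\<phi> = pullback3 e phi0\<close> and become polynomial identities
  there. Metric, volume, cross product, Christoffel symbols, normal parts and second fundamental
  form are definite descriptions, and frames and bases are arbitrary choices; each needs an
  existence, uniqueness or independence argument before it can be computed. The reference chart of a
  tangent space jumps with the point, so derivatives are taken in one fixed chart, from the joint
  map that sends a time and a point to the moved point. Symmetry of its second derivatives gives
  both the commuting of the fields and the Lie derivatives. The fields are Killing because \<phi>
  determines the metric.\<close>

lemma exhaust_7:
  fixes x :: 7
  shows "x = 1 \<or> x = 2 \<or> x = 3 \<or> x = 4 \<or> x = 5 \<or> x = 6 \<or> x = 7"
proof (induct x)
  case (of_int z)
  then have "0 \<le> z" and "z < 7" by simp_all
  then have "z = 0 \<or> z = 1 \<or> z = 2 \<or> z = 3 \<or> z = 4 \<or> z = 5 \<or> z = 6" by arith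
  then show ?case by auto
qed

lemma forall_7: "(\<forall>i::7. P i) \<longleftrightarrow> P 1 \<and> P 2 \<and> P 3 \<and> P 4 \<and> P 5 \<and> P 6 \<and> P 7"
  by (metis exhaust_7)

lemma UNIV_7: "(UNIV :: 7 set) = {1, 2, 3, 4, 5, 6, 7}"
  using exhaust_7 by auto

lemma sum_7: "sum f (UNIV :: 7 set) = f 1 + f 2 + f 3 + f 4 + f 5 + f 6 + f 7"
  unfolding UNIV_7 by (simp add: ac_simps)

lemma prod_7: "prod f (UNIV :: 7 set) = f 1 * f 2 * f 3 * f 4 * f 5 * f 6 * f 7"
  unfolding UNIV_7 by (simp add: ac_simps)

lemma vector_7 [simp]:
  "(vector [a, b, c, d, e, f, g] :: 'a::zero^7) $ 1 = a"
  "(vector [a, b, c, d, e, f, g] :: 'a::zero^7) $ 2 = b"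
  "(vector [a, b, c, d, e, f, g] :: 'a::zero^7) $ 3 = c"
  "(vector [a, b, c, d, e, f, g] :: 'a::zero^7) $ 4 = d"
  "(vector [a, b, c, d, e, f, g] :: 'a::zero^7) $ 5 = e"
  "(vector [a, b, c, d, e, f, g] :: 'a::zero^7) $ 6 = f"
  "(vector [a, b, c, d, e, f, g] :: 'a::zero^7) $ 7 = g"
  unfolding vector_def by simp_all

text \<open>In the type \<open>7\<close> the numeral \<open>7\<close> equals \<open>0\<close>; the rank restores the order \<open>1 < \<dots> < 7\<close> in which the
  simplifier sorts column indices.\<close>

definition rank7 :: "7 \<Rightarrow> nat" where
  "rank7 x = (if x = 1 then 1 else if x = 2 then 2 else if x = 3 then 3 else if x = 4 then 4
     else if x = 5 then 5 else if x = 6 then 6 else 7)"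

lemma rank7_numeral [simp]:
  "rank7 1 = 1" "rank7 2 = 2" "rank7 3 = 3" "rank7 4 = 4" "rank7 5 = 5" "rank7 6 = 6" "rank7 7 = 7"
  by (simp_all add: rank7_def)

section \<open>Determinants of selected columns\<close>

text \<open>This is the value of the wedge product of the coordinate forms with indices
  \<open>a\<close>, ..., \<open>g\<close> on the seven rows of \<open>v\<close>. A wedge of
  constant-coefficient forms of total degree seven is a combination of such values, each of which is
  zero or plus or minus \<open>det v\<close>.\<close>

definition det_cols :: "real^7^7 \<Rightarrow> 7 \<Rightarrow> 7 \<Rightarrow> 7 \<Rightarrow> 7 \<Rightarrow> 7 \<Rightarrow> 7 \<Rightarrow> 7 \<Rightarrow> real" where
  "det_cols v a b c d e f g =
     det (vector [column a v, column b v, column c v, column d v, column e v, column f v, column g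
         v])"

lemma det_cols_sum:
  "det_cols v a b c d e f g = (\<Sum>p | p permutes (UNIV :: 7 set). of_int (sign p) *
     (v $ p 1 $ a * v $ p 2 $ b * v $ p 3 $ c * v $ p 4 $ d * v $ p 5 $ e * v $ p 6 $ f * v $ p 7
         $ g))"
  by (simp add: det_cols_def det_def prod_7 column_def)

lemma det_cols_sorted: "det_cols v 1 2 3 4 5 6 7 = det v"
proof -
  have "vector [column 1 v, column 2 v, column 3 v, column 4 v, column 5 v, column 6 v, column 7 v]
     = Finite_Cartesian_Product.transpose v"
    by (simp add: vec_eq_iff forall_7 column_def Finite_Cartesian_Product.transpose_def)
  then show ?thesis
    by (simp add: det_cols_def)
qed

lemma det_swap_rows:
  fixes M :: "'a::comm_ring_1^'n^'n"
  assumes "i \<noteq> j" "\<And>k. N $ k = M $ (Transposition.transpose i j k)"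
  shows "det N = - det M"
proof -
  have "N = (\<chi> k. M $ (Transposition.transpose i j k))"
    by (simp add: vec_eq_iff assms(2))
  then show ?thesis
    using assms(1) by (simp add: det_permute_rows permutes_swap_id sign_swap_id)
qed

lemma det_vector_7_swap:
  fixes a b c d e f g :: "'a::comm_ring_1^7"
  shows "det (vector [b, a, c, d, e, f, g]) = - det (vector [a, b, c, d, e, f, g])"
    "det (vector [a, c, b, d, e, f, g]) = - det (vector [a, b, c, d, e, f, g])"
    "det (vector [a, b, d, c, e, f, g]) = - det (vector [a, b, c, d, e, f, g])"
    "det (vector [a, b, c, e, d, f, g]) = - det (vector [a, b, c, d, e, f, g])"
    "det (vector [a, b, c, d, f, e, g]) = - det (vector [a, b, c, d, e, f, g])"
    "det (vector [a, b, c, d, e, g, f]) = - det (vector [a, b, c, d, e, f, g])"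
proof -
  have *: "det N = - det M"
    if "i \<noteq> j" "\<forall>k. N $ k = M $ (Transposition.transpose i j k)" for N M :: "'a^7^7" and i j
    by (rule det_swap_rows[OF that(1)]) (use that(2) in blast)
  show "det (vector [b, a, c, d, e, f, g]) = - det (vector [a, b, c, d, e, f, g])"
    by (rule *[of 1 2]) (simp_all add: forall_7 Transposition.transpose_def)
  show "det (vector [a, c, b, d, e, f, g]) = - det (vector [a, b, c, d, e, f, g])"
    by (rule *[of 2 3]) (simp_all add: forall_7 Transposition.transpose_def)
  show "det (vector [a, b, d, c, e, f, g]) = - det (vector [a, b, c, d, e, f, g])"
    by (rule *[of 3 4]) (simp_all add: forall_7 Transposition.transpose_def)
  show "det (vector [a, b, c, e, d, f, g]) = - det (vector [a, b, c, d, e, f, g])"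
    by (rule *[of 4 5]) (simp_all add: forall_7 Transposition.transpose_def)
  show "det (vector [a, b, c, d, f, e, g]) = - det (vector [a, b, c, d, e, f, g])"
    by (rule *[of 5 6]) (simp_all add: forall_7 Transposition.transpose_def)
  show "det (vector [a, b, c, d, e, g, f]) = - det (vector [a, b, c, d, e, f, g])"
    by (rule *[of 6 7]) (simp_all add: forall_7 Transposition.transpose_def)
qed

lemma det_cols_swap:
  "det_cols v b a c d e f g = - det_cols v a b c d e f g"
  "det_cols v a c b d e f g = - det_cols v a b c d e f g"
  "det_cols v a b d c e f g = - det_cols v a b c d e f g"
  "det_cols v a b c e d f g = - det_cols v a b c d e f g"
  "det_cols v a b c d f e g = - det_cols v a b c d e f g"
  "det_cols v a b c d e g f = - det_cols v a b c d e f g"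
  unfolding det_cols_def by (rule det_vector_7_swap)+

text \<open>The rank condition orients the swaps: only an adjacent inversion is exchanged, so
  rewriting is a terminating bubble sort, and equal columns end up side by side where
  \<open>det_cols_repeat\<close> applies.\<close>

lemma det_cols_sort:
  "rank7 a < rank7 b \<Longrightarrow> det_cols v b a c d e f g = - det_cols v a b c d e f g"
  "rank7 b < rank7 c \<Longrightarrow> det_cols v a c b d e f g = - det_cols v a b c d e f g"
  "rank7 c < rank7 d \<Longrightarrow> det_cols v a b d c e f g = - det_cols v a b c d e f g"
  "rank7 d < rank7 e \<Longrightarrow> det_cols v a b c e d f g = - det_cols v a b c d e f g"
  "rank7 e < rank7 f \<Longrightarrow> det_cols v a b c d f e g = - det_cols v a b c d e f g"
  "rank7 f < rank7 g \<Longrightarrow> det_cols v a b c d e g f = - det_cols v a b c d e f g"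
  by (rule det_cols_swap)+

lemma det_cols_repeat:
  "det_cols v a a c d e f g = 0"
  "det_cols v a b b d e f g = 0"
  "det_cols v a b c c e f g = 0"
  "det_cols v a b c d d f g = 0"
  "det_cols v a b c d e e g = 0"
  "det_cols v a b c d e f f = 0"
  using det_cols_swap(1)[of v a a c d e f g] det_cols_swap(2)[of v a b b d e f g]
    det_cols_swap(3)[of v a b c c e f g] det_cols_swap(4)[of v a b c d d f g]
    det_cols_swap(5)[of v a b c d e e g] det_cols_swap(6)[of v a b c d e f f]
  by simp_all

section \<open>Alternating three-forms in coordinates\<close>

lemma linear_axis_expansion:
  fixes f :: "real^'n \<Rightarrow> real"
  assumes "linear f"
  shows "f u = (\<Sum>i\<in>UNIV. u $ i * f (axis i 1))"
proof -
  have "f u = f (\<Sum>i\<in>UNIV. u $ i *\<^sub>R axis i 1)"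
    by (metis (no_types, lifting) basis_expansion scalar_mult_eq_scaleR sum.cong)
  then show ?thesis
    by (simp add: linear_sum[OF assms] linear_cmul[OF assms])
qed

lemma e3_expand:
  "e3 i j k u v w = u$i * v$j * w$k + v$i * w$j * u$k + w$i * u$j * v$k
     - u$i * w$j * v$k - v$i * u$j * w$k - w$i * v$j * u$k"
  by (simp add: e3_def det_3)

lemma alternating3_e3: "alternating3 (e3 i j k)"
proof -
  have "linear (\<lambda>u. e3 i j k u v w)" for v w
    by (rule linearI) (simp_all add: e3_expand algebra_simps)
  moreover have "e3 i j k v u w = - e3 i j k u v w" "e3 i j k u w v = - e3 i j k u v w" for u v w
    by (simp_all add: e3_expand)
  ultimately show ?thesis
    unfolding alternating3_def by (intro conjI allI)
qed

lemma alternating3_add: "alternating3 S \<Longrightarrow> alternating3 T \<Longrightarrow> alternating3 (\<lambda>u v w. S u v w + T u v w)"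
  unfolding alternating3_def by (intro conjI allI linear_compose_add) (blast, blast, metis
      minus_add_distrib, metis minus_add_distrib)

lemma alternating3_diff: "alternating3 S \<Longrightarrow> alternating3 T \<Longrightarrow> alternating3 (\<lambda>u v w. S u v w - T u v
    w)"
  unfolding alternating3_def by (intro conjI allI linear_compose_sub) (blast, blast, metis
      minus_diff_minus, metis minus_diff_minus)

lemma alternating3_phi0: "alternating3 phi0"
proof -
  have *: "phi0 = (\<lambda>u v w. e3 1 2 3 u v w
     - (e3 1 4 5 u v w + e3 1 6 7 u v w)
     - (e3 2 4 6 u v w + e3 2 7 5 u v w)
     - (e3 3 4 7 u v w + e3 3 5 6 u v w))"
    by (simp add: phi0_def fun_eq_iff)
  show ?thesis
    by (subst *) (intro alternating3_add alternating3_diff alternating3_e3)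
qed

lemma alternating3_linear:
  assumes "alternating3 \<omega>"
  shows "linear (\<lambda>u. \<omega> u v w)" "linear (\<lambda>v. \<omega> u v w)" "linear (\<lambda>w. \<omega> u v w)"
proof -
  have sk: "\<omega> v u w = - \<omega> u v w" "\<omega> u w v = - \<omega> u v w" for u v w
    using assms unfolding alternating3_def by blast+
  show l: "linear (\<lambda>u. \<omega> u v w)" for v w
    using assms unfolding alternating3_def by blast
  show l2: "linear (\<lambda>v. \<omega> u v w)" for u w
    by (subst sk(1)) (intro linear_compose_neg l)
  show "linear (\<lambda>w. \<omega> u v w)"
    by (subst sk(2)) (intro linear_compose_neg l2)
qed

lemma sum_axis_left [simp]: "(\<Sum>l\<in>UNIV. (axis l (1::real) :: real^'n) $ i * f l) = f i"
proof -
  have "(\<Sum>l\<in>UNIV. (axis l (1::real) :: real^'n) $ i * f l) = (\<Sum>l\<in>UNIV. if l = i then f l else 0)"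
    by (rule sum.cong) (auto simp: axis_def)
  then show ?thesis by simp
qed

section \<open>Contractions against the monomials of \<open>phi0\<close>\<close>

text \<open>The six terms of the determinant pair up by antisymmetry of \<open>H\<close>, whence the
  factor 2. Contracting with \<open>phi0\<close> thus becomes a sum over its seven monomials instead
  of over all index pairs.\<close>

lemma e3_contract2:
  assumes "\<And>m n. H n m = - H m n"
  shows "(\<Sum>m\<in>UNIV. \<Sum>n\<in>UNIV. e3 i j k X (axis m 1) (axis n 1) * H m n) =
    2 * (X$i * H j k + X$j * H k i + X$k * H i j)"
proof -
  have "(\<Sum>m\<in>UNIV. \<Sum>n\<in>UNIV. e3 i j k X (axis m 1) (axis n 1) * H m n) =
   (\<Sum>m\<in>UNIV. \<Sum>n\<in>UNIV. axis m 1 $ j * (axis n 1 $ k * (X $ i * H m n)))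
   + (\<Sum>m\<in>UNIV. \<Sum>n\<in>UNIV. axis m 1 $ i * (axis n 1 $ j * (X $ k * H m n)))
   + (\<Sum>m\<in>UNIV. \<Sum>n\<in>UNIV. axis m 1 $ k * (axis n 1 $ i * (X $ j * H m n)))
   - (\<Sum>m\<in>UNIV. \<Sum>n\<in>UNIV. axis m 1 $ k * (axis n 1 $ j * (X $ i * H m n)))
   - (\<Sum>m\<in>UNIV. \<Sum>n\<in>UNIV. axis m 1 $ i * (axis n 1 $ k * (X $ j * H m n)))
   - (\<Sum>m\<in>UNIV. \<Sum>n\<in>UNIV. axis m 1 $ j * (axis n 1 $ i * (X $ k * H m n)))"
    unfolding sum.distrib[symmetric] sum_subtractf[symmetric] e3_expand
    by (intro sum.cong refl) (simp add: algebra_simps)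
  also have "\<dots> = X$i * H j k + X$k * H i j + X$j * H k i - X$i * H k j - X$j * H i k - X$k * H j i"
    by (simp flip: sum_distrib_left)
  finally show ?thesis
    by (simp add: assms[of j k] assms[of k i] assms[of i j])
qed

lemma e3_contract3:
  assumes "\<And>l m n. H m l n = - H l m n" "\<And>l m n. H l n m = - H l m n"
  shows "(\<Sum>l\<in>UNIV. \<Sum>m\<in>UNIV. \<Sum>n\<in>UNIV. e3 i j k (axis l 1) (axis m 1) (axis n 1) * H l m n) =
    6 * H i j k"
proof -
  have "(\<Sum>l\<in>UNIV. \<Sum>m\<in>UNIV. \<Sum>n\<in>UNIV. e3 i j k (axis l 1) (axis m 1) (axis n 1) * H l m n) =
    (\<Sum>l\<in>UNIV. axis l 1 $ i * (2 * H l j k) + axis l 1 $ j * (2 * H l k i) + axis l 1 $ k * (2 * H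
        l i j))"
    by (intro sum.cong refl) (subst e3_contract2, rule assms(2), simp add: algebra_simps)
  also have "\<dots> = 2 * (H i j k + H j k i + H k i j)"
    by (simp add: sum.distrib)
  also have "H j k i = H i j k"
    using assms(1)[of j i k] assms(2)[of j k i] by simp
  also have "H k i j = H i j k"
    using assms(1)[of k i j] assms(2)[of i k j] by simp
  finally show ?thesis by simp
qed

lemma phi0_contract2:
  assumes "\<And>m n. H n m = - H m n"
  shows "(\<Sum>m\<in>UNIV. \<Sum>n\<in>UNIV. phi0 X (axis m 1) (axis n 1) * H m n) =
    2 * ((X$1 * H 2 3 + X$2 * H 3 1 + X$3 * H 1 2)
     - (X$1 * H 4 5 + X$4 * H 5 1 + X$5 * H 1 4) - (X$1 * H 6 7 + X$6 * H 7 1 + X$7 * H 1 6)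
     - (X$2 * H 4 6 + X$4 * H 6 2 + X$6 * H 2 4) - (X$2 * H 7 5 + X$7 * H 5 2 + X$5 * H 2 7)
     - (X$3 * H 4 7 + X$4 * H 7 3 + X$7 * H 3 4) - (X$3 * H 5 6 + X$5 * H 6 3 + X$6 * H 3 5))"
  unfolding phi0_def distrib_right left_diff_distrib sum.distrib sum_subtractf e3_contract2[OF
      assms]
  by simp

lemma phi0_contract3:
  assumes "\<And>l m n. H m l n = - H l m n" "\<And>l m n. H l n m = - H l m n"
  shows "(\<Sum>l\<in>UNIV. \<Sum>m\<in>UNIV. \<Sum>n\<in>UNIV. phi0 (axis l 1) (axis m 1) (axis n 1) * H l m n) =
    6 * (H 1 2 3 - (H 1 4 5 + H 1 6 7) - (H 2 4 6 + H 2 7 5) - (H 3 4 7 + H 3 5 6))"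
  unfolding phi0_def distrib_right left_diff_distrib sum.distrib sum_subtractf
    e3_contract3[of H, OF assms] by simp

text \<open>Used to peel the forms off \<open>wedge223\<close> one at a time: a form evaluated on
  rows of the matrix is traded for its coefficients, while \<open>r p\<close> carries the factors
  not yet treated.\<close>

lemma bilinear_sum_expand:
  fixes \<alpha> :: "real^'n \<Rightarrow> real^'n \<Rightarrow> real"
  assumes "\<And>w. linear (\<lambda>u. \<alpha> u w)" "\<And>u. linear (\<lambda>w. \<alpha> u w)"
  shows "(\<Sum>a\<in>UNIV. \<Sum>b\<in>UNIV. \<alpha> (axis a 1) (axis b 1) * (\<Sum>p\<in>P. s p * (u p $ a * w p $ b * r p)))
    = (\<Sum>p\<in>P. s p * (\<alpha> (u p) (w p) * r p))"
proof -
  have ex: "\<alpha> u w = (\<Sum>a\<in>UNIV. \<Sum>b\<in>UNIV. u $ a * (w $ b * \<alpha> (axis a 1) (axis b 1)))" for u w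
    by (subst linear_axis_expansion[OF assms(1)], subst linear_axis_expansion[OF assms(2)])
      (simp add: sum_distrib_left)
  have "(\<Sum>a\<in>UNIV. \<Sum>b\<in>UNIV. \<alpha> (axis a 1) (axis b 1) * (\<Sum>p\<in>P. s p * (u p $ a * w p $ b * r p)))
    = (\<Sum>a\<in>UNIV. \<Sum>p\<in>P. \<Sum>b\<in>UNIV. \<alpha> (axis a 1) (axis b 1) * (s p * (u p $ a * w p $ b * r p)))"
    unfolding sum_distrib_left by (subst sum.swap) simp
  also have "\<dots> = (\<Sum>p\<in>P. \<Sum>a\<in>UNIV. \<Sum>b\<in>UNIV. \<alpha> (axis a 1) (axis b 1) * (s p * (u p $ a * w p $ b * r
      p)))"
    by (rule sum.swap)
  also have "\<dots> = (\<Sum>p\<in>P. s p * (\<alpha> (u p) (w p) * r p))"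
    by (rule sum.cong[OF refl], unfold ex[of "u _" "w _"]) (simp add: sum_distrib_left
        sum_distrib_right mult_ac)
  finally show ?thesis .
qed

lemma trilinear_sum_expand:
  fixes \<gamma> :: "real^'n \<Rightarrow> real^'n \<Rightarrow> real^'n \<Rightarrow> real"
  assumes "\<And>v w. linear (\<lambda>u. \<gamma> u v w)" "\<And>u w. linear (\<lambda>v. \<gamma> u v w)" "\<And>u v. linear (\<lambda>w. \<gamma> u v w)"
  shows "(\<Sum>a\<in>UNIV. \<Sum>b\<in>UNIV. \<Sum>c\<in>UNIV. \<gamma> (axis a 1) (axis b 1) (axis c 1)
       * (\<Sum>p\<in>P. s p * (u p $ a * v p $ b * w p $ c * r p)))
    = (\<Sum>p\<in>P. s p * (\<gamma> (u p) (v p) (w p) * r p))"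
proof -
  have ex: "\<gamma> u v w = (\<Sum>a\<in>UNIV. u $ a * \<gamma> (axis a 1) v w)" for u v w
    by (rule linear_axis_expansion[OF assms(1)])
  have "(\<Sum>b\<in>UNIV. \<Sum>c\<in>UNIV. \<gamma> (axis a 1) (axis b 1) (axis c 1)
       * (\<Sum>p\<in>P. s p * (u p $ a * v p $ b * w p $ c * r p)))
     = (\<Sum>p\<in>P. s p * (\<gamma> (axis a 1) (v p) (w p) * (u p $ a * r p)))" for a
    using bilinear_sum_expand[OF assms(2,3), where P=P and s=s and u=v and w=w and r="\<lambda>p. u p $ a
        * r p"]
    by (simp add: mult_ac)
  then have "(\<Sum>a\<in>UNIV. \<Sum>b\<in>UNIV. \<Sum>c\<in>UNIV. \<gamma> (axis a 1) (axis b 1) (axis c 1)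
       * (\<Sum>p\<in>P. s p * (u p $ a * v p $ b * w p $ c * r p)))
     = (\<Sum>p\<in>P. \<Sum>a\<in>UNIV. s p * (\<gamma> (axis a 1) (v p) (w p) * (u p $ a * r p)))"
    by (subst sum.swap) simp
  also have "\<dots> = (\<Sum>p\<in>P. s p * (\<gamma> (u p) (v p) (w p) * r p))"
    by (rule sum.cong[OF refl], unfold ex[of "u _" "v _" "w _"]) (simp add: sum_distrib_left
        sum_distrib_right mult_ac)
  finally show ?thesis .
qed

section \<open>The metric identity for the standard form\<close>

lemma wedge223_det_cols:
  fixes X Y :: "real^7"
  shows "wedge223 (phi0 X) (phi0 Y) phi0 v =
    (\<Sum>l\<in>UNIV. \<Sum>m\<in>UNIV. \<Sum>n\<in>UNIV. phi0 (axis l 1) (axis m 1) (axis n 1) *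
      (\<Sum>c\<in>UNIV. \<Sum>d\<in>UNIV. phi0 Y (axis c 1) (axis d 1) *
        (\<Sum>a\<in>UNIV. \<Sum>b\<in>UNIV. phi0 X (axis a 1) (axis b 1) * det_cols v a b c d l m n))) / 24"
proof -
  note lin = alternating3_linear[OF alternating3_phi0]
  let ?P = "{p. p permutes (UNIV :: 7 set)}"
  let ?s = "\<lambda>p. of_int (sign p) :: real"
  have D: "det_cols v a b c d l m n = (\<Sum>p\<in>?P. ?s p * (v$p 1$a * v$p 2$b *
      (v$p 3$c * v$p 4$d * (v$p 5$l * v$p 6$m * v$p 7$n))))" for a b c d l m n
    unfolding det_cols_sum by (simp only: mult.assoc)
  have 1: "(\<Sum>a\<in>UNIV. \<Sum>b\<in>UNIV. phi0 X (axis a 1) (axis b 1) * det_cols v a b c d l m n) =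
    (\<Sum>p\<in>?P. ?s p * (v$p 3$c * v$p 4$d * (phi0 X (v$p 1) (v$p 2) * (v$p 5$l * v$p 6$m * v$p
        7$n))))" for c d l m n
    unfolding D by (subst bilinear_sum_expand[OF lin(2,3)]) (simp only: mult_ac)
  have 2: "(\<Sum>c\<in>UNIV. \<Sum>d\<in>UNIV. phi0 Y (axis c 1) (axis d 1) *
     (\<Sum>p\<in>?P. ?s p * (v$p 3$c * v$p 4$d * (phi0 X (v$p 1) (v$p 2) * (v$p 5$l * v$p 6$m * v$p 7$n)))))
     = (\<Sum>p\<in>?P. ?s p * (v$p 5$l * v$p 6$m * v$p 7$n * (phi0 X (v$p 1) (v$p 2) * phi0 Y (v$p 3) (v$p
         4))))" for l m n
    by (subst bilinear_sum_expand[OF lin(2,3)]) (simp only: mult_ac)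
  have "(fact 2 * fact 2 * fact 3 :: real) = 24"
    by (simp add: fact_numeral)
  then show ?thesis
    unfolding 1 2 trilinear_sum_expand[OF lin] wedge223_def by (simp only: mult_ac)
qed

text \<open>The defining identity of metric and volume in the flat model: it identifies them as the
  Euclidean inner product and the determinant.\<close>

lemma wedge223_phi0: "wedge223 (phi0 X) (phi0 Y) phi0 v = 6 * (X \<bullet> Y) * det v"
proof -
  have 1: "(\<Sum>a\<in>UNIV. \<Sum>b\<in>UNIV. phi0 X (axis a 1) (axis b 1) * det_cols v a b c d l m n) =
    2 * ((X$1 * det_cols v 2 3 c d l m n + X$2 * det_cols v 3 1 c d l m n + X$3 * det_cols v 1 2 c
        d l m n)
     - (X$1 * det_cols v 4 5 c d l m n + X$4 * det_cols v 5 1 c d l m n + X$5 * det_cols v 1 4 c d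
         l m n)
     - (X$1 * det_cols v 6 7 c d l m n + X$6 * det_cols v 7 1 c d l m n + X$7 * det_cols v 1 6 c d
         l m n)
     - (X$2 * det_cols v 4 6 c d l m n + X$4 * det_cols v 6 2 c d l m n + X$6 * det_cols v 2 4 c d
         l m n)
     - (X$2 * det_cols v 7 5 c d l m n + X$7 * det_cols v 5 2 c d l m n + X$5 * det_cols v 2 7 c d
         l m n)
     - (X$3 * det_cols v 4 7 c d l m n + X$4 * det_cols v 7 3 c d l m n + X$7 * det_cols v 3 4 c d
         l m n)
     - (X$3 * det_cols v 5 6 c d l m n + X$5 * det_cols v 6 3 c d l m n + X$6 * det_cols v 3 5 c d
         l m n))"
     (is "?L c d l m n = ?A c d l m n") for c d l m n
    by (rule phi0_contract2) (rule det_cols_swap)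
  \<comment> \<open>\<open>B\<close> contracts the columns against both two-forms and is still
    alternating in \<open>l\<close>, \<open>m\<close>, \<open>n\<close>; the remaining contraction
    with \<open>phi0\<close> therefore needs only its seven monomials.\<close>
  define B where "B l m n = (\<Sum>c\<in>UNIV. \<Sum>d\<in>UNIV. phi0 Y (axis c 1) (axis d 1) * ?L c d l m n)" for l
      m n
  have L_swap: "?L d c l m n = - ?L c d l m n" "?L c d m l n = - ?L c d l m n"
    "?L c d l n m = - ?L c d l m n" for c d l m n
      apply (simp only: det_cols_swap(3)[of v _ _ d c] mult_minus_right sum_negf)
     apply (simp only: det_cols_swap(5)[of v _ _ _ _ m l] mult_minus_right sum_negf)
    apply (simp only: det_cols_swap(6)[of v _ _ _ _ _ n m] mult_minus_right sum_negf)
    done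
  have A_swap: "?A d c l m n = - ?A c d l m n" for c d l m n
    using L_swap(1)[of d c l m n] unfolding 1 .
  have B_swap: "B m l n = - B l m n" "B l n m = - B l m n" for l m n
    by (simp_all only: B_def L_swap(2)[where l=l and m=m and n=n] L_swap(3)[where l=l and m=m and
        n=n]
        mult_minus_right sum_negf)
  have B: "B l m n = 2 * ((Y$1 * ?A 2 3 l m n + Y$2 * ?A 3 1 l m n + Y$3 * ?A 1 2 l m n)
     - (Y$1 * ?A 4 5 l m n + Y$4 * ?A 5 1 l m n + Y$5 * ?A 1 4 l m n) - (Y$1 * ?A 6 7 l m n + Y$6
         * ?A 7 1 l m n + Y$7 * ?A 1 6 l m n)
     - (Y$2 * ?A 4 6 l m n + Y$4 * ?A 6 2 l m n + Y$6 * ?A 2 4 l m n) - (Y$2 * ?A 7 5 l m n + Y$7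
         * ?A 5 2 l m n + Y$5 * ?A 2 7 l m n)
     - (Y$3 * ?A 4 7 l m n + Y$4 * ?A 7 3 l m n + Y$7 * ?A 3 4 l m n) - (Y$3 * ?A 5 6 l m n + Y$5
         * ?A 6 3 l m n + Y$6 * ?A 3 5 l m n))" for l m n
    unfolding B_def 1 by (rule phi0_contract2) (rule A_swap)
  have "wedge223 (phi0 X) (phi0 Y) phi0 v =
    (B 1 2 3 - (B 1 4 5 + B 1 6 7) - (B 2 4 6 + B 2 7 5) - (B 3 4 7 + B 3 5 6)) / 4"
    unfolding wedge223_det_cols unfolding B_def[symmetric]
    unfolding phi0_contract3[of B, OF B_swap] by simp
  \<comment> \<open>Each monomial of \<open>phi0\<close> yields the part of
    \<open>X \<bullet> Y\<close> in its own three coordinates, with a sign that cancels against the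
    sign of the monomial. The triples form a Fano plane, so every coordinate occurs in exactly three
    of them and the total is \<open>3 * 8 / 4 = 6\<close>.\<close>
  also have "B 1 2 3 = 8 * (X$1*Y$1 + X$2*Y$2 + X$3*Y$3) * det v"
    unfolding B by (simp add: det_cols_sort det_cols_repeat det_cols_sorted) (simp add:
        algebra_simps)
  also have "B 1 4 5 = - 8 * (X$1*Y$1 + X$4*Y$4 + X$5*Y$5) * det v"
    unfolding B by (simp add: det_cols_sort det_cols_repeat det_cols_sorted) (simp add:
        algebra_simps)
  also have "B 1 6 7 = - 8 * (X$1*Y$1 + X$6*Y$6 + X$7*Y$7) * det v"
    unfolding B by (simp add: det_cols_sort det_cols_repeat det_cols_sorted) (simp add:
        algebra_simps)
  also have "B 2 4 6 = - 8 * (X$2*Y$2 + X$4*Y$4 + X$6*Y$6) * det v"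
    unfolding B by (simp add: det_cols_sort det_cols_repeat det_cols_sorted) (simp add:
        algebra_simps)
  also have "B 2 7 5 = - 8 * (X$2*Y$2 + X$7*Y$7 + X$5*Y$5) * det v"
    unfolding B by (simp add: det_cols_sort det_cols_repeat det_cols_sorted) (simp add:
        algebra_simps)
  also have "B 3 4 7 = - 8 * (X$3*Y$3 + X$4*Y$4 + X$7*Y$7) * det v"
    unfolding B by (simp add: det_cols_sort det_cols_repeat det_cols_sorted) (simp add:
        algebra_simps)
  also have "B 3 5 6 = - 8 * (X$3*Y$3 + X$5*Y$5 + X$6*Y$6) * det v"
    unfolding B by (simp add: det_cols_sort det_cols_repeat det_cols_sorted) (simp add:
        algebra_simps)
  finally show ?thesis
    by (simp add: inner_vec_def sum_7 algebra_simps)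
qed

section \<open>Hodge star and cross product of the standard form\<close>

lemma det_vector_7_repeat:
  fixes a b c d e f g :: "real^7"
  shows
  "det (vector [a, a, c, d, e, f, g]) = 0" "det (vector [a, b, a, d, e, f, g]) = 0"
  "det (vector [a, b, c, a, e, f, g]) = 0" "det (vector [a, b, c, d, a, f, g]) = 0"
  "det (vector [a, b, c, d, e, a, g]) = 0" "det (vector [a, b, c, d, e, f, a]) = 0"
  "det (vector [a, b, b, d, e, f, g]) = 0" "det (vector [a, b, c, b, e, f, g]) = 0"
  "det (vector [a, b, c, d, b, f, g]) = 0" "det (vector [a, b, c, d, e, b, g]) = 0"
  "det (vector [a, b, c, d, e, f, b]) = 0" "det (vector [a, b, c, c, e, f, g]) = 0"
  "det (vector [a, b, c, d, c, f, g]) = 0" "det (vector [a, b, c, d, e, c, g]) = 0"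
  "det (vector [a, b, c, d, e, f, c]) = 0" "det (vector [a, b, c, d, d, f, g]) = 0"
  "det (vector [a, b, c, d, e, d, g]) = 0" "det (vector [a, b, c, d, e, f, d]) = 0"
  "det (vector [a, b, c, d, e, e, g]) = 0" "det (vector [a, b, c, d, e, f, e]) = 0"
  "det (vector [a, b, c, d, e, f, f]) = 0"
  by (rule det_identical_rows[of 1 2] det_identical_rows[of 1 3] det_identical_rows[of 1 4]
      det_identical_rows[of 1 5] det_identical_rows[of 1 6] det_identical_rows[of 1 7]
      det_identical_rows[of 2 3] det_identical_rows[of 2 4] det_identical_rows[of 2 5]
      det_identical_rows[of 2 6] det_identical_rows[of 2 7] det_identical_rows[of 3 4]
      det_identical_rows[of 3 5] det_identical_rows[of 3 6] det_identical_rows[of 3 7]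
      det_identical_rows[of 4 5] det_identical_rows[of 4 6] det_identical_rows[of 4 7]
      det_identical_rows[of 5 6] det_identical_rows[of 5 7] det_identical_rows[of 6 7];
      simp add: row_def; fail)+

lemma linear_det_row:
  fixes A :: "real^'n^'n"
  shows "linear (\<lambda>u. det (\<chi> i. if i = k then u else A $ i))"
proof (rule linearI)
  fix u v
  show "det (\<chi> i. if i = k then u + v else A $ i) =
      det (\<chi> i. if i = k then u else A $ i) + det (\<chi> i. if i = k then v else A $ i)"
    using det_row_add[of k "\<lambda>_. u" "\<lambda>_. v" "\<lambda>i. A $ i"] by simp
next
  fix c u
  show "det (\<chi> i. if i = k then c *\<^sub>R u else A $ i) = c *\<^sub>R det (\<chi> i. if i = k then u else A $ i)"
    using det_row_mul[of k c "\<lambda>_. u" "\<lambda>i. A $ i"] unfolding scalar_mult_eq_scaleR by simp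
qed

lemma linear_det_vector_7:
  "linear (\<lambda>u :: real^7. det (vector [u, b, c, d, e, f, g]))"
  "linear (\<lambda>u :: real^7. det (vector [a, u, c, d, e, f, g]))"
  "linear (\<lambda>u :: real^7. det (vector [a, b, u, d, e, f, g]))"
  "linear (\<lambda>u :: real^7. det (vector [a, b, c, u, e, f, g]))"
  "linear (\<lambda>u :: real^7. det (vector [a, b, c, d, u, f, g]))"
  "linear (\<lambda>u :: real^7. det (vector [a, b, c, d, e, u, g]))"
  "linear (\<lambda>u :: real^7. det (vector [a, b, c, d, e, f, u]))"
proof -
  have *: "linear (\<lambda>u. det (N u))"
    if "\<And>u. \<forall>i. N u $ i = (if i = k then u else N 0 $ i)" for N :: "real^7 \<Rightarrow> real^7^7" and k
  proof -
    have "N = (\<lambda>u. \<chi> i. if i = k then u else N 0 $ i)"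
      using that by (simp add: fun_eq_iff vec_eq_iff)
    then show ?thesis
      using linear_det_row[of k "N 0"] by metis
  qed
  show "linear (\<lambda>u :: real^7. det (vector [u, b, c, d, e, f, g]))"
    by (rule *[of _ 1]) (simp add: forall_7)
  show "linear (\<lambda>u :: real^7. det (vector [a, u, c, d, e, f, g]))"
    by (rule *[of _ 2]) (simp add: forall_7)
  show "linear (\<lambda>u :: real^7. det (vector [a, b, u, d, e, f, g]))"
    by (rule *[of _ 3]) (simp add: forall_7)
  show "linear (\<lambda>u :: real^7. det (vector [a, b, c, u, e, f, g]))"
    by (rule *[of _ 4]) (simp add: forall_7)
  show "linear (\<lambda>u :: real^7. det (vector [a, b, c, d, u, f, g]))"
    by (rule *[of _ 5]) (simp add: forall_7)
  show "linear (\<lambda>u :: real^7. det (vector [a, b, c, d, e, u, g]))"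
    by (rule *[of _ 6]) (simp add: forall_7)
  show "linear (\<lambda>u :: real^7. det (vector [a, b, c, d, e, f, u]))"
    by (rule *[of _ 7]) (simp add: forall_7)
qed

text \<open>The Hodge star of \<open>phi0\<close>: each term \<open>e\<^sup>i\<^sup>j\<^sup>k\<close> of \<open>phi0\<close> contributes the determinant with first
  rows \<open>e\<^sub>i, e\<^sub>j, e\<^sub>k\<close>.\<close>

definition psi0 :: "7 form4" where
  "psi0 u1 u2 u3 u4 =
     det (vector [axis 1 1, axis 2 1, axis 3 1, u1, u2, u3, u4])
     - (det (vector [axis 1 1, axis 4 1, axis 5 1, u1, u2, u3, u4])
        + det (vector [axis 1 1, axis 6 1, axis 7 1, u1, u2, u3, u4]))
     - (det (vector [axis 2 1, axis 4 1, axis 6 1, u1, u2, u3, u4])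
        + det (vector [axis 2 1, axis 7 1, axis 5 1, u1, u2, u3, u4]))
     - (det (vector [axis 3 1, axis 4 1, axis 7 1, u1, u2, u3, u4])
        + det (vector [axis 3 1, axis 5 1, axis 6 1, u1, u2, u3, u4]))"

definition cross0 :: "real^7 \<Rightarrow> real^7 \<Rightarrow> real^7" where
  "cross0 u v = (\<chi> k. phi0 u v (axis k 1))"

lemma det_axes:
  "det (vector [axis a (1::real), axis b 1, axis c 1, axis d 1, axis e 1, axis f 1, axis g 1])
     = det_cols (mat 1) a b c d e f g"
proof -
  have "column i (mat 1 :: real^7^7) = axis i 1" for i
    by (simp add: vec_eq_iff column_def mat_def axis_def)
  then show ?thesis by (simp add: det_cols_def)
qed

text \<open>\<open>D a b c d\<close> is a four-by-four minor in Laplace expansion, so this is the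
  usual expression e4567 - e2367 - e2345 - e1357 + e1346 - e1256 - e1247 of the dual four-form. The
  explicit polynomial is what \<open>cross0_cross0\<close> is checked against.\<close>

lemma psi0_expand:
  fixes u v w x :: "real^7"
  defines "D \<equiv> \<lambda>a b c d.
    u$a * (v$b * (w$c * x$d - w$d * x$c) - v$c * (w$b * x$d - w$d * x$b) + v$d * (w$b * x$c - w$c
        * x$b))
  - u$b * (v$a * (w$c * x$d - w$d * x$c) - v$c * (w$a * x$d - w$d * x$a) + v$d * (w$a * x$c - w$c
      * x$a))
  + u$c * (v$a * (w$b * x$d - w$d * x$b) - v$b * (w$a * x$d - w$d * x$a) + v$d * (w$a * x$b - w$b
      * x$a))
  - u$d * (v$a * (w$b * x$c - w$c * x$b) - v$b * (w$a * x$c - w$c * x$a) + v$c * (w$a * x$b - w$b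
      * x$a))"
  shows "psi0 u v w x = D 4 5 6 7 - D 2 3 6 7 - D 2 3 4 5 - D 1 3 5 7 + D 1 3 4 6 - D 1 2 5 6 - D
      1 2 4 7"
proof -
  have S1: "det (vector [p, q, r, u, b, c, d]) = (\<Sum>i\<in>UNIV. u $ i * det (vector [p, q, r, axis i 1,
      b, c, d]))" for p q r b c d
    by (rule linear_axis_expansion[OF linear_det_vector_7(4)])
  have S2: "det (vector [p, q, r, a, v, c, d]) = (\<Sum>i\<in>UNIV. v $ i * det (vector [p, q, r, a, axis i
      1, c, d]))" for p q r a c d
    by (rule linear_axis_expansion[OF linear_det_vector_7(5)])
  have S3: "det (vector [p, q, r, a, b, w, d]) = (\<Sum>i\<in>UNIV. w $ i * det (vector [p, q, r, a, b,
      axis i 1, d]))" for p q r a b d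
    by (rule linear_axis_expansion[OF linear_det_vector_7(6)])
  have S4: "det (vector [p, q, r, a, b, c, x]) = (\<Sum>i\<in>UNIV. x $ i * det (vector [p, q, r, a, b, c,
      axis i 1]))" for p q r a b c
    by (rule linear_axis_expansion[OF linear_det_vector_7(7)])
  \<comment> \<open>Rows are expanded one at a time and determinants with a repeated row dropped at
    once; only the 24 orderings of the four complementary axes survive, not \<open>7 ^ 4\<close>
    terms.\<close>
  note z = det_vector_7_repeat mult_zero_right add_0_left add_0_right sum_7
  note s = det_axes det_cols_sort rank7_numeral det_cols_sorted det_I mult_minus_right mult_1_right
  have 1: "det (vector [axis 1 1, axis 2 1, axis 3 1, u, v, w, x]) = D 4 5 6 7"
    unfolding D_def by (simp only: S1 z, simp only: S2 z, simp only: S3 z, simp only: S4 z, simp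
        add: s) (simp add: algebra_simps)
  have 2: "det (vector [axis 1 1, axis 4 1, axis 5 1, u, v, w, x]) = D 2 3 6 7"
    unfolding D_def by (simp only: S1 z, simp only: S2 z, simp only: S3 z, simp only: S4 z, simp
        add: s) (simp add: algebra_simps)
  have 3: "det (vector [axis 1 1, axis 6 1, axis 7 1, u, v, w, x]) = D 2 3 4 5"
    unfolding D_def by (simp only: S1 z, simp only: S2 z, simp only: S3 z, simp only: S4 z, simp
        add: s) (simp add: algebra_simps)
  have 4: "det (vector [axis 2 1, axis 4 1, axis 6 1, u, v, w, x]) = D 1 3 5 7"
    unfolding D_def by (simp only: S1 z, simp only: S2 z, simp only: S3 z, simp only: S4 z, simp
        add: s) (simp add: algebra_simps)
  have 5: "det (vector [axis 2 1, axis 7 1, axis 5 1, u, v, w, x]) = - D 1 3 4 6"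
    unfolding D_def by (simp only: S1 z, simp only: S2 z, simp only: S3 z, simp only: S4 z, simp
        add: s) (simp add: algebra_simps)
  have 6: "det (vector [axis 3 1, axis 4 1, axis 7 1, u, v, w, x]) = D 1 2 5 6"
    unfolding D_def by (simp only: S1 z, simp only: S2 z, simp only: S3 z, simp only: S4 z, simp
        add: s) (simp add: algebra_simps)
  have 7: "det (vector [axis 3 1, axis 5 1, axis 6 1, u, v, w, x]) = D 1 2 4 7"
    unfolding D_def by (simp only: S1 z, simp only: S2 z, simp only: S3 z, simp only: S4 z, simp
        add: s) (simp add: algebra_simps)
  show ?thesis
    unfolding psi0_def 1 2 3 4 5 6 7 by simp
qed

lemma cross0_inner: "cross0 u v \<bullet> x = phi0 u v x"
  by (subst linear_axis_expansion[OF alternating3_linear(3)[OF alternating3_phi0]])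
    (simp add: cross0_def inner_vec_def mult.commute)

lemma phi0_expand: "phi0 u v w =
  (u$1 * v$2 * w$3 + v$1 * w$2 * u$3 + w$1 * u$2 * v$3 - u$1 * w$2 * v$3 - v$1 * u$2 * w$3 - w$1 *
      v$2 * u$3)
  - (u$1 * v$4 * w$5 + v$1 * w$4 * u$5 + w$1 * u$4 * v$5 - u$1 * w$4 * v$5 - v$1 * u$4 * w$5 - w$1
      * v$4 * u$5)
  - (u$1 * v$6 * w$7 + v$1 * w$6 * u$7 + w$1 * u$6 * v$7 - u$1 * w$6 * v$7 - v$1 * u$6 * w$7 - w$1
      * v$6 * u$7)
  - (u$2 * v$4 * w$6 + v$2 * w$4 * u$6 + w$2 * u$4 * v$6 - u$2 * w$4 * v$6 - v$2 * u$4 * w$6 - w$2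
      * v$4 * u$6)
  - (u$2 * v$7 * w$5 + v$2 * w$7 * u$5 + w$2 * u$7 * v$5 - u$2 * w$7 * v$5 - v$2 * u$7 * w$5 - w$2
      * v$7 * u$5)
  - (u$3 * v$4 * w$7 + v$3 * w$4 * u$7 + w$3 * u$4 * v$7 - u$3 * w$4 * v$7 - v$3 * u$4 * w$7 - w$3
      * v$4 * u$7)
  - (u$3 * v$5 * w$6 + v$3 * w$5 * u$6 + w$3 * u$5 * v$6 - u$3 * w$5 * v$6 - v$3 * u$5 * w$6 - w$3
      * v$5 * u$6)"
  unfolding phi0_def e3_expand by simp

lemma cross0_component:
  "cross0 u v $ 1 = u$2* v$3 - u$3* v$2 - u$4* v$5 + u$5* v$4 - u$6* v$7 + u$7* v$6"
  "cross0 u v $ 2 = u$3* v$1 - u$1* v$3 - u$4* v$6 + u$6* v$4 - u$7* v$5 + u$5* v$7"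
  "cross0 u v $ 3 = u$1* v$2 - u$2* v$1 - u$4* v$7 + u$7* v$4 - u$5* v$6 + u$6* v$5"
  "cross0 u v $ 4 = - u$5* v$1 + u$1* v$5 - u$6* v$2 + u$2* v$6 - u$7* v$3 + u$3* v$7"
  "cross0 u v $ 5 = - u$1* v$4 + u$4* v$1 - u$2* v$7 + u$7* v$2 - u$6* v$3 + u$3* v$6"
  "cross0 u v $ 6 = - u$7* v$1 + u$1* v$7 - u$2* v$4 + u$4* v$2 - u$3* v$5 + u$5* v$3"
  "cross0 u v $ 7 = - u$1* v$6 + u$6* v$1 - u$5* v$2 + u$2* v$5 - u$3* v$4 + u$4* v$3"
  unfolding cross0_def phi0_expand by (simp_all add: axis_def algebra_simps)

text \<open>The Lagrange identity of the seven-dimensional cross product. It gives both the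
  calibration inequality and the fact that a vanishing product means parallel factors.\<close>

lemma cross0_norm: "cross0 u v \<bullet> cross0 u v = (u \<bullet> u) * (v \<bullet> v) - (u \<bullet> v)\<^sup>2"
  unfolding inner_vec_def inner_real_def sum_7 cross0_component power2_eq_square
  by (simp add: algebra_simps)

text \<open>The last two terms are the three-dimensional rule for an iterated cross product;
  \<open>psi0\<close> measures by how much that rule fails in dimension seven.\<close>

lemma cross0_cross0:
  "x \<bullet> cross0 u (cross0 v w) = psi0 x u v w - (u \<bullet> v) * (x \<bullet> w) + (u \<bullet> w) * (x \<bullet> v)"
  unfolding inner_vec_def inner_real_def sum_7 cross0_component psi0_expand
  by (simp add: algebra_simps)

section \<open>Metric, volume and Hodge star of a \<open>G\<^sub>2\<close>-form\<close>

definition pullback_metric :: "(real^'n \<Rightarrow> real^'n) \<Rightarrow> 'n::finite form2" where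
  "pullback_metric e X Y = e X \<bullet> e Y"

definition pullback_volume :: "(real^7 \<Rightarrow> real^7) \<Rightarrow> real^7^7 \<Rightarrow> real" where
  "pullback_volume e v = det (\<chi> i. e (v $ i))"

definition pullback3 :: "(real^'n \<Rightarrow> real^'n) \<Rightarrow> 'n form3 \<Rightarrow> 'n::finite form3" where
  "pullback3 e \<phi> u v w = \<phi> (e u) (e v) (e w)"

lemma G2_form_iff: "G2_form \<phi> \<longleftrightarrow> (\<exists>e. linear e \<and> bij e \<and> \<phi> = pullback3 e phi0)"
  unfolding G2_form_def pullback3_def fun_eq_iff by blast

lemma orthonormal_frame_pullback:
  "orthonormal_frame (pullback_metric e) E \<longleftrightarrow> orthogonal_matrix (\<chi> i. e (E $ i))"
proof -
  have "orthogonal_matrix R \<longleftrightarrow> (\<forall>i j. R $ i \<bullet> R $ j = (if i = j then 1 else 0))" for R ::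
      "real^'a^'a"
    unfolding orthogonal_matrix_orthonormal_rows row_def orthogonal_def norm_eq_1
    by (auto simp: vec_nth_inverse)
  then show ?thesis
    by (simp add: orthonormal_frame_def pullback_metric_def)
qed

lemma inner_product_pullback:
  assumes "linear e" "bij e"
  shows "inner_product (pullback_metric e)"
proof -
  have "e u \<noteq> 0" if "u \<noteq> 0" for u
    using assms that by (metis bij_is_inj linear_0 injD)
  moreover have "linear (\<lambda>u. e u \<bullet> e v)" for v
    using assms(1) by (auto intro!: linearI simp: linear_add linear_cmul inner_add_left)
  ultimately show ?thesis
    by (simp add: inner_product_def pullback_metric_def inner_commute)
qed

lemma G2_metric_volume_pullback:
  assumes "linear e" "bij e"
  shows "G2_metric_volume (pullback3 e phi0) (pullback_metric e) (pullback_volume e)"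
proof -
  have "\<bar>pullback_volume e E\<bar> = 1" if "orthonormal_frame (pullback_metric e) E" for E
    using det_orthogonal_matrix[of "\<chi> i. e (E $ i)"] that
    by (auto simp: orthonormal_frame_pullback pullback_volume_def)
  moreover have "wedge223 (pullback3 e phi0 X) (pullback3 e phi0 Y) (pullback3 e phi0) v =
      wedge223 (phi0 (e X)) (phi0 (e Y)) phi0 (\<chi> i. e (v $ i))" for X Y v
    by (simp add: wedge223_def pullback3_def)
  ultimately show ?thesis
    using inner_product_pullback[OF assms]
    by (simp add: G2_metric_volume_def wedge223_phi0 pullback_metric_def pullback_volume_def)
qed

lemma standard_frame:
  assumes "linear e" "bij e"
  obtains E where "orthonormal_frame (pullback_metric e) E" "pullback_volume e E = 1"
proof
  let ?E = "\<chi> i. inv e (axis i 1)"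
  have "(\<chi> i. e (?E $ i)) = (mat 1 :: real^7^7)"
    using assms(2) by (simp add: bij_is_surj surj_f_inv_f vec_eq_iff mat_def axis_def)
  then show "orthonormal_frame (pullback_metric e) ?E" "pullback_volume e ?E = 1"
    by (simp_all add: orthonormal_frame_pullback pullback_volume_def orthogonal_matrix_id)
qed

lemma pullback_volume_scale:
  assumes "linear e"
  shows "pullback_volume e (\<chi> i. c *\<^sub>R (E $ i)) = c ^ 7 * pullback_volume e E"
proof -
  have "pullback_volume e (\<chi> i. c *\<^sub>R (E $ i)) = det (\<chi> i. c *s e (E $ i))"
    by (simp add: pullback_volume_def linear_cmul[OF assms] scalar_mult_eq_scaleR)
  then show ?thesis
    by (simp add: det_rows_mul[of "\<lambda>_. c"] pullback_volume_def prod_7 power_numeral_reduce)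
qed

text \<open>The defining equation fixes only the product of \<open>g\<close> and \<open>vol\<close>,
  which leaves a scaling by a constant \<open>c\<close>. Normalising \<open>vol\<close> on
  orthonormal frames removes it: rescaling a frame by \<open>sqrt c\<close> costs
  \<open>sqrt c ^ 7\<close>, and with the factor \<open>c\<close> of \<open>vol\<close> this gives
  \<open>sqrt c ^ 9 = 1\<close>.\<close>

lemma G2_metric_volume_unique:
  assumes e: "linear e" "bij e" and gv: "G2_metric_volume (pullback3 e phi0) g vol"
  shows "g = pullback_metric e" "vol = pullback_volume e"
proof -
  let ?g = "pullback_metric e" and ?v = "pullback_volume e"
  have eq: "g X Y * vol v = ?g X Y * ?v v" for X Y v
  proof -
    have "6 * g X Y * vol v = 6 * ?g X Y * ?v v"
      using gv G2_metric_volume_pullback[OF e] unfolding G2_metric_volume_def by metis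
    then show ?thesis by simp
  qed
  obtain E where E: "orthonormal_frame ?g E" "?v E = 1"
    using standard_frame[OF e] .
  define c where "c = vol E"
  have gc: "c * g X Y = ?g X Y" for X Y
    using eq[of X Y E] E by (simp add: c_def mult.commute)
  have ip: "inner_product g" "inner_product ?g"
    using gv inner_product_pullback[OF e] by (auto simp: G2_metric_volume_def)
  have pos: "g (axis 1 1) (axis 1 1) > 0" "?g (axis 1 1) (axis 1 1) > 0"
    using ip by (auto simp: inner_product_def axis_eq_0_iff)
  have "c > 0"
    using gc[of "axis 1 1" "axis 1 1"] pos by (metis zero_less_mult_pos2)
  have volc: "vol v = c * ?v v" for v
  proof -
    have "g (axis 1 1) (axis 1 1) * vol v = g (axis 1 1) (axis 1 1) * (c * ?v v)"
      unfolding eq by (simp flip: gc)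
    then show ?thesis using pos(1) by simp
  qed
  define E' where "E' = (\<chi> i. sqrt c *\<^sub>R (E $ i))"
  have lin: "linear (\<lambda>u. g u v)" and sym: "g u v = g v u" for u v
    using ip by (auto simp: inner_product_def)
  have "g (a *\<^sub>R u) (b *\<^sub>R v) = a * b * g u v" for a b u v
    using linear_cmul[OF lin[of "b *\<^sub>R v"], of a u] linear_cmul[OF lin[of u], of b v] sym[of u v]
      sym[of u "b *\<^sub>R v"] by simp
  then have "g (E' $ i) (E' $ j) = c * g (E $ i) (E $ j)" for i j
    using \<open>c > 0\<close> by (simp add: E'_def)
  then have "orthonormal_frame g E'"
    using E(1) by (simp add: orthonormal_frame_def gc)
  then have "\<bar>vol E'\<bar> = 1"
    using gv by (simp add: G2_metric_volume_def)
  then have "c * sqrt c ^ 7 = 1"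
    using \<open>c > 0\<close> E(2) by (simp add: volc E'_def pullback_volume_scale[OF e(1)])
  moreover have "c * sqrt c ^ 7 = sqrt c ^ 9"
    using \<open>c > 0\<close> by (simp add: power_numeral_reduce)
  ultimately have "sqrt c ^ 9 = 1 ^ 9" by simp
  then have "sqrt c = 1"
    by (rule power_eq_imp_eq_base) (use \<open>c > 0\<close> in auto)
  then have "c = 1" by simp
  then show "g = ?g" "vol = ?v"
    using gc volc by (auto simp: fun_eq_iff)
qed

lemma G2_metric_pullback:
  assumes "linear e" "bij e"
  shows "G2_metric (pullback3 e phi0) = pullback_metric e"
    and "G2_volume (pullback3 e phi0) = pullback_volume e"
  unfolding G2_metric_def G2_volume_def
  by (rule the_equality; use G2_metric_volume_pullback[OF assms] G2_metric_volume_unique[OF assms]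
      in blast)+

section \<open>Independence of the Hodge star from the frame\<close>

text \<open>Invariance of the trace under a change of orthonormal basis; it holds because the
  columns of an orthogonal matrix are orthonormal as well.\<close>

lemma sum_orthogonal_rows:
  fixes R :: "real^'n^'n"
  assumes R: "orthogonal_matrix R" and B: "\<And>v. linear (\<lambda>u. B u v)" "\<And>u. linear (\<lambda>v. B u v)"
  shows "(\<Sum>i\<in>UNIV. B (R $ i) (R $ i)) = (\<Sum>i\<in>UNIV. B (axis i 1) (axis i 1 :: real^'n) :: real)"
proof -
  have "(\<Sum>i\<in>UNIV. R $ i $ a * R $ i $ b) = (Finite_Cartesian_Product.transpose R ** R) $ a $ b"
      for a b
    by (simp add: matrix_matrix_mult_def Finite_Cartesian_Product.transpose_def)
  then have d: "(\<Sum>i\<in>UNIV. R $ i $ a * R $ i $ b) = (if a = b then 1 else 0)" for a b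
    using R by (simp add: orthogonal_matrix mat_def)
  have "B u u = (\<Sum>a\<in>UNIV. \<Sum>b\<in>UNIV. u $ a * u $ b * B (axis a 1) (axis b 1))" for u
    by (subst linear_axis_expansion[OF B(1)], subst linear_axis_expansion[OF B(2)])
      (simp add: sum_distrib_left mult.assoc)
  then have "(\<Sum>i\<in>UNIV. B (R $ i) (R $ i)) =
      (\<Sum>i\<in>UNIV. \<Sum>a\<in>UNIV. \<Sum>b\<in>UNIV. R $ i $ a * R $ i $ b * B (axis a 1) (axis b 1))"
    by simp
  also have "\<dots> = (\<Sum>a\<in>UNIV. \<Sum>b\<in>UNIV. \<Sum>i\<in>UNIV. R $ i $ a * R $ i $ b * B (axis a 1) (axis b 1))"
    by (subst sum.swap) (intro sum.cong refl sum.swap)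
  also have "\<dots> = (\<Sum>a\<in>UNIV. \<Sum>b\<in>UNIV. (if a = b then 1 else 0) * B (axis a 1) (axis b 1))"
    unfolding sum_distrib_right[symmetric] d ..
  finally show ?thesis by (simp add: mult_delta_left)
qed

lemma linear_mult_const:
  fixes f :: "'a::real_vector \<Rightarrow> real"
  assumes "linear f"
  shows "linear (\<lambda>u. f u * c)" "linear (\<lambda>u. c * f u)"
  using assms by (simp_all add: linear_iff algebra_simps)

text \<open>Makes \<open>hodge_star3\<close> computable although its frame is an arbitrary choice.
  The three summation indices are moved to the standard basis one after the other.\<close>

lemma sum_orthogonal_rows3:
  fixes R :: "real^'n^'n" and S T :: "'n form3"
  assumes R: "orthogonal_matrix R"
    and S: "\<And>v w. linear (\<lambda>u. S u v w)" "\<And>u w. linear (\<lambda>v. S u v w)" "\<And>u v. linear (\<lambda>w. S u v w)"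
    and T: "\<And>v w. linear (\<lambda>u. T u v w)" "\<And>u w. linear (\<lambda>v. T u v w)" "\<And>u v. linear (\<lambda>w. T u v w)"
  shows "(\<Sum>i\<in>UNIV. \<Sum>j\<in>UNIV. \<Sum>k\<in>UNIV. S (R $ i) (R $ j) (R $ k) * T (R $ i) (R $ j) (R $ k)) =
    (\<Sum>i\<in>UNIV. \<Sum>j\<in>UNIV. \<Sum>k\<in>UNIV.
       S (axis i 1) (axis j 1) (axis k 1) * T (axis i 1) (axis j 1) (axis k 1))"
proof -
  have 1: "(\<Sum>k\<in>UNIV. S u v (R $ k) * T u v (R $ k)) = (\<Sum>k\<in>UNIV. S u v (axis k 1) * T u v (axis k
      1))" for u v
    by (rule sum_orthogonal_rows[OF R, where B = "\<lambda>x y. S u v x * T u v y"])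
      (intro linear_mult_const S T)+
  have 2: "(\<Sum>j\<in>UNIV. \<Sum>k\<in>UNIV. S u (R $ j) (axis k 1) * T u (R $ j) (axis k 1)) =
    (\<Sum>j\<in>UNIV. \<Sum>k\<in>UNIV. S u (axis j 1) (axis k 1) * T u (axis j 1) (axis k 1))" for u
    by (rule sum_orthogonal_rows[OF R, where B = "\<lambda>x y. \<Sum>k\<in>UNIV. S u x (axis k 1) * T u y (axis k
        1)"])
      (intro linear_compose_sum ballI linear_mult_const S T)+
  have 3: "(\<Sum>i\<in>UNIV. \<Sum>j\<in>UNIV. \<Sum>k\<in>UNIV. S (R $ i) (axis j 1) (axis k 1) * T (R $ i) (axis j 1)
      (axis k 1)) =
    (\<Sum>i\<in>UNIV. \<Sum>j\<in>UNIV. \<Sum>k\<in>UNIV.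
       S (axis i 1) (axis j 1) (axis k 1) * T (axis i 1) (axis j 1) (axis k 1))"
    by (rule sum_orthogonal_rows[OF R, where
          B = "\<lambda>x y. \<Sum>j\<in>UNIV. \<Sum>k\<in>UNIV. S x (axis j 1) (axis k 1) * T y (axis j 1) (axis k 1)"])
      (intro linear_compose_sum ballI linear_mult_const S T)+
  show ?thesis
    unfolding 1 2 3 ..
qed

lemma hodge_star3_pullback:
  assumes e: "linear e" "bij e"
  shows "hodge_star3 (G2_metric (pullback3 e phi0)) (G2_volume (pullback3 e phi0)) (pullback3 e
      phi0) u1 u2 u3 u4
    = psi0 (e u1) (e u2) (e u3) (e u4)"
proof -
  define E where "E = (SOME E. orthonormal_frame (pullback_metric e) E \<and> pullback_volume e E = 1)"
  have E: "orthonormal_frame (pullback_metric e) E"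
    unfolding E_def using standard_frame[OF e] by (metis (mono_tags, lifting) someI_ex)
  define R where "R = (\<chi> i. e (E $ i))"
  have R: "orthogonal_matrix R"
    using E by (simp add: orthonormal_frame_pullback R_def)
  have eR: "e (E $ i) = R $ i" for i by (simp add: R_def)
  let ?d = "\<lambda>x y z. det (vector [x, y, z, e u1, e u2, e u3, e u4])"
  note lin = alternating3_linear[OF alternating3_phi0]
  have pv: "pullback_volume e (vector [E $ i, E $ j, E $ k, u1, u2, u3, u4]) = ?d (R $ i) (R $ j)
      (R $ k)" for i j k
  proof -
    have "(\<chi> l. e (vector [E $ i, E $ j, E $ k, u1, u2, u3, u4] $ l))
        = (vector [R $ i, R $ j, R $ k, e u1, e u2, e u3, e u4] :: real^7^7)"
      by (simp add: vec_eq_iff forall_7 eR)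
    then show ?thesis by (simp add: pullback_volume_def)
  qed
  have "hodge_star3 (G2_metric (pullback3 e phi0)) (G2_volume (pullback3 e phi0)) (pullback3 e
      phi0) u1 u2 u3 u4
    = (\<Sum>i\<in>UNIV. \<Sum>j\<in>UNIV. \<Sum>k\<in>UNIV. phi0 (R $ i) (R $ j) (R $ k) * ?d (R $ i) (R $ j) (R $ k)) / 6"
    unfolding hodge_star3_def G2_metric_pullback[OF e] E_def[symmetric] Let_def pv
    by (simp add: pullback3_def fact_numeral eR)
  also have "(\<Sum>i\<in>UNIV. \<Sum>j\<in>UNIV. \<Sum>k\<in>UNIV. phi0 (R $ i) (R $ j) (R $ k) * ?d (R $ i) (R $ j) (R $ k))
    = (\<Sum>i\<in>UNIV. \<Sum>j\<in>UNIV. \<Sum>k\<in>UNIV. phi0 (axis i 1) (axis j 1) (axis k 1) * ?d (axis i 1) (axis j 1)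
        (axis k 1))"
    by (rule sum_orthogonal_rows3[OF R]) (rule lin linear_det_vector_7)+
  also have "\<dots> = 6 * psi0 (e u1) (e u2) (e u3) (e u4)"
    unfolding psi0_def
    by (rule phi0_contract3[where H = "\<lambda>i j k. ?d (axis i 1) (axis j 1) (axis k 1)"]) (rule
        det_vector_7_swap)+
  finally show ?thesis by simp
qed

section \<open>Closure under the cross product and vanishing of \<open>psi0\<close>\<close>

text \<open>By \<open>cross0_norm\<close> a vanishing cross product is the equality case of
  Cauchy-Schwarz. The conclusion avoids division so that \<open>u = 0\<close> is included.\<close>

lemma cauchy_schwarz_cross0:
  assumes "cross0 u n = 0"
  shows "(u \<bullet> u) *\<^sub>R n = (u \<bullet> n) *\<^sub>R u"
proof -
  have 0: "(u \<bullet> u) * (n \<bullet> n) = (u \<bullet> n)\<^sup>2"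
    using cross0_norm[of u n] assms by simp
  let ?z = "(u \<bullet> u) *\<^sub>R n - (u \<bullet> n) *\<^sub>R u"
  have "?z \<bullet> ?z = (u \<bullet> u) * ((u \<bullet> u) * (n \<bullet> n)) - (u \<bullet> u) * (u \<bullet> n)\<^sup>2"
    by (simp add: inner_diff_left inner_diff_right inner_commute power2_eq_square algebra_simps)
  then have "?z = 0" unfolding 0 by simp
  then show ?thesis by simp
qed

lemma linearly_dependent3_perm:
  "linearly_dependent3 v w u \<longleftrightarrow> linearly_dependent3 u v w"
proof
  assume "linearly_dependent3 v w u"
  then obtain a b c where "(a, b, c) \<noteq> (0, 0, 0)" "a *\<^sub>R v + b *\<^sub>R w + c *\<^sub>R u = 0"
    unfolding linearly_dependent3_def by blast
  then have "(c, a, b) \<noteq> (0, 0, 0) \<and> c *\<^sub>R u + a *\<^sub>R v + b *\<^sub>R w = 0"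
    by (auto simp: algebra_simps)
  then show "linearly_dependent3 u v w"
    unfolding linearly_dependent3_def by blast
next
  assume "linearly_dependent3 u v w"
  then obtain a b c where "(a, b, c) \<noteq> (0, 0, 0)" "a *\<^sub>R u + b *\<^sub>R v + c *\<^sub>R w = 0"
    unfolding linearly_dependent3_def by blast
  then have "(b, c, a) \<noteq> (0, 0, 0) \<and> b *\<^sub>R v + c *\<^sub>R w + a *\<^sub>R u = 0"
    by (auto simp: algebra_simps)
  then show "linearly_dependent3 v w u"
    unfolding linearly_dependent3_def by blast
qed

lemma independent3_coeffs:
  assumes "\<not> linearly_dependent3 u v w" "a *\<^sub>R u + b *\<^sub>R v + c *\<^sub>R w = 0"
  shows "a = 0" "b = 0" "c = 0"
  using assms unfolding linearly_dependent3_def by (metis prod.inject)+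

lemma span_triple: "span {u, v, w} = {a *\<^sub>R u + b *\<^sub>R v + c *\<^sub>R w |a b c. True}"
  by (auto simp: span_insert span_breakdown_eq algebra_simps)

text \<open>Dependence is a property of the family here, while \<open>independent\<close> speaks of
  the set; hence both directions first show that the three vectors are distinct.\<close>

lemma dim_span_triple: "dim (span {u, v, w}) = 3 \<longleftrightarrow> \<not> linearly_dependent3 u v (w ::
    'a::euclidean_space)"
proof
  assume d: "dim (span {u, v, w}) = 3"
  then have d: "dim {u, v, w} = 3" by simp
  then have "3 \<le> card {u, v, w}"
    using dim_le_card'[of "{u, v, w}"] by simp
  then have ne: "u \<noteq> v" "u \<noteq> w" "v \<noteq> w"
    by (auto simp: card_insert_if split: if_splits)
  then have "card {u, v, w} = 3" by simp
  then have ind: "independent {u, v, w}"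
    using card_le_dim_spanning[of "{u, v, w}" "span {u, v, w}"] d by (simp add: span_superset)
  show "\<not> linearly_dependent3 u v w"
  proof
    assume "linearly_dependent3 u v w"
    then obtain a b c where abc: "(a, b, c) \<noteq> (0, 0, 0)" "a *\<^sub>R u + b *\<^sub>R v + c *\<^sub>R w = 0"
      unfolding linearly_dependent3_def by blast
    let ?f = "\<lambda>x. if x = u then a else if x = v then b else c"
    have s: "(\<Sum>x\<in>{u, v, w}. ?f x *\<^sub>R x) = 0"
      using ne abc(2) by (simp add: add.assoc)
    have "(\<Sum>x\<in>{u, v, w}. f x *\<^sub>R x) = 0 \<Longrightarrow> \<forall>x\<in>{u, v, w}. f x = 0" for f
      using ind unfolding independent_explicit by blast
    from this[OF s] show False using ne abc(1) by auto
  qed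
next
  assume nd: "\<not> linearly_dependent3 u v w"
  note i = independent3_coeffs[OF nd]
  have ne: "u \<noteq> v" "u \<noteq> w" "v \<noteq> w"
    using i(1)[of 1 "-1" 0] i(1)[of 1 0 "-1"] i(2)[of 0 1 "-1"] by auto
  have "independent {u, v, w}"
    unfolding independent_explicit
  proof (intro conjI allI impI ballI)
    fix f x assume f: "(\<Sum>v\<in>{u, v, w}. f v *\<^sub>R v) = 0" and x: "x \<in> {u, v, w}"
    have "f u *\<^sub>R u + f v *\<^sub>R v + f w *\<^sub>R w = 0"
      using f ne by (simp add: add.assoc)
    from i[OF this] x show "f x = 0" by auto
  qed simp
  then show "dim (span {u, v, w}) = 3"
    using ne by (simp add: dim_eq_card_independent)
qed

lemma psi0_cyclic: "psi0 x v w u = psi0 x u v w"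
proof -
  have "det (vector [p, q, r, x, v, w, u]) = det (vector [p, q, r, x, u, v, w])" for p q r
    using det_vector_7_swap(6)[of p q r x v u w] det_vector_7_swap(5)[of p q r x u v w] by simp
  then show ?thesis by (simp add: psi0_def)
qed

lemma linear_psi0: "linear (\<lambda>u. psi0 x u v w)"
  unfolding psi0_def by (intro linear_compose_add linear_compose_sub linear_det_vector_7)

lemma psi0_repeat: "psi0 x v v w = 0" "psi0 x w v w = 0"
  by (simp_all add: psi0_def det_vector_7_repeat)

lemma phi0_cyclic: "phi0 v w u = phi0 u v w"
  by (simp add: phi0_expand)

lemma phi0_repeat: "phi0 v w v = 0" "phi0 v w w = 0" "phi0 v v w = 0"
  by (simp_all add: phi0_expand)

lemma cross0_skew: "cross0 v u = - cross0 u v"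
  by (simp add: cross0_def vec_eq_iff phi0_expand)

lemma cross0_self: "cross0 u u = 0"
  by (simp add: cross0_def vec_eq_iff phi0_repeat)

lemma linear_cross0: "linear (\<lambda>u. cross0 u v)" "linear (\<lambda>v. cross0 u v)"
  by (rule linearI; simp add: cross0_def vec_eq_iff linear_add[OF alternating3_linear(1)[OF
      alternating3_phi0]]
      linear_cmul[OF alternating3_linear(1)[OF alternating3_phi0]])
    (rule linearI; simp add: cross0_def vec_eq_iff linear_add[OF alternating3_linear(2)[OF
        alternating3_phi0]]
      linear_cmul[OF alternating3_linear(2)[OF alternating3_phi0]])

text \<open>Splitting off the part of \<open>u\<close> normal to \<open>v\<close> and \<open>w\<close> turns \<open>psi0\<close> into a double cross product.\<close>

lemma psi0_normal_part:
  obtains u' a b where "u' = u - a *\<^sub>R v - b *\<^sub>R w" "u' \<bullet> v = 0" "u' \<bullet> w = 0"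
    "\<And>x. psi0 x u v w = x \<bullet> cross0 u' (cross0 v w)"
proof -
  obtain y z where yz: "y \<in> span {v, w}" "\<And>x. x \<in> span {v, w} \<Longrightarrow> orthogonal z x" "u = y + z"
    by (rule orthogonal_subspace_decomp_exists[of "{v, w}" u]) blast
  obtain a b where ab: "y = a *\<^sub>R v + b *\<^sub>R w"
    using yz(1) span_triple[of v w 0] by (auto simp: insert_commute span_insert_0)
  have zz: "z = u - a *\<^sub>R v - b *\<^sub>R w" using yz(3) ab by simp
  have o: "z \<bullet> v = 0" "z \<bullet> w = 0"
    using yz(2) by (auto simp: orthogonal_def span_base)
  have "psi0 x z v w = psi0 x u v w" for x
    unfolding zz by (simp add: linear_diff[OF linear_psi0] linear_cmul[OF linear_psi0] psi0_repeat)
  then have "psi0 x u v w = x \<bullet> cross0 z (cross0 v w)" for x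
    by (simp add: cross0_cross0 o)
  with zz o show ?thesis using that by blast
qed

text \<open>The vector \<open>cross0 v w\<close> is parallel to \<open>u'\<close>, and both are
  non-zero by independence. Besides closure of the span this gives
  \<open>phi0 u v w \<noteq> 0\<close>, which at a critical zero of the multi-moment map rules out
  independent generators.\<close>

lemma psi0_zero_cross0:
  assumes "\<And>x. psi0 x u v w = 0" and nd: "\<not> linearly_dependent3 u v w"
  obtains u' l a b where "u' = u - a *\<^sub>R v - b *\<^sub>R w" "u' \<bullet> v = 0" "u' \<bullet> w = 0"
    "cross0 v w = l *\<^sub>R u'" "phi0 u v w = l * (u' \<bullet> u')" "l \<noteq> 0" "u' \<noteq> 0"
proof -
  obtain u' a b where u': "u' = u - a *\<^sub>R v - b *\<^sub>R w" "u' \<bullet> v = 0" "u' \<bullet> w = 0"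
    "\<And>x. psi0 x u v w = x \<bullet> cross0 u' (cross0 v w)"
    by (rule psi0_normal_part[of u v w]) blast
  note i = independent3_coeffs[OF nd]
  have ne: "u' \<noteq> 0"
    using i(1)[of 1 "-a" "-b"] u'(1) by auto
  have "cross0 u' (cross0 v w) = 0"
    using assms(1) u'(4) by (metis inner_eq_zero_iff)
  from cauchy_schwarz_cross0[OF this] have l: "cross0 v w = ((u' \<bullet> cross0 v w) / (u' \<bullet> u')) *\<^sub>R
      u'" (is "_ = ?l *\<^sub>R _")
    using ne by (metis (no_types, lifting) divide_inverse_commute inner_eq_zero_iff scaleR_scaleR
      left_inverse scaleR_one)
  have "cross0 v w \<noteq> 0"
  proof
    assume "cross0 v w = 0"
    from cauchy_schwarz_cross0[OF this] have "(v \<bullet> v) *\<^sub>R w - (v \<bullet> w) *\<^sub>R v = 0" by simp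
    then have "v \<bullet> v = 0"
      using i(3)[of 0 "- (v \<bullet> w)" "v \<bullet> v"] by simp
    then show False using i(2)[of 0 1 0] by simp
  qed
  then have "?l \<noteq> 0" using l by (metis scaleR_zero_left)
  moreover have "phi0 u v w = ?l * (u' \<bullet> u')"
  proof -
    have "u = u' + a *\<^sub>R v + b *\<^sub>R w" using u'(1) by simp
    then have "u \<bullet> u' = u' \<bullet> u'"
      using u'(2,3) by (simp add: inner_add_left inner_add_right inner_commute)
    have "phi0 u v w = cross0 v w \<bullet> u" by (simp add: cross0_inner phi0_cyclic)
    also have "\<dots> = ?l * (u' \<bullet> u)" by (subst l) simp
    finally show ?thesis using \<open>u \<bullet> u' = u' \<bullet> u'\<close> by (simp add: inner_commute)
  qed
  ultimately show ?thesis using that u' l ne by blast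
qed

lemma psi0_zero_cross0_in_span:
  assumes "\<And>x. psi0 x u v w = 0" and nd: "\<not> linearly_dependent3 u v w"
  shows "cross0 v w \<in> span {u, v, w}"
proof -
  obtain u' l a b where "u' = u - a *\<^sub>R v - b *\<^sub>R w" "cross0 v w = l *\<^sub>R u'"
    using psi0_zero_cross0[OF assms] .
  then show ?thesis
    by (auto intro!: span_mul span_diff intro: span_base)
qed

text \<open>The hypotheses are invariant under cyclic permutation, so what holds for
  \<open>cross0 v w\<close> also holds for \<open>cross0 w u\<close> and \<open>cross0 u v\<close>;
  skew symmetry and bilinearity extend it to the span.\<close>

lemma psi0_zero_closed:
  assumes "\<And>x. psi0 x u v w = 0" and nd: "\<not> linearly_dependent3 u v w"
    and X: "X \<in> span {u, v, w}" and Y: "Y \<in> span {u, v, w}"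
  shows "cross0 X Y \<in> span {u, v, w}"
proof -
  let ?P = "span {u, v, w}"
  have 1: "cross0 v w \<in> ?P" using psi0_zero_cross0_in_span assms(1,2) by blast
  have 2: "cross0 w u \<in> ?P"
    using psi0_zero_cross0_in_span[of v w u] assms(1,2)
    by (simp add: psi0_cyclic linearly_dependent3_perm insert_commute)
  have 3: "cross0 u v \<in> ?P"
    using psi0_zero_cross0_in_span[of w u v] assms(1,2) psi0_cyclic[of _ w u v]
      linearly_dependent3_perm[of w u v]
    by (simp add: psi0_cyclic linearly_dependent3_perm insert_commute)
  have neg: "cross0 y x \<in> ?P" if "cross0 x y \<in> ?P" for x y
    using that by (metis cross0_skew span_neg)
  have "cross0 x Y \<in> ?P" if "x \<in> {u, v, w}" for x
    using Y
  proof (induction rule: span_induct_alt)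
    case base then show ?case by (simp add: linear_0[OF linear_cross0(2)] span_0)
  next
    case (step c z y)
    have "cross0 x z \<in> ?P" using step(1) that 1 2 3 neg span_0 by (auto simp: cross0_self)
    then show ?case using step
      by (simp add: linear_add[OF linear_cross0(2)] linear_cmul[OF linear_cross0(2)] span_add
          span_mul)
  qed
  with X show ?thesis
  proof (induction rule: span_induct_alt)
    case base then show ?case by (simp add: linear_0[OF linear_cross0(1)] span_0)
  next
    case (step c z y)
    then show ?case
      by (simp add: linear_add[OF linear_cross0(1)] linear_cmul[OF linear_cross0(1)] span_add
          span_mul)
  qed
qed

text \<open>\<open>cross0 v w\<close> is always orthogonal to \<open>v\<close> and \<open>w\<close>.
  Inside the span this forces it onto the line of \<open>u'\<close>, and a vector has zero cross
  product with its multiples.\<close>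

lemma closed_psi0_zero:
  assumes nd: "\<not> linearly_dependent3 u v w" and cl: "cross0 v w \<in> span {u, v, w}"
  shows "psi0 x u v w = 0"
proof -
  obtain u' a b where u': "u' = u - a *\<^sub>R v - b *\<^sub>R w" "u' \<bullet> v = 0" "u' \<bullet> w = 0"
    "\<And>x. psi0 x u v w = x \<bullet> cross0 u' (cross0 v w)"
    by (rule psi0_normal_part[of u v w]) blast
  obtain p q r where n: "cross0 v w = p *\<^sub>R u + q *\<^sub>R v + r *\<^sub>R w"
    using cl by (auto simp: span_triple)
  \<comment> \<open>Writing \<open>u\<close> through \<open>u'\<close> puts all components along
    \<open>v\<close> and \<open>w\<close> into \<open>z\<close>; being orthogonal to both while
    lying in their span, \<open>z\<close> is zero.\<close>
  define z where "z = (q + p * a) *\<^sub>R v + (r + p * b) *\<^sub>R w"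
  have nz: "cross0 v w = p *\<^sub>R u' + z"
    unfolding n u'(1) z_def by (simp add: algebra_simps)
  have "cross0 v w \<bullet> v = 0" "cross0 v w \<bullet> w = 0"
    by (simp_all add: cross0_inner phi0_repeat)
  then have "z \<bullet> v = 0" "z \<bullet> w = 0"
    using u'(2,3) by (simp_all add: nz inner_add_left)
  then have "z \<bullet> z = 0"
    unfolding z_def by (simp add: inner_add_right)
  then have "cross0 v w = p *\<^sub>R u'" using nz by simp
  then have "cross0 u' (cross0 v w) = 0"
    by (simp add: linear_cmul[OF linear_cross0(2)] cross0_self)
  then show ?thesis using u'(4) by simp
qed

lemma cross_product_pullback:
  assumes "linear e" "bij e"
  shows "e (cross_product (pullback3 e phi0) X Y) = cross0 (e X) (e Y)"
proof -
  have "cross_product (pullback3 e phi0) X Y = inv e (cross0 (e X) (e Y))"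
    unfolding cross_product_def G2_metric_pullback(1)[OF assms]
  proof (rule the_equality)
    show "\<forall>Z. pullback_metric e (inv e (cross0 (e X) (e Y))) Z = pullback3 e phi0 X Y Z"
      using assms(2) by (simp add: pullback_metric_def pullback3_def bij_is_surj surj_f_inv_f
          cross0_inner)
  next
    fix W assume "\<forall>Z. pullback_metric e W Z = pullback3 e phi0 X Y Z"
    then have "e W \<bullet> e Z = cross0 (e X) (e Y) \<bullet> e Z" for Z
      by (simp add: pullback_metric_def pullback3_def cross0_inner)
    then have "e W \<bullet> z = cross0 (e X) (e Y) \<bullet> z" for z
      using assms(2) by (metis bij_is_surj surj_f_inv_f)
    then have "e W = cross0 (e X) (e Y)"
      by (metis vector_eq_rdot)
    then show "W = inv e (cross0 (e X) (e Y))"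
      using assms(2) by (metis bij_inv_eq_iff)
  qed
  then show ?thesis
    using assms(2) by (simp add: bij_is_surj surj_f_inv_f)
qed

lemma linearly_dependent3_linear_image:
  assumes "linear e" "bij e"
  shows "linearly_dependent3 (e u) (e v) (e w) \<longleftrightarrow> linearly_dependent3 u v w"
proof -
  have "e z = 0 \<longleftrightarrow> z = 0" for z
    using inj_eq[OF bij_is_inj[OF assms(2)], of z 0] linear_0[OF assms(1)] by simp
  moreover have "a *\<^sub>R e u + b *\<^sub>R e v + c *\<^sub>R e w = e (a *\<^sub>R u + b *\<^sub>R v + c *\<^sub>R w)" for a b c
    by (simp add: linear_add[OF assms(1)] linear_cmul[OF assms(1)])
  ultimately show ?thesis
    by (simp add: linearly_dependent3_def)
qed

lemma associative_plane_pullback: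
  assumes "linear e" "bij e"
  shows "associative_plane (pullback3 e phi0) (span {u, v, w}) \<longleftrightarrow>
    \<not> linearly_dependent3 u v w \<and> (\<forall>x. psi0 x (e u) (e v) (e w) = 0)"
proof -
  have im: "e ` span {u, v, w} = span {e u, e v, e w}"
    using span_linear_image[OF assms(1), of "{u, v, w}"] by simp
  have mem: "X \<in> span {u, v, w} \<longleftrightarrow> e X \<in> span {e u, e v, e w}" for X
    using assms(2) unfolding im[symmetric] by (simp add: bij_is_inj inj_image_mem_iff)
  have "cross_product (pullback3 e phi0) X Y \<in> span {u, v, w} \<longleftrightarrow>
      cross0 (e X) (e Y) \<in> span {e u, e v, e w}" for X Y
    by (simp add: mem cross_product_pullback[OF assms])
  moreover have "(\<forall>X\<in>span {u, v, w}. \<forall>Y\<in>span {u, v, w}. cross0 (e X) (e Y) \<in> span {e u, e v, e w})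
    \<longleftrightarrow> (\<forall>X\<in>span {e u, e v, e w}. \<forall>Y\<in>span {e u, e v, e w}. cross0 X Y \<in> span {e u, e v, e w})"
    unfolding im[symmetric] by auto
  moreover have "\<dots> \<longleftrightarrow> (\<forall>x. psi0 x (e u) (e v) (e w) = 0)" if "\<not> linearly_dependent3 u v w"
  proof -
    have nd: "\<not> linearly_dependent3 (e u) (e v) (e w)"
      using that assms by (simp add: linearly_dependent3_linear_image)
    have "e v \<in> span {e u, e v, e w}" "e w \<in> span {e u, e v, e w}"
      by (simp_all add: span_base)
    then show ?thesis
      using psi0_zero_closed[OF _ nd] closed_psi0_zero[OF nd] by blast
  qed
  ultimately show ?thesis
    unfolding associative_plane_def dim_span_triple
    by (cases "linearly_dependent3 u v w") (simp_all add: subspace_span)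
qed

lemma alternating3_dependent:
  assumes alt: "alternating3 \<omega>" and dep: "linearly_dependent3 u v w"
  shows "\<omega> u v w = 0"
proof -
  note lin = alternating3_linear[OF alt]
  have sk: "\<omega> v u w = - \<omega> u v w" "\<omega> u w v = - \<omega> u v w" for u v w
    using alt unfolding alternating3_def by blast+
  have rep: "\<omega> x x y = 0" "\<omega> x y y = 0" "\<omega> x y x = 0" for x y
    using sk(1)[of x x y] sk(2)[of x y y] sk(2)[of x x y] by simp_all
  obtain a b c where "(a, b, c) \<noteq> (0, 0, 0)" and 0: "a *\<^sub>R u + b *\<^sub>R v + c *\<^sub>R w = 0"
    using dep unfolding linearly_dependent3_def by blast
  then consider "a \<noteq> 0" | "b \<noteq> 0" | "c \<noteq> 0" by auto
  then show ?thesis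
  proof cases
    case 1
    have "\<omega> (a *\<^sub>R u + b *\<^sub>R v + c *\<^sub>R w) v w = 0" unfolding 0 by (rule linear_0[OF lin(1)])
    then show ?thesis using 1 by (simp add: linear_add[OF lin(1)] linear_cmul[OF lin(1)] rep)
  next
    case 2
    have "\<omega> u (a *\<^sub>R u + b *\<^sub>R v + c *\<^sub>R w) w = 0" unfolding 0 by (rule linear_0[OF lin(2)])
    then show ?thesis using 2 by (simp add: linear_add[OF lin(2)] linear_cmul[OF lin(2)] rep)
  next
    case 3
    have "\<omega> u v (a *\<^sub>R u + b *\<^sub>R v + c *\<^sub>R w) = 0" unfolding 0 by (rule linear_0[OF lin(3)])
    then show ?thesis using 3 by (simp add: linear_add[OF lin(3)] linear_cmul[OF lin(3)] rep)
  qed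
qed

lemma pullback3_zero_iff:
  assumes "linear e" "bij e" "\<And>x. psi0 x (e u) (e v) (e w) = 0"
  shows "pullback3 e phi0 u v w = 0 \<longleftrightarrow> linearly_dependent3 u v w"
proof
  assume 0: "pullback3 e phi0 u v w = 0"
  show "linearly_dependent3 u v w"
  proof (rule ccontr)
    assume "\<not> linearly_dependent3 u v w"
    then have nd: "\<not> linearly_dependent3 (e u) (e v) (e w)"
      using assms by (simp add: linearly_dependent3_linear_image)
    obtain u' :: "real^7" and l where "phi0 (e u) (e v) (e w) = l * (u' \<bullet> u')" "l \<noteq> 0" "u' \<noteq> 0"
      by (rule psi0_zero_cross0[OF assms(3) nd]) blast
    then show False using 0 by (simp add: pullback3_def)
  qed
next
  assume "linearly_dependent3 u v w"
  then have "linearly_dependent3 (e u) (e v) (e w)"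
    using assms by (simp add: linearly_dependent3_linear_image)
  then show "pullback3 e phi0 u v w = 0"
    by (simp add: pullback3_def alternating3_dependent[OF alternating3_phi0])
qed

lemma alternating3_psi0: "alternating3 (psi0 x)"
proof -
  have "psi0 x v u w = - psi0 x u v w" "psi0 x u w v = - psi0 x u v w" for u v w
    using det_vector_7_swap(5)[of _ _ _ x v u w] det_vector_7_swap(6)[of _ _ _ x u v w]
    by (simp_all add: psi0_def)
  then show ?thesis
    unfolding alternating3_def using linear_psi0 by blast
qed

section \<open>Transfer to arbitrary \<open>G\<^sub>2\<close>-forms\<close>

lemma G2_form_cases:
  assumes "G2_form \<phi>"
  obtains e where "linear e" "bij e" "\<phi> = pullback3 e phi0"
  using assms unfolding G2_form_iff by blast

lemma inner_product_G2_metric: "G2_form \<phi> \<Longrightarrow> inner_product (G2_metric \<phi>)"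
  by (erule G2_form_cases) (simp add: G2_metric_pullback inner_product_pullback)

lemma alternating3_pullback:
  assumes "linear e" "alternating3 \<omega>"
  shows "alternating3 (pullback3 e \<omega>)"
proof -
  have "linear (\<lambda>u. \<omega> (e u) (e v) (e w))" for v w
    using linear_compose[OF assms(1) alternating3_linear(1)[OF assms(2)]] by (simp add: o_def)
  moreover have "\<omega> v u w = - \<omega> u v w \<and> \<omega> u w v = - \<omega> u v w" for u v w
    using assms(2) unfolding alternating3_def by blast
  ultimately show ?thesis
    unfolding alternating3_def pullback3_def by blast
qed

lemma G2_form_alternating: "G2_form \<phi> \<Longrightarrow> alternating3 \<phi>"
  by (erule G2_form_cases) (simp add: alternating3_pullback alternating3_phi0)

text \<open>Naturality of the metric. Applied to chart changes it gives the metric in a chart;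
  applied to a flow preserving \<phi> it makes that flow isometric.\<close>

lemma G2_form_pullback:
  assumes "G2_form \<phi>" "linear T" "bij T"
  shows "G2_form (pullback3 T \<phi>)"
    and "G2_metric (pullback3 T \<phi>) X Y = G2_metric \<phi> (T X) (T Y)"
proof -
  obtain e where e: "linear e" "bij e" "\<phi> = pullback3 e phi0"
    using assms(1) by (rule G2_form_cases)
  have T: "linear (e \<circ> T)" "bij (e \<circ> T)" "pullback3 T \<phi> = pullback3 (e \<circ> T) phi0"
    using e assms by (auto simp: linear_compose bij_comp pullback3_def fun_eq_iff)
  then show "G2_form (pullback3 T \<phi>)"
    unfolding G2_form_iff by blast
  show "G2_metric (pullback3 T \<phi>) X Y = G2_metric \<phi> (T X) (T Y)"
    unfolding T(3) G2_metric_pullback(1)[OF T(1,2)] unfolding e(3) G2_metric_pullback(1)[OF e(1,2)]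
    by (simp add: pullback_metric_def)
qed

abbreviation star3 :: "7 form3 \<Rightarrow> 7 form4" where
  "star3 \<phi> \<equiv> hodge_star3 (G2_metric \<phi>) (G2_volume \<phi>) \<phi>"

lemma star3_zero_iff_psi0:
  assumes "linear e" "bij e"
  shows "(\<forall>x. star3 (pullback3 e phi0) x u v w = 0) \<longleftrightarrow> (\<forall>x. psi0 x (e u) (e v) (e w) = 0)"
proof -
  have "(\<forall>x. psi0 (e x) (e u) (e v) (e w) = 0) \<longleftrightarrow> (\<forall>x. psi0 x (e u) (e v) (e w) = 0)"
    using assms(2) by (metis bij_pointE)
  then show ?thesis
    by (simp add: hodge_star3_pullback[OF assms])
qed

text \<open>The algebra behind both characterisations: the first two facts settle the points with
  \<nu> = 0, the third those with \<nu> \<noteq> 0, where independence is automatic because an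
  alternating form vanishes on dependent vectors.\<close>

lemma star3_zero:
  assumes "G2_form \<phi>"
  shows "linearly_dependent3 u v w \<Longrightarrow> star3 \<phi> x u v w = 0"
    and "(\<And>x. star3 \<phi> x u v w = 0) \<Longrightarrow> \<phi> u v w = 0 \<Longrightarrow> linearly_dependent3 u v w"
    and "\<phi> u v w \<noteq> 0 \<Longrightarrow> associative_plane \<phi> (span {u, v, w}) \<longleftrightarrow> (\<forall>x. star3 \<phi> x u v w = 0)"
proof -
  obtain e where e: "linear e" "bij e" "\<phi> = pullback3 e phi0"
    using assms(1) by (rule G2_form_cases)
  show "star3 \<phi> x u v w = 0" if "linearly_dependent3 u v w"
    unfolding e(3) hodge_star3_pullback[OF e(1,2)]
    by (rule alternating3_dependent[OF alternating3_psi0])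
      (simp add: linearly_dependent3_linear_image[OF e(1,2)] that)
  show "linearly_dependent3 u v w" if "\<And>x. star3 \<phi> x u v w = 0" "\<phi> u v w = 0"
    using that star3_zero_iff_psi0[OF e(1,2), of u v w] pullback3_zero_iff[OF e(1,2), of u v w]
    unfolding e(3) by blast
  show "associative_plane \<phi> (span {u, v, w}) \<longleftrightarrow> (\<forall>x. star3 \<phi> x u v w = 0)" if "\<phi> u v w \<noteq> 0"
  proof -
    have "\<not> linearly_dependent3 u v w"
      using that alternating3_dependent[OF G2_form_alternating[OF assms]] by blast
    then show ?thesis
      unfolding e(3) associative_plane_pullback[OF e(1,2)] star3_zero_iff_psi0[OF e(1,2)] by blast
  qed
qed

text \<open>The calibration inequality: Cauchy-Schwarz for \<open>cross0 u v \<bullet> w\<close>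
  followed by \<open>cross0_norm\<close>. The product form covers arbitrary vectors, so it applies
  at nearby points where the generating fields are no longer orthonormal.\<close>

lemma G2_form_comass:
  assumes "G2_form \<phi>"
  shows "(\<phi> u v w)\<^sup>2 \<le> G2_metric \<phi> u u * G2_metric \<phi> v v * G2_metric \<phi> w w"
proof -
  obtain e where e: "linear e" "bij e" "\<phi> = pullback3 e phi0"
    using assms(1) by (rule G2_form_cases)
  have "(phi0 u v w)\<^sup>2 \<le> (u \<bullet> u) * (v \<bullet> v) * (w \<bullet> w)" for u v w
  proof -
    have "(phi0 u v w)\<^sup>2 \<le> (cross0 u v \<bullet> cross0 u v) * (w \<bullet> w)"
      unfolding cross0_inner[symmetric] by (rule Cauchy_Schwarz_ineq)
    also have "\<dots> \<le> ((u \<bullet> u) * (v \<bullet> v)) * (w \<bullet> w)"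
      unfolding cross0_norm by (rule mult_right_mono) auto
    finally show ?thesis .
  qed
  then show ?thesis
    unfolding e(3) G2_metric_pullback[OF e(1,2)] by (simp add: pullback3_def pullback_metric_def)
qed

text \<open>Equality in the calibration inequality: with \<open>u\<close> already normal to
  \<open>v\<close> and \<open>w\<close>, the cross product of \<open>v\<close> and \<open>w\<close>
  is \<open>l\<close> times \<open>u\<close>, and it has length one.\<close>

lemma G2_form_associative_orthonormal:
  assumes "G2_form \<phi>" and P: "associative_plane \<phi> (span {u, v, w})"
    and n: "G2_metric \<phi> v v = 1" "G2_metric \<phi> w w = 1" "G2_metric \<phi> u u = 1"
    and o: "G2_metric \<phi> u v = 0" "G2_metric \<phi> u w = 0" "G2_metric \<phi> v w = 0"
  shows "(\<phi> u v w)\<^sup>2 = 1"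
proof -
  obtain e where e: "linear e" "bij e" "\<phi> = pullback3 e phi0"
    using assms(1) by (rule G2_form_cases)
  have g: "G2_metric \<phi> x y = e x \<bullet> e y" for x y
    unfolding e(3) G2_metric_pullback[OF e(1,2)] by (simp add: pullback_metric_def)
  have z: "psi0 x (e u) (e v) (e w) = 0" and nd: "\<not> linearly_dependent3 (e u) (e v) (e w)" for x
    using P unfolding e(3) associative_plane_pullback[OF e(1,2)]
      linearly_dependent3_linear_image[OF e(1,2)] by blast+
  obtain u' l a b where u': "u' = e u - a *\<^sub>R e v - b *\<^sub>R e w" "u' \<bullet> e v = 0" "u' \<bullet> e w = 0"
    "cross0 (e v) (e w) = l *\<^sub>R u'" "phi0 (e u) (e v) (e w) = l * (u' \<bullet> u')"
    using psi0_zero_cross0[OF z nd] by metis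
  have "a = 0" "b = 0"
    using u'(2,3) n o unfolding u'(1) g by (simp_all add: inner_diff_left inner_diff_right
        inner_commute)
  then have "u' = e u" using u'(1) by simp
  then have l: "phi0 (e u) (e v) (e w) = l" using u'(5) n(3) by (simp add: g)
  have "cross0 (e v) (e w) \<bullet> cross0 (e v) (e w) = 1"
    unfolding cross0_norm using n o by (simp add: g)
  then have "l\<^sup>2 = 1"
    unfolding u'(4) using \<open>u' = e u\<close> n(3) by (simp add: g power2_eq_square)
  then show ?thesis
    using l unfolding e(3) pullback3_def by simp
qed

text \<open>With \<open>W(X, Y) = g(X, Y) vol\<close>, evaluated on the standard frame, \<open>det W = vol\<^sup>9\<close>; this recovers \<open>g\<close> from \<open>W\<close>
  and shows that it depends smoothly on \<open>\<phi>\<close>.\<close>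

lemma G2_metric_formula:
  assumes "G2_form \<phi>"
  defines "W \<equiv> \<lambda>X Y. wedge223 (\<phi> X) (\<phi> Y) \<phi> (mat 1) / 6"
  shows "G2_metric \<phi> X Y = W X Y / root 9 (det (\<chi> i j. W (axis i 1) (axis j 1)))"
    and "det (\<chi> i j. W (axis i 1) (axis j 1)) \<noteq> 0"
proof -
  obtain e where e: "linear e" "bij e" "\<phi> = pullback3 e phi0"
    using assms(1) by (rule G2_form_cases)
  define M where "M = (\<chi> i. e (mat 1 $ i))"
  define d where "d = det M"
  have W: "W X Y = (e X \<bullet> e Y) * d" for X Y
  proof -
    have "6 * pullback_metric e X Y * pullback_volume e (mat 1) = wedge223 (\<phi> X) (\<phi> Y) \<phi> (mat 1)"
      using G2_metric_volume_pullback[OF e(1,2)] unfolding G2_metric_volume_def e(3) by blast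
    then show ?thesis
      by (simp add: W_def pullback_metric_def pullback_volume_def d_def M_def)
  qed
  have axis: "mat 1 $ i = (axis i 1 :: real^7)" for i
    by (simp add: vec_eq_iff mat_def axis_def)
  have "Finite_Cartesian_Product.transpose (matrix e) = M"
    by (simp add: vec_eq_iff M_def Finite_Cartesian_Product.transpose_def matrix_def axis)
  then have "d = det (matrix e)"
    unfolding d_def by (metis det_transpose)
  then have "d \<noteq> 0"
    using det_nz_iff_inj[OF e(1)] e(2) by (simp add: bij_is_inj)
  \<comment> \<open>A Gram matrix with each of its seven rows scaled by \<open>d\<close>; the
    scaling contributes \<open>d ^ 7\<close> and the Gram determinant \<open>d ^ 2\<close>.\<close>
  have "(\<chi> i j. W (axis i 1) (axis j 1)) = (\<chi> i. d *s (M ** Finite_Cartesian_Product.transpose M)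
      $ i)"
    by (simp add: vec_eq_iff W M_def axis matrix_matrix_mult_def
        Finite_Cartesian_Product.transpose_def
        inner_vec_def mult.commute)
  then have "det (\<chi> i j. W (axis i 1) (axis j 1)) = d ^ 7 * det (M **
      Finite_Cartesian_Product.transpose M)"
    by (simp add: det_rows_mul[of "\<lambda>_. d"] prod_7 power_numeral_reduce)
  also have "\<dots> = d ^ 9"
    by (simp add: det_mul d_def[symmetric] power_numeral_reduce)
  finally have D: "det (\<chi> i j. W (axis i 1) (axis j 1)) = d ^ 9" .
  then show "det (\<chi> i j. W (axis i 1) (axis j 1)) \<noteq> 0"
    using \<open>d \<noteq> 0\<close> by simp
  \<comment> \<open>The exponent is odd, so the root returns \<open>d\<close> with its sign and both
    orientations are covered.\<close>
  have "root 9 (d ^ 9) = d"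
    by (rule odd_real_root_power_cancel) simp
  then show "G2_metric \<phi> X Y = W X Y / root 9 (det (\<chi> i j. W (axis i 1) (axis j 1)))"
    unfolding D unfolding W using \<open>d \<noteq> 0\<close>
    unfolding e(3) G2_metric_pullback[OF e(1,2)] by (simp add: pullback_metric_def)
qed

text \<open>The description by \<open>THE\<close> says nothing about dependence on \<phi>; the
  formula does, being a quotient of polynomials and a ninth root taken away from zero. First
  derivatives suffice for the Christoffel symbols.\<close>

lemma G2_metric_differentiable:
  fixes \<omega> :: "'a::real_normed_vector \<Rightarrow> 7 form3"
  assumes S: "open S" "p \<in> S" and G2: "\<And>q. q \<in> S \<Longrightarrow> G2_form (\<omega> q)"
    and d: "\<And>u v w. (\<lambda>q. \<omega> q u v w) differentiable (at p)"
  shows "(\<lambda>q. G2_metric (\<omega> q) X Y) differentiable (at p)"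
proof -
  define W where "W q X Y = wedge223 (\<omega> q X) (\<omega> q Y) (\<omega> q) (mat 1) / 6" for q X Y
  define D where "D q = det (\<chi> i j. W q (axis i 1) (axis j 1))" for q
  have W: "(\<lambda>q. W q X Y) differentiable (at p)" for X Y
    unfolding W_def wedge223_def
    by (intro differentiable_divide differentiable_sum differentiable_mult differentiable_const d
        finite_permutations ballI) auto
  have "D differentiable (at p)"
    unfolding D_def det_def prod_7 vec_lambda_beta
    by (intro differentiable_sum differentiable_mult differentiable_const W finite_permutations
        ballI) auto
  moreover have "D p \<noteq> 0"
    using G2_metric_formula(2)[OF G2[OF S(2)]] by (simp add: D_def W_def)
  moreover have "(\<lambda>x. root 9 x) differentiable (at (D p))"
    using DERIV_odd_real_root[of 9 "D p"] \<open>D p \<noteq> 0\<close>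
    by (auto simp: real_differentiable_def)
  ultimately have "(\<lambda>q. root 9 (D q)) differentiable (at p)"
    using differentiable_chain_at[of D p "root 9"] by (simp add: o_def)
  then have "(\<lambda>q. W q X Y / root 9 (D q)) differentiable (at p)"
    using \<open>D p \<noteq> 0\<close> by (intro differentiable_divide W) auto
  then obtain f' where "((\<lambda>q. W q X Y / root 9 (D q)) has_derivative f') (at p)"
    unfolding differentiable_def by blast
  then have "((\<lambda>q. G2_metric (\<omega> q) X Y) has_derivative f') (at p)"
    by (rule has_derivative_transform_within_open[OF _ S])
      (simp add: G2_metric_formula(1)[OF G2] W_def D_def)
  then show ?thesis
    unfolding differentiable_def by blast
qed

section \<open>Calculus of smooth maps\<close>

lemma Ck_on_subset: "Ck_on k S f \<Longrightarrow> T \<subseteq> S \<Longrightarrow> Ck_on k T f"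
  by (induction k arbitrary: f) (auto intro: continuous_on_subset)

lemma frechet_derivative_cong_open:
  assumes "open S" "x \<in> S" "\<And>x. x \<in> S \<Longrightarrow> f x = g x"
  shows "frechet_derivative f (at x) = frechet_derivative g (at x)"
    and "f differentiable (at x) \<longleftrightarrow> g differentiable (at x)"
proof -
  have "(f has_derivative f') (at x) \<longleftrightarrow> (g has_derivative f') (at x)" for f'
    using has_derivative_transform_within_open[OF _ assms(1,2), of f f' UNIV g]
      has_derivative_transform_within_open[OF _ assms(1,2), of g f' UNIV f] assms(3) by auto
  then show "frechet_derivative f (at x) = frechet_derivative g (at x)"
    "f differentiable (at x) \<longleftrightarrow> g differentiable (at x)"
    by (simp_all add: frechet_derivative_def differentiable_def)
qed

lemma Ck_on_cong:
  assumes "open S" "\<And>x. x \<in> S \<Longrightarrow> f x = g x"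
  shows "Ck_on k S f \<longleftrightarrow> Ck_on k S g"
  using assms(2)
proof (induction k arbitrary: f g)
  case 0
  then show ?case by (simp cong: continuous_on_cong)
next
  case (Suc k)
  have "Ck_on k S (\<lambda>x. frechet_derivative f (at x) v) \<longleftrightarrow> Ck_on k S (\<lambda>x. frechet_derivative g (at x)
      v)" for v
    by (rule Suc.IH) (simp add: frechet_derivative_cong_open(1)[OF assms(1) _ Suc.prems])
  then show ?case
    using frechet_derivative_cong_open(2)[OF assms(1) _ Suc.prems] by auto
qed

text \<open>Replaces \<open>frechet_derivative\<close> by any explicit derivative; most inductions
  on \<open>k\<close> below go through this rule.\<close>

lemma Ck_on_SucI:
  assumes "open S" "\<And>x. x \<in> S \<Longrightarrow> (f has_derivative f' x) (at x)" "\<And>v. Ck_on k S (\<lambda>x. f' x v)"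
  shows "Ck_on (Suc k) S f"
proof -
  have "Ck_on k S (\<lambda>x. frechet_derivative f (at x) v) \<longleftrightarrow> Ck_on k S (\<lambda>x. f' x v)" for v
    using assms(2) by (intro Ck_on_cong[OF assms(1)]) (metis frechet_derivative_at)
  then show ?thesis
    using assms by (auto simp: differentiable_def)
qed

lemma Ck_on_SucD: "Ck_on (Suc k) S f \<Longrightarrow> Ck_on k S f"
proof (induction k arbitrary: f)
  case 0
  then show ?case
    by (auto intro!: continuous_at_imp_continuous_on simp: differentiable_imp_continuous_within)
next
  case (Suc k)
  then show ?case by (simp only: Ck_on.simps(2)) blast
qed

lemma Ck_on_derivative:
  assumes "Ck_on (Suc k) S f" "x \<in> S"
  shows "(f has_derivative frechet_derivative f (at x)) (at x)"
  using assms by (simp add: frechet_derivative_works)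

lemma Ck_on_const: "Ck_on k S (\<lambda>x. c)"
  by (induction k arbitrary: c) (auto simp: frechet_derivative_const)

lemma Ck_on_bounded_linear:
  assumes "bounded_linear f" "open S"
  shows "Ck_on k S f"
proof (cases k)
  case 0
  then show ?thesis using assms by (simp add: linear_continuous_on)
next
  case (Suc j)
  show ?thesis
    unfolding Suc by (rule Ck_on_SucI[OF assms(2) bounded_linear_imp_has_derivative[OF assms(1)]
        Ck_on_const])
qed

lemma Ck_on_add:
  assumes "open S" "Ck_on k S f" "Ck_on k S g"
  shows "Ck_on k S (\<lambda>x. f x + g x)"
  using assms(2,3)
proof (induction k arbitrary: f g)
  case 0
  then show ?case by (simp add: continuous_on_add)
next
  case (Suc k)
  show ?case
    by (rule Ck_on_SucI[OF assms(1) has_derivative_add[OF Ck_on_derivative[OF Suc.prems(1)]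
        Ck_on_derivative[OF Suc.prems(2)]]])
      (use Suc in auto)
qed

lemma Ck_on_sum:
  assumes "open S" "\<And>i. i \<in> I \<Longrightarrow> Ck_on k S (f i)"
  shows "Ck_on k S (\<lambda>x. \<Sum>i\<in>I. f i x)"
  using assms(2)
  by (induction I rule: infinite_finite_induct) (auto intro: Ck_on_const Ck_on_add assms(1))

lemma Ck_on_bilinear:
  assumes B: "bounded_bilinear B" and "open S" "Ck_on k S f" "Ck_on k S g"
  shows "Ck_on k S (\<lambda>x. B (f x) (g x))"
  using assms(3,4)
proof (induction k arbitrary: f g)
  case 0
  then show ?case by (simp add: bounded_bilinear.continuous_on[OF B])
next
  case (Suc k)
  show ?case
  proof (rule Ck_on_SucI[OF assms(2) bounded_bilinear.FDERIV[OF B Ck_on_derivative[OF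
      Suc.prems(1)] Ck_on_derivative[OF Suc.prems(2)]]])
    fix v
    show "Ck_on k S (\<lambda>x. B (f x) (frechet_derivative g (at x) v) + B (frechet_derivative f (at x)
        v) (g x))"
      using Suc.prems Suc.prems[THEN Ck_on_SucD] by (intro Ck_on_add assms(2) Suc.IH) auto
  qed
qed

lemmas Ck_on_mult = Ck_on_bilinear[OF bounded_bilinear_mult]
lemmas Ck_on_scaleR = Ck_on_bilinear[OF bounded_bilinear_scaleR]

lemma Ck_on_linear_compose:
  assumes "bounded_linear L" "open S" "Ck_on k S f"
  shows "Ck_on k S (\<lambda>x. L (f x))"
  using assms(3)
proof (induction k arbitrary: f)
  case 0
  then show ?case by (simp add: bounded_linear.continuous_on[OF assms(1)])
next
  case (Suc k)
  show ?case
    by (rule Ck_on_SucI[OF assms(2) bounded_linear.has_derivative[OF assms(1) Ck_on_derivative[OF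
        Suc.prems]]])
      (use Suc in auto)
qed

lemma Ck_on_minus: "open S \<Longrightarrow> Ck_on k S f \<Longrightarrow> Ck_on k S (\<lambda>x. - f x)"
  by (rule Ck_on_linear_compose[OF bounded_linear_minus[OF bounded_linear_ident]])

lemma Ck_on_prod:
  fixes f :: "'i \<Rightarrow> 'a::real_normed_vector \<Rightarrow> real"
  assumes "open S" "\<And>i. i \<in> I \<Longrightarrow> Ck_on k S (f i)"
  shows "Ck_on k S (\<lambda>x. \<Prod>i\<in>I. f i x)"
  using assms(2)
  by (induction I rule: infinite_finite_induct) (auto intro: Ck_on_const Ck_on_mult assms(1))

lemma Ck_on_componentwise:
  fixes f :: "'a::real_normed_vector \<Rightarrow> 'b::euclidean_space"
  assumes "open S" "\<And>b. b \<in> Basis \<Longrightarrow> Ck_on k S (\<lambda>x. f x \<bullet> b)"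
  shows "Ck_on k S f"
proof -
  have "Ck_on k S (\<lambda>x. \<Sum>b\<in>Basis. (f x \<bullet> b) *\<^sub>R b)"
    using assms by (intro Ck_on_sum Ck_on_scaleR Ck_on_const)
  then show ?thesis by (simp add: euclidean_representation)
qed

lemma Ck_on_vec:
  fixes f :: "'a::real_normed_vector \<Rightarrow> real^'n"
  assumes "open S" "\<And>i. Ck_on k S (\<lambda>x. f x $ i)"
  shows "Ck_on k S f"
proof (rule Ck_on_componentwise[OF assms(1)])
  fix b :: "real^'n" assume "b \<in> Basis"
  then obtain i where "b = axis i 1" by (auto simp: Basis_vec_def)
  then show "Ck_on k S (\<lambda>x. f x \<bullet> b)" using assms(2)[of i] by (simp add: inner_axis)
qed

lemma frechet_derivative_basis:
  fixes g :: "'a::euclidean_space \<Rightarrow> 'b::real_normed_vector"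
  assumes "g differentiable (at y)"
  shows "frechet_derivative g (at y) v = (\<Sum>b\<in>Basis. (v \<bullet> b) *\<^sub>R frechet_derivative g (at y) b)"
proof -
  have l: "linear (frechet_derivative g (at y))"
    by (rule linear_frechet_derivative[OF assms])
  have "frechet_derivative g (at y) v = frechet_derivative g (at y) (\<Sum>b\<in>Basis. (v \<bullet> b) *\<^sub>R b)"
    by (simp only: euclidean_representation)
  then show ?thesis
    by (simp add: linear_sum[OF l] linear_cmul[OF l])
qed

text \<open>In the chain rule the direction fed to the derivative of \<open>g\<close> depends on the
  point. Expanding it in a basis leaves derivatives of \<open>g\<close> in constant directions, to
  which the induction hypothesis applies; hence the finite-dimensional middle space.\<close>

lemma Ck_on_compose:
  fixes f :: "'a::real_normed_vector \<Rightarrow> 'b::euclidean_space"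
  assumes "open S" "Ck_on k S f" "Ck_on k T g" "f ` S \<subseteq> T"
  shows "Ck_on k S (\<lambda>x. g (f x))"
  using assms(2,3)
proof (induction k arbitrary: g)
  case 0
  then show ?case using assms(4) by (auto intro: continuous_on_compose2)
next
  case (Suc k)
  have fT: "f x \<in> T" if "x \<in> S" for x using that assms(4) by blast
  show ?case
  proof (rule Ck_on_SucI[OF assms(1)])
    fix x assume x: "x \<in> S"
    have "((g \<circ> f) has_derivative frechet_derivative g (at (f x)) \<circ> frechet_derivative f (at x))
        (at x)"
      by (intro diff_chain_at Ck_on_derivative[OF Suc.prems(1)] Ck_on_derivative[OF Suc.prems(2)]
          x fT)
    moreover have "g differentiable (at (f x))" using Suc.prems(2) fT[OF x] by simp
    then have "frechet_derivative g (at (f x)) \<circ> frechet_derivative f (at x) =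
        (\<lambda>v. \<Sum>b\<in>Basis. (frechet_derivative f (at x) v \<bullet> b) *\<^sub>R frechet_derivative g (at (f x)) b)"
      unfolding o_def by (intro ext frechet_derivative_basis)
    ultimately show "((\<lambda>x. g (f x)) has_derivative
        (\<lambda>v. \<Sum>b\<in>Basis. (frechet_derivative f (at x) v \<bullet> b) *\<^sub>R frechet_derivative g (at (f x)) b))
            (at x)"
      unfolding o_def by (simp only:)
  next
    fix v
    have "Ck_on k S (\<lambda>x. frechet_derivative g (at (f x)) b)" for b
      using Suc.prems(2) by (intro Suc.IH Ck_on_SucD[OF Suc.prems(1)]) simp
    moreover have "Ck_on k S (\<lambda>x. frechet_derivative f (at x) v \<bullet> b)" for b
      using Suc.prems(1) by (intro Ck_on_linear_compose[OF bounded_linear_inner_left] assms(1)) simp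
    ultimately show "Ck_on k S (\<lambda>x. \<Sum>b\<in>Basis. (frechet_derivative f (at x) v \<bullet> b) *\<^sub>R
        frechet_derivative g (at (f x)) b)"
      by (intro Ck_on_sum Ck_on_scaleR assms(1))
  qed
qed

lemma Ck_on_inverse:
  fixes f :: "'a::real_normed_vector \<Rightarrow> real"
  assumes "open S" "Ck_on k S f" "\<And>x. x \<in> S \<Longrightarrow> f x \<noteq> 0"
  shows "Ck_on k S (\<lambda>x. inverse (f x))"
  using assms(2)
proof (induction k)
  case 0
  then show ?case using assms(3) by (simp add: continuous_on_inverse)
next
  case (Suc k)
  show ?case
  proof (rule Ck_on_SucI[OF assms(1)])
    fix x assume x: "x \<in> S"
    show "((\<lambda>x. inverse (f x)) has_derivative (\<lambda>v. - (inverse (f x) * frechet_derivative f (at x)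
        v * inverse (f x)))) (at x)"
      by (rule Deriv.has_derivative_inverse[OF assms(3)[OF x] Ck_on_derivative[OF Suc.prems x]])
  next
    fix v
    show "Ck_on k S (\<lambda>x. - (inverse (f x) * frechet_derivative f (at x) v * inverse (f x)))"
      using Suc.prems by (intro Ck_on_minus Ck_on_mult assms(1) Suc.IH Ck_on_SucD[OF Suc.prems])
          simp
  qed
qed

lemma Ck_on_det:
  fixes M :: "'a::real_normed_vector \<Rightarrow> real^'n^'n"
  assumes "open S" "\<And>i j. Ck_on k S (\<lambda>x. M x $ i $ j)"
  shows "Ck_on k S (\<lambda>x. det (M x))"
  unfolding det_def by (intro Ck_on_sum Ck_on_mult Ck_on_prod Ck_on_const assms)

text \<open>Cramer's rule expresses the derivative of the inverse through the derivative of the function,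
  composed with the inverse itself; hence every \<open>C\<^sup>k\<close> inverse is \<open>C\<^sup>k\<^sup>+\<^sup>1\<close>.\<close>

lemma Ck_on_inverse_function:
  fixes F G :: "real^'n \<Rightarrow> real^'n"
  assumes "open V" and F: "\<And>k. Ck_on k U F" and G: "G ` V \<subseteq> U"
    and dG: "\<And>y. y \<in> V \<Longrightarrow> (G has_derivative G' y) (at y)"
    and inv: "\<And>y v. y \<in> V \<Longrightarrow> frechet_derivative F (at (G y)) (G' y v) = v"
    and bij: "\<And>y. y \<in> V \<Longrightarrow> bij (frechet_derivative F (at (G y)))"
  shows "Ck_on k V G"
proof (induction k)
  case 0
  have "continuous (at y) G" if "y \<in> V" for y
    using dG[OF that] by (rule has_derivative_continuous)
  then show ?case by (simp add: continuous_at_imp_continuous_on)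
next
  case (Suc k)
  have GU: "G y \<in> U" if "y \<in> V" for y using G that by blast
  have lin: "linear (frechet_derivative F (at (G y)))" if "y \<in> V" for y
    using F[of 1] GU[OF that] by (simp add: linear_frechet_derivative)
  define M where "M y = matrix (frechet_derivative F (at (G y)))" for y
  have det: "det (M y) \<noteq> 0" if "y \<in> V" for y
    unfolding M_def using det_nz_iff_inj[OF lin[OF that]] bij[OF that] by (simp add: bij_is_inj)
  have G': "G' y v = (\<chi> i. det (\<chi> a b. if b = i then v $ a else M y $ a $ b) * inverse (det (M
      y)))" if "y \<in> V" for y v
  proof -
    have "M y *v G' y v = v"
      unfolding M_def using inv[OF that] fun_cong[OF matrix_vector_mul(2)[OF lin[OF that]]] by simp
    then show ?thesis
      unfolding cramer[OF det[OF that]] by (simp add: divide_inverse)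
  qed
  have M: "Ck_on k V (\<lambda>y. M y $ a $ b)" for a b
  proof -
    have "Ck_on k V (\<lambda>y. frechet_derivative F (at (G y)) (axis b 1))"
      using F[of "Suc k"] by (intro Ck_on_compose[OF assms(1) Suc _ G]) simp
    from Ck_on_linear_compose[OF bounded_linear_vec_nth assms(1) this, of a] show ?thesis
      by (simp add: M_def matrix_def)
  qed
  show ?case
  proof (rule Ck_on_SucI[OF assms(1) dG], assumption)
    fix v
    have "Ck_on k V (\<lambda>y. if b = i then v $ a else M y $ a $ b)" for a b i
      using M Ck_on_const by (cases "b = i") auto
    then have "Ck_on k V (\<lambda>y. \<chi> i. det (\<chi> a b. if b = i then v $ a else M y $ a $ b) * inverse
        (det (M y)))"
      by (intro Ck_on_vec assms(1)) (simp, intro Ck_on_mult Ck_on_inverse Ck_on_det assms(1) M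
          det, auto)
    then show "Ck_on k V (\<lambda>x. G' x v)"
      by (subst Ck_on_cong[OF assms(1) G']) auto
  qed
qed

lemma smooth_onD: "smooth_on S f \<Longrightarrow> Ck_on k S f"
  by (simp add: smooth_on_def)

lemma smooth_on_subset: "smooth_on S f \<Longrightarrow> T \<subseteq> S \<Longrightarrow> smooth_on T f"
  by (auto simp: smooth_on_def intro: Ck_on_subset)

lemma smooth_on_cong: "open S \<Longrightarrow> (\<And>x. x \<in> S \<Longrightarrow> f x = g x) \<Longrightarrow> smooth_on S f \<longleftrightarrow> smooth_on S g"
  unfolding smooth_on_def using Ck_on_cong by blast

lemma smooth_on_compose:
  fixes f :: "'a::real_normed_vector \<Rightarrow> 'b::euclidean_space"
  assumes "open S" "smooth_on S f" "smooth_on T g" "f ` S \<subseteq> T"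
  shows "smooth_on S (\<lambda>x. g (f x))"
  using assms unfolding smooth_on_def by (blast intro: Ck_on_compose)

lemma smooth_on_has_derivative:
  "smooth_on S f \<Longrightarrow> x \<in> S \<Longrightarrow> (f has_derivative frechet_derivative f (at x)) (at x)"
  using Ck_on_derivative[of 0] smooth_onD by blast

lemma smooth_on_differentiable: "smooth_on S f \<Longrightarrow> x \<in> S \<Longrightarrow> f differentiable (at x)"
  using smooth_onD[of S f 1] by simp

lemma smooth_on_continuous: "smooth_on S f \<Longrightarrow> continuous_on S f"
  using smooth_onD[of S f 0] by simp

lemma smooth_on_frechet_derivative: "smooth_on S f \<Longrightarrow> smooth_on S (\<lambda>x. frechet_derivative f (at x)
    v)"
  unfolding smooth_on_def by (metis Ck_on.simps(2))

lemma smooth_on_affine: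
  assumes "bounded_linear L" "open S"
  shows "smooth_on S (\<lambda>x. c + L x)"
  unfolding smooth_on_def by (intro allI Ck_on_add Ck_on_const Ck_on_bounded_linear assms)

text \<open>The inverse function theorem takes the derivative as a continuous family of bounded
  operators; in finite dimension this follows from continuity in each fixed direction.
  \<open>Ck_on_inverse_function\<close> then upgrades the inverse to a smooth map.\<close>

lemma smooth_local_inverse:
  fixes F :: "real^'n \<Rightarrow> real^'n"
  assumes "open U" "smooth_on U F" "x0 \<in> U" and id: "frechet_derivative F (at x0) = (\<lambda>v. v)"
  obtains U' V G where "open U'" "U' \<subseteq> U" "x0 \<in> U'" "open V" "homeomorphism U' V F G" "smooth_on V
      G"
proof -
  define F' where "F' x = Blinfun (frechet_derivative F (at x))" for x
  have F': "blinfun_apply (F' x) = frechet_derivative F (at x)" if "x \<in> U" for x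
    unfolding F'_def using smooth_on_has_derivative[OF assms(2) that]
    by (intro bounded_linear_Blinfun_apply) (rule has_derivative_bounded_linear)
  have "continuous_on U (\<lambda>x. blinfun_apply (F' x) i)" for i
    using smooth_on_continuous[OF smooth_on_frechet_derivative[OF assms(2)], of i]
    by (rule continuous_on_eq) (simp add: F')
  then have "continuous_on U F'"
    by (intro continuous_on_blinfun_componentwise)
  moreover have "id_blinfun o\<^sub>L F' x0 = id_blinfun"
    by (rule blinfun_eqI) (simp add: F' assms id)
  ultimately obtain U' V G G' where *: "open U'" "U' \<subseteq> U" "x0 \<in> U'" "open V" "F x0 \<in> V"
      "homeomorphism U' V F G"
    "\<And>y. y \<in> V \<Longrightarrow> (G has_derivative (G' y)) (at y)"
    "\<And>y. y \<in> V \<Longrightarrow> G' y = inv (blinfun_apply (F' (G y)))"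
    "\<And>y. y \<in> V \<Longrightarrow> bij (blinfun_apply (F' (G y)))"
    using inverse_function_theorem[OF assms(1), of F F' x0 id_blinfun]
      smooth_on_has_derivative[OF assms(2)] assms(3) F' by metis
  have GV: "G ` V \<subseteq> U" using * by (auto simp: homeomorphism_def)
  have "Ck_on k V G" for k
  proof (rule Ck_on_inverse_function[OF *(4) smooth_onD[OF assms(2)] GV *(7)])
    fix y v assume y: "y \<in> V"
    then have "G y \<in> U" using GV by blast
    then show "bij (frechet_derivative F (at (G y)))" "frechet_derivative F (at (G y)) (G' y v) = v"
      using *(8,9)[OF y] by (simp_all add: F' bij_is_surj surj_f_inv_f)
  qed
  then show ?thesis
    using that * by (simp add: smooth_on_def)
qed

text \<open>Both iterated derivatives are limits of the same second difference quotient.\<close>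

lemma second_difference:
  fixes f :: "'a::real_normed_vector \<Rightarrow> real"
  assumes "open S" "convex S" "Ck_on 2 S f" and h: "h > 0"
    and seg: "\<And>s t. \<bar>s\<bar> \<le> h \<Longrightarrow> \<bar>t\<bar> \<le> h \<Longrightarrow> x + s *\<^sub>R u + t *\<^sub>R v \<in> S"
  obtains s t where "0 < s" "s < h" "0 < t" "t < h"
    "f (x + h *\<^sub>R u + h *\<^sub>R v) - f (x + h *\<^sub>R u) - f (x + h *\<^sub>R v) + f x
      = h\<^sup>2 * frechet_derivative (\<lambda>y. frechet_derivative f (at y) u) (at (x + s *\<^sub>R u + t *\<^sub>R v)) v"
proof -
  have C: "Ck_on (Suc (Suc 0)) S f" using assms(3) by (simp add: numeral_2_eq_2)
  have C1: "Ck_on (Suc 0) S (\<lambda>y. frechet_derivative f (at y) u)" using C by simp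
  have d1: "((\<lambda>s. f (x + s *\<^sub>R u + t *\<^sub>R v)) has_real_derivative frechet_derivative f (at (x + s
      *\<^sub>R u + t *\<^sub>R v)) u) (at s)"
    if "\<bar>s\<bar> \<le> h" "\<bar>t\<bar> \<le> h" for s t
  proof -
    have "((\<lambda>s. x + s *\<^sub>R u + t *\<^sub>R v) has_derivative (\<lambda>r. r *\<^sub>R u)) (at s)"
      by (auto intro!: derivative_eq_intros)
    from diff_chain_at[OF this Ck_on_derivative[OF C seg[OF that]]] show ?thesis
      using linear_cmul[OF linear_frechet_derivative, of f _ _ u] C seg[OF that]
      by (simp add: o_def has_field_derivative_def mult_commute_abs)
  qed
  have d2: "((\<lambda>t. frechet_derivative f (at (x + s *\<^sub>R u + t *\<^sub>R v)) u) has_real_derivative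
      frechet_derivative (\<lambda>y. frechet_derivative f (at y) u) (at (x + s *\<^sub>R u + t *\<^sub>R v)) v) (at t)"
    if "\<bar>s\<bar> \<le> h" "\<bar>t\<bar> \<le> h" for s t
  proof -
    have "((\<lambda>t. x + s *\<^sub>R u + t *\<^sub>R v) has_derivative (\<lambda>r. r *\<^sub>R v)) (at t)"
      by (auto intro!: derivative_eq_intros)
    from diff_chain_at[OF this Ck_on_derivative[OF C1 seg[OF that]]] show ?thesis
      using linear_cmul[OF linear_frechet_derivative, of "\<lambda>y. frechet_derivative f (at y) u" _ _
          v] C1 seg[OF that]
      by (simp add: o_def has_field_derivative_def mult_commute_abs)
  qed
  \<comment> \<open>The increment in direction \<open>v\<close> as a function of the step in
    direction \<open>u\<close>; the mean value theorem is used first in \<open>s\<close> and then in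
    \<open>t\<close>.\<close>
  define a where "a s = f (x + s *\<^sub>R u + h *\<^sub>R v) - f (x + s *\<^sub>R u + 0 *\<^sub>R v)" for s
  have "\<exists>s. 0 < s \<and> s < h \<and> a h - a 0 = (h - 0) * (frechet_derivative f (at (x + s *\<^sub>R u + h *\<^sub>R
      v)) u
      - frechet_derivative f (at (x + s *\<^sub>R u + 0 *\<^sub>R v)) u)"
    unfolding a_def using h by (intro MVT2 DERIV_diff d1) auto
  then obtain s where s: "0 < s" "s < h" "a h - a 0 = h * (frechet_derivative f (at (x + s *\<^sub>R u +
      h *\<^sub>R v)) u
      - frechet_derivative f (at (x + s *\<^sub>R u + 0 *\<^sub>R v)) u)" by auto
  have "\<exists>t. 0 < t \<and> t < h \<and> frechet_derivative f (at (x + s *\<^sub>R u + h *\<^sub>R v)) u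
      - frechet_derivative f (at (x + s *\<^sub>R u + 0 *\<^sub>R v)) u = (h - 0) *
      frechet_derivative (\<lambda>y. frechet_derivative f (at y) u) (at (x + s *\<^sub>R u + t *\<^sub>R v)) v"
    using h s by (intro MVT2 d2) auto
  then obtain t where t: "0 < t" "t < h" "frechet_derivative f (at (x + s *\<^sub>R u + h *\<^sub>R v)) u
      - frechet_derivative f (at (x + s *\<^sub>R u + 0 *\<^sub>R v)) u = h *
      frechet_derivative (\<lambda>y. frechet_derivative f (at y) u) (at (x + s *\<^sub>R u + t *\<^sub>R v)) v" by auto
  show ?thesis
    by (rule that[OF s(1,2) t(1,2)])
      (use s(3)[unfolded t(3)] in \<open>simp add: a_def power2_eq_square algebra_simps\<close>)
qed

lemma mixed_derivative_limit:
  fixes f :: "'a::real_normed_vector \<Rightarrow> real"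
  assumes "open S" "x \<in> S" "Ck_on 2 S f"
  shows "((\<lambda>h. (f (x + h *\<^sub>R u + h *\<^sub>R v) - f (x + h *\<^sub>R u) - f (x + h *\<^sub>R v) + f x) / h\<^sup>2)
    \<longlongrightarrow> frechet_derivative (\<lambda>y. frechet_derivative f (at y) u) (at x) v) (at_right 0)"
proof -
  let ?D = "\<lambda>y. frechet_derivative (\<lambda>y. frechet_derivative f (at y) u) (at y) v"
  obtain r where r: "r > 0" "ball x r \<subseteq> S"
    using assms(1,2) open_contains_ball by blast
  have C: "Ck_on (Suc (Suc 0)) S f" using assms(3) by (simp add: numeral_2_eq_2)
  have cont: "isCont ?D x"
    using C assms(1,2) by (simp add: continuous_on_eq_continuous_at)
  show ?thesis
  proof (rule tendstoI)
    fix e :: real assume e: "e > 0"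
    obtain d where d: "d > 0" "\<And>y. dist y x < d \<Longrightarrow> dist (?D y) (?D x) < e"
      using cont e unfolding continuous_at_eps_delta by blast
    \<comment> \<open>Chosen so that a parallelogram with steps below \<open>m\<close> stays within
      \<open>min d r\<close> of \<open>x\<close>, hence both in \<open>S\<close> and where the
      second derivative is close to its value at \<open>x\<close>; the added 1 keeps the denominator
      positive.\<close>
    define m where "m = min d r / (norm u + norm v + 1)"
    have nn: "norm u + norm v + 1 > 0" using norm_ge_zero[of u] norm_ge_zero[of v] by linarith
    have m: "m > 0" unfolding m_def using d r nn by simp
    have near: "dist (x + s *\<^sub>R u + t *\<^sub>R v) x < min d r" if "\<bar>s\<bar> \<le> h" "\<bar>t\<bar> \<le> h" "h < m" "0 < h"
        for s t h
    proof -
      have "dist (x + s *\<^sub>R u + t *\<^sub>R v) x = norm (s *\<^sub>R u + t *\<^sub>R v)"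
        by (simp add: dist_norm add.assoc)
      also have "\<dots> \<le> \<bar>s\<bar> * norm u + \<bar>t\<bar> * norm v"
        by (metis norm_scaleR norm_triangle_ineq)
      also have "\<dots> \<le> h * norm u + h * norm v"
        using that by (intro add_mono mult_right_mono) auto
      also have "\<dots> < h * (norm u + norm v + 1)"
        using that by (simp add: algebra_simps)
      also have "\<dots> \<le> m * (norm u + norm v + 1)"
        using that nn by (intro mult_right_mono) auto
      also have "\<dots> = min d r" using nn by (simp add: m_def)
      finally show ?thesis .
    qed
    have "\<forall>\<^sub>F h in at_right 0. 0 < h \<and> h < m"
      using m by (auto simp: eventually_at_right_field)
    then show "\<forall>\<^sub>F h in at_right 0. dist ((f (x + h *\<^sub>R u + h *\<^sub>R v) - f (x + h *\<^sub>R u) - f (x + h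
        *\<^sub>R v) + f x) / h\<^sup>2)
       (frechet_derivative (\<lambda>y. frechet_derivative f (at y) u) (at x) v) < e"
    proof eventually_elim
      case (elim h)
      have "x + s *\<^sub>R u + t *\<^sub>R v \<in> ball x r" if "\<bar>s\<bar> \<le> h" "\<bar>t\<bar> \<le> h" for s t
        using near[OF that] elim by (simp add: dist_commute)
      then obtain s t where st: "0 < s" "s < h" "0 < t" "t < h"
        "f (x + h *\<^sub>R u + h *\<^sub>R v) - f (x + h *\<^sub>R u) - f (x + h *\<^sub>R v) + f x
          = h\<^sup>2 * ?D (x + s *\<^sub>R u + t *\<^sub>R v)"
        using second_difference[of "ball x r" f h x u v] Ck_on_subset[OF assms(3) r(2)] elim by
            (metis convex_ball open_ball)
      have "dist (?D (x + s *\<^sub>R u + t *\<^sub>R v)) (?D x) < e"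
        using near[of s h t] st elim by (intro d(2)) auto
      then show ?case using st(5) elim by simp
    qed
  qed
qed

lemma symmetric_second_derivative_real:
  fixes f :: "'a::real_normed_vector \<Rightarrow> real"
  assumes "open S" "x \<in> S" "Ck_on 2 S f"
  shows "frechet_derivative (\<lambda>y. frechet_derivative f (at y) u) (at x) v =
    frechet_derivative (\<lambda>y. frechet_derivative f (at y) v) (at x) u"
proof -
  have "(\<lambda>h. (f (x + h *\<^sub>R v + h *\<^sub>R u) - f (x + h *\<^sub>R v) - f (x + h *\<^sub>R u) + f x) / h\<^sup>2)
     = (\<lambda>h. (f (x + h *\<^sub>R u + h *\<^sub>R v) - f (x + h *\<^sub>R u) - f (x + h *\<^sub>R v) + f x) / h\<^sup>2)"
    by (intro ext) (simp add: algebra_simps)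
  then show ?thesis
    using tendsto_unique[OF trivial_limit_at_right_real mixed_derivative_limit[OF assms, of u v]]
      mixed_derivative_limit[OF assms, of v u] by (simp only:)
qed

text \<open>Applied to \<open>chart_flow\<close> on time and space together it serves twice: two
  time directions give commuting fields, one of each kind gives the derivative of the flow
  differential.\<close>

lemma symmetric_second_derivative:
  fixes f :: "'a::real_normed_vector \<Rightarrow> 'b::euclidean_space"
  assumes "open S" "x \<in> S" "smooth_on S f"
  shows "frechet_derivative (\<lambda>y. frechet_derivative f (at y) u) (at x) v =
    frechet_derivative (\<lambda>y. frechet_derivative f (at y) v) (at x) u"
proof (rule euclidean_eqI)
  fix b :: 'b assume "b \<in> Basis"
  have i: "frechet_derivative (\<lambda>x. g x \<bullet> b) (at y) w = frechet_derivative g (at y) w \<bullet> b"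
    if "g differentiable (at y)" for g :: "'a \<Rightarrow> 'b" and y w
    using frechet_derivative_at[OF bounded_linear.has_derivative[OF bounded_linear_inner_left
        that[unfolded frechet_derivative_works]], of b] by metis
  have 2: "frechet_derivative (\<lambda>y. frechet_derivative f (at y) u) (at x) v \<bullet> b =
      frechet_derivative (\<lambda>y. frechet_derivative (\<lambda>x. f x \<bullet> b) (at y) u) (at x) v" for u v
  proof -
    have "frechet_derivative (\<lambda>y. frechet_derivative (\<lambda>x. f x \<bullet> b) (at y) u) (at x)
      = frechet_derivative (\<lambda>y. frechet_derivative f (at y) u \<bullet> b) (at x)"
      by (rule frechet_derivative_cong_open(1)[OF assms(1,2)])
        (simp add: i smooth_on_differentiable[OF assms(3)])
    then show ?thesis
      by (simp add: i smooth_on_differentiable[OF smooth_on_frechet_derivative[OF assms(3)]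
          assms(2)])
  qed
  have "Ck_on 2 S (\<lambda>x. f x \<bullet> b)"
    by (intro Ck_on_linear_compose[OF bounded_linear_inner_left] assms(1) smooth_onD assms(3))
  then show "frechet_derivative (\<lambda>y. frechet_derivative f (at y) u) (at x) v \<bullet> b =
      frechet_derivative (\<lambda>y. frechet_derivative f (at y) v) (at x) u \<bullet> b"
    unfolding 2 by (rule symmetric_second_derivative_real[OF assms(1,2)])
qed

section \<open>Charts and the torus flow\<close>

locale smooth_manifold =
  fixes A :: "('m::{t2_space,second_countable_topology}, 'n::finite) chart set"
  assumes atlas: "smooth_atlas A"
begin

lemma open_chart: "c \<in> A \<Longrightarrow> open (fst c)"
  and open_chart_image: "c \<in> A \<Longrightarrow> open (chart_image c)"
  and chart_homeomorphism: "c \<in> A \<Longrightarrow> homeomorphism (fst c) (chart_image c) (snd c) (chart_inv c)"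
  using atlas unfolding smooth_atlas_def by blast+

lemma chart_inv_left: "c \<in> A \<Longrightarrow> y \<in> fst c \<Longrightarrow> chart_inv c (snd c y) = y"
  and chart_inv_right: "c \<in> A \<Longrightarrow> p \<in> chart_image c \<Longrightarrow> snd c (chart_inv c p) = p"
  and chart_inv_in: "c \<in> A \<Longrightarrow> p \<in> chart_image c \<Longrightarrow> chart_inv c p \<in> fst c"
  and chart_in: "c \<in> A \<Longrightarrow> y \<in> fst c \<Longrightarrow> snd c y \<in> chart_image c"
  and continuous_chart: "c \<in> A \<Longrightarrow> continuous_on (fst c) (snd c)"
  and continuous_chart_inv: "c \<in> A \<Longrightarrow> continuous_on (chart_image c) (chart_inv c)"
  using chart_homeomorphism[of c] unfolding homeomorphism_def by blast+

lemma isCont_chart: "c \<in> A \<Longrightarrow> y \<in> fst c \<Longrightarrow> isCont (snd c) y"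
  using continuous_chart open_chart continuous_on_eq_continuous_at by blast

lemma isCont_chart_inv: "c \<in> A \<Longrightarrow> p \<in> chart_image c \<Longrightarrow> isCont (chart_inv c) p"
  using continuous_chart_inv open_chart_image continuous_on_eq_continuous_at by blast

lemma chart_at: "chart_at A x \<in> A" "x \<in> fst (chart_at A x)"
proof -
  have "x \<in> (\<Union>c\<in>A. fst c)" using atlas unfolding smooth_atlas_def by blast
  then have "\<exists>c. c \<in> A \<and> x \<in> fst c" by blast
  then have "chart_at A x \<in> A \<and> x \<in> fst (chart_at A x)"
    unfolding chart_at_def by (rule someI_ex)
  then show "chart_at A x \<in> A" "x \<in> fst (chart_at A x)" by blast+
qed

lemma coord_at_in: "coord_at A x \<in> chart_image (chart_at A x)"
  by (simp add: coord_at_def chart_in chart_at)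

lemma chart_inv_coord_at: "chart_inv (chart_at A x) (coord_at A x) = x"
  by (simp add: coord_at_def chart_inv_left chart_at)

lemma chart_preimage:
  assumes "c \<in> A"
  shows "snd c ` (fst c \<inter> V) = {p \<in> chart_image c. chart_inv c p \<in> V}"
  using chart_inv_left[OF assms] chart_inv_right[OF assms] chart_inv_in[OF assms] chart_in[OF assms]
  by (force simp: image_iff)

lemma open_chart_preimage:
  assumes "c \<in> A" "open V"
  shows "open (snd c ` (fst c \<inter> V))"
proof -
  have "snd c ` (fst c \<inter> V) = chart_image c \<inter> chart_inv c -` V"
    unfolding chart_preimage[OF assms(1)] by blast
  then show ?thesis
    using continuous_open_preimage[OF continuous_chart_inv open_chart_image] assms by simp
qed

lemma smooth_transition:
  "c \<in> A \<Longrightarrow> d \<in> A \<Longrightarrow> smooth_on (snd c ` (fst c \<inter> fst d)) (snd d \<circ> chart_inv c)"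
  using atlas unfolding smooth_atlas_def by blast

lemma transition_has_derivative:
  assumes "c \<in> A" "d \<in> A" "y \<in> fst c" "y \<in> fst d"
  shows "((snd d \<circ> chart_inv c) has_derivative coord_change c d y) (at (snd c y))"
  unfolding coord_change_def
  using assms by (intro smooth_on_has_derivative[OF smooth_transition]) auto

lemma linear_coord_change:
  assumes "c \<in> A" "d \<in> A" "y \<in> fst c" "y \<in> fst d"
  shows "linear (coord_change c d y)"
  using transition_has_derivative[OF assms] has_derivative_linear by blast

text \<open>Continuity keeps \<open>f\<close> inside the domain of \<open>c\<close> near
  \<open>x0\<close>, where the new coordinates are the transition map applied to the old
  ones.\<close>

lemma change_chart:
  fixes f :: "'x::real_normed_vector \<Rightarrow> 'm"
  assumes c: "c \<in> A" and d: "d \<in> A" and y: "f x0 \<in> fst c" "f x0 \<in> fst d"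
    and cont: "isCont f x0"
    and der: "((\<lambda>x. snd c (f x)) has_derivative D) (at x0)"
  shows "((\<lambda>x. snd d (f x)) has_derivative (\<lambda>v. coord_change c d (f x0) (D v))) (at x0)"
proof -
  have 1: "(((snd d \<circ> chart_inv c) \<circ> (\<lambda>x. snd c (f x))) has_derivative (coord_change c d (f x0) \<circ>
      D)) (at x0)"
    by (rule diff_chain_at[OF der transition_has_derivative[OF c d y]])
  have "\<forall>\<^sub>F x in at x0. f x \<in> fst c"
    by (rule topological_tendstoD[OF cont[unfolded isCont_def] open_chart[OF c] y(1)])
  then have 2: "\<forall>\<^sub>F x in at x0. ((snd d \<circ> chart_inv c) \<circ> (\<lambda>x. snd c (f x))) x = snd d (f x)"
    by eventually_elim (simp add: chart_inv_left[OF c])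
  show ?thesis
    using has_derivative_transform_eventually[OF 1 2] y by (simp add: o_def chart_inv_left[OF c])
qed

lemma change_chart_dom:
  fixes h :: "'m \<Rightarrow> 'x::real_normed_vector"
  assumes c: "c \<in> A" and d: "d \<in> A" and y: "y \<in> fst c" "y \<in> fst d"
    and der: "((\<lambda>p. h (chart_inv c p)) has_derivative D) (at (snd c y))"
  shows "((\<lambda>p. h (chart_inv d p)) has_derivative (\<lambda>v. D (coord_change d c y v))) (at (snd d y))"
proof -
  have "((\<lambda>p. h (chart_inv c p)) has_derivative D) (at ((snd c \<circ> chart_inv d) (snd d y)))"
    using der y by (simp add: chart_inv_left[OF d])
  from diff_chain_at[OF transition_has_derivative[OF d c y(2,1)] this]
  have "((\<lambda>p. h (chart_inv c p)) \<circ> (snd c \<circ> chart_inv d) has_derivative D \<circ> coord_change d c y)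
      (at (snd d y))" .
  then have "((\<lambda>p. h (chart_inv d p)) has_derivative D \<circ> coord_change d c y) (at (snd d y))"
  proof (rule has_derivative_transform_within_open[where s = "snd d ` (fst d \<inter> fst c)"])
    show "open (snd d ` (fst d \<inter> fst c))" by (rule open_chart_preimage[OF d open_chart[OF c]])
    show "snd d y \<in> snd d ` (fst d \<inter> fst c)" using y by blast
    show "((\<lambda>p. h (chart_inv c p)) \<circ> (snd c \<circ> chart_inv d)) p = h (chart_inv d p)"
      if "p \<in> snd d ` (fst d \<inter> fst c)" for p
      using that by (auto simp: chart_inv_left[OF c] chart_inv_left[OF d])
  qed
  then show ?thesis by (simp add: o_def)
qed

lemma coord_change_id:
  assumes "c \<in> A" "y \<in> fst c"
  shows "coord_change c c y v = v"
proof -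
  have "((\<lambda>p. p) has_derivative (\<lambda>v. v)) (at (snd c y))" by simp
  then have "((snd c \<circ> chart_inv c) has_derivative (\<lambda>v. v)) (at (snd c y))"
    by (rule has_derivative_transform_within_open[OF _ open_chart_image[OF assms(1)] chart_in[OF
        assms]])
      (simp add: chart_inv_right[OF assms(1)])
  then show ?thesis
    using has_derivative_unique[OF transition_has_derivative[OF assms(1,1,2,2)]] by metis
qed

lemma coord_change_trans:
  assumes "c \<in> A" "d \<in> A" "e \<in> A" "y \<in> fst c" "y \<in> fst d" "y \<in> fst e"
  shows "coord_change d e y (coord_change c d y v) = coord_change c e y v"
proof -
  have "((\<lambda>p. snd d (chart_inv c p)) has_derivative coord_change c d y) (at (snd c y))"
    using transition_has_derivative[OF assms(1,2,4,5)] by (simp add: o_def)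
  then have "((\<lambda>p. snd e (chart_inv c p)) has_derivative
      (\<lambda>v. coord_change d e (chart_inv c (snd c y)) (coord_change c d y v))) (at (snd c y))"
    using assms by (intro change_chart isCont_chart_inv chart_in) (auto simp: chart_inv_left)
  then show ?thesis
    using has_derivative_unique[OF transition_has_derivative[OF assms(1,3,4,6)]] assms
    by (simp add: o_def chart_inv_left fun_eq_iff)
qed

lemma coord_change_inverse:
  assumes "c \<in> A" "d \<in> A" "y \<in> fst c" "y \<in> fst d"
  shows "coord_change d c y (coord_change c d y v) = v"
  using coord_change_trans[of c d c y v] coord_change_id[of c y v] assms by simp

lemma bij_coord_change:
  assumes "c \<in> A" "d \<in> A" "y \<in> fst c" "y \<in> fst d"
  shows "bij (coord_change c d y)"
  by (rule o_bij[of "coord_change d c y"])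
    (use coord_change_inverse[OF assms] coord_change_inverse[OF assms(2,1,4,3)] in \<open>auto simp:
        fun_eq_iff\<close>)

end

section \<open>The torus and its flow in charts\<close>

lemma torus_exp_0: "torus_exp 0 = 1"
  by (simp add: torus_exp_def vec_eq_iff)

lemma torus_exp_add: "torus_exp (s + t) = torus_exp s * torus_exp t"
  by (simp add: torus_exp_def vec_eq_iff cis_mult)

lemma torus_exp_in: "torus_exp t \<in> torus3"
  by (simp add: torus_exp_def torus3_def)

text \<open>Principal arguments serve as times. Their compact box is what later yields a convergent
  subsequence of return times in \<open>orbit_slice\<close>.\<close>

lemma torus_exp_surj:
  assumes "z \<in> torus3"
  obtains t where "z = torus_exp t" "t \<in> cbox (\<chi> i. - pi) (\<chi> i. pi)"
proof
  let ?t = "\<chi> i. Arg (z $ i)"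
  have "z $ i = cis (Arg (z $ i))" for i
  proof -
    have "cmod (z $ i) = 1" using assms by (simp add: torus3_def)
    moreover from this have "z $ i \<noteq> 0" by auto
    ultimately show ?thesis using cis_Arg[of "z $ i"] by (simp add: sgn_div_norm)
  qed
  then show "z = torus_exp ?t"
    by (simp add: torus_exp_def vec_eq_iff)
  show "?t \<in> cbox (\<chi> i. - pi) (\<chi> i. pi)"
    using Arg_bounded by (auto simp: mem_box_cart intro: less_imp_le)
qed

locale torus_manifold = smooth_manifold A
  for A :: "('m::{t2_space,second_countable_topology}, 'n::finite) chart set" +
  fixes act :: "complex^3 \<Rightarrow> 'm \<Rightarrow> 'm"
  assumes action: "smooth_torus_action A act"
begin

definition flow :: "real^3 \<Rightarrow> 'm \<Rightarrow> 'm" where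
  "flow t y = act (torus_exp t) y"

lemma flow_0: "flow 0 y = y"
  using action by (simp add: flow_def torus_exp_0 smooth_torus_action_def)

lemma flow_add: "flow (s + t) y = flow s (flow t y)"
  using action torus_exp_in unfolding flow_def torus_exp_add smooth_torus_action_def by blast

lemma flow_minus: "flow (- t) (flow t y) = y" "flow t (flow (- t) y) = y"
  by (simp_all flip: flow_add add: flow_0)

lemma continuous_flow: "continuous_on UNIV (\<lambda>(t, y). flow t y)"
  using action by (simp add: flow_def smooth_torus_action_def)

lemma isCont_flow_compose:
  fixes f :: "'x::t2_space \<Rightarrow> real^3"
  assumes "isCont f x" "isCont g x"
  shows "isCont (\<lambda>x. flow (f x) (g x)) x"
proof -
  have "isCont (\<lambda>(t, y). flow t y) (f x, g x)"
    using continuous_flow by (simp add: continuous_on_eq_continuous_at)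
  with isCont_Pair[OF assms] have "isCont (\<lambda>x. (\<lambda>(t, y). flow t y) (f x, g x)) x"
    by (rule isCont_o2)
  then show ?thesis by simp
qed

definition flow_dom :: "('m, 'n) chart \<Rightarrow> ('m, 'n) chart \<Rightarrow> ((real^3) \<times> (real^'n)) set" where
  "flow_dom c d = {(t, p). p \<in> chart_image c \<and> flow t (chart_inv c p) \<in> fst d}"

definition chart_flow :: "('m, 'n) chart \<Rightarrow> ('m, 'n) chart \<Rightarrow> (real^3) \<times> (real^'n) \<Rightarrow> real^'n" where
  "chart_flow c d = (\<lambda>(t, p). snd d (flow t (chart_inv c p)))"

lemma smooth_chart_flow: "c \<in> A \<Longrightarrow> d \<in> A \<Longrightarrow> smooth_on (flow_dom c d) (chart_flow c d)"
  using action unfolding smooth_torus_action_def flow_dom_def chart_flow_def flow_def by blast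

lemma flow_dom_iff: "(t, p) \<in> flow_dom c d \<longleftrightarrow> p \<in> chart_image c \<and> flow t (chart_inv c p) \<in> fst d"
  by (simp add: flow_dom_def)

lemma open_flow_dom:
  assumes c: "c \<in> A" and d: "d \<in> A"
  shows "open (flow_dom c d)"
proof -
  have "continuous_on (UNIV \<times> chart_image c) (\<lambda>z. flow (fst z) (chart_inv c (snd z)))"
  proof (rule continuous_at_imp_continuous_on, rule ballI)
    fix z :: "(real^3) \<times> (real^'n)" assume "z \<in> UNIV \<times> chart_image c"
    then have "isCont (chart_inv c) (snd z)" using isCont_chart_inv[OF c] by auto
    then show "isCont (\<lambda>z. flow (fst z) (chart_inv c (snd z))) z"
      by (intro isCont_flow_compose isCont_fst isCont_o2[OF isCont_snd]) auto
  qed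
  then have "open ((UNIV \<times> chart_image c) \<inter> (\<lambda>z. flow (fst z) (chart_inv c (snd z))) -` fst d)"
    by (intro continuous_open_preimage open_Times open_chart_image open_chart c d) auto
  also have "(UNIV \<times> chart_image c) \<inter> (\<lambda>z. flow (fst z) (chart_inv c (snd z))) -` fst d = flow_dom
      c d"
    by (auto simp: flow_dom_def)
  finally show ?thesis .
qed

lemma chart_flow_has_derivative:
  assumes "c \<in> A" "d \<in> A" "(t, p) \<in> flow_dom c d"
  shows "(chart_flow c d has_derivative frechet_derivative (chart_flow c d) (at (t, p))) (at (t,
      p))"
  by (rule smooth_on_has_derivative[OF smooth_chart_flow[OF assms(1,2)] assms(3)])

lemma zero_in_flow_dom: "c \<in> A \<Longrightarrow> p \<in> chart_image c \<Longrightarrow> (0, p) \<in> flow_dom c c"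
  by (simp add: flow_dom_iff flow_0 chart_inv_in)

lemma chart_flow_0: "c \<in> A \<Longrightarrow> p \<in> chart_image c \<Longrightarrow> chart_flow c c (0, p) = p"
  by (simp add: chart_flow_def flow_0 chart_inv_right)

lemma chart_flow_in: "c \<in> A \<Longrightarrow> (t, p) \<in> flow_dom c d \<Longrightarrow> d \<in> A \<Longrightarrow> chart_flow c d (t, p) \<in> chart_image d"
  by (simp add: chart_flow_def flow_dom_iff chart_in)

lemma chart_inv_chart_flow:
  "c \<in> A \<Longrightarrow> d \<in> A \<Longrightarrow> (t, p) \<in> flow_dom c d \<Longrightarrow> chart_inv d (chart_flow c d (t, p)) = flow t (chart_inv
      c p)"
  by (simp add: chart_flow_def flow_dom_iff chart_inv_left)

text \<open>The generating field in a fixed chart, as opposed to \<open>fundamental_field\<close>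
  with its jumping reference chart. Like \<open>space_deriv\<close> it is cut out of the joint
  derivative in time and space, so that smoothness and mixed derivatives come from
  \<open>chart_flow\<close> alone.\<close>

definition chart_field :: "('m, 'n) chart \<Rightarrow> real^3 \<Rightarrow> real^'n \<Rightarrow> real^'n" where
  "chart_field c \<xi> p = frechet_derivative (chart_flow c c) (at (0, p)) (\<xi>, 0)"

definition space_deriv :: "('m, 'n) chart \<Rightarrow> real^3 \<Rightarrow> real^'n \<Rightarrow> real^'n \<Rightarrow> real^'n" where
  "space_deriv c t p v = frechet_derivative (chart_flow c c) (at (t, p)) (0, v)"

lemma smooth_chart_field:
  assumes "c \<in> A"
  shows "smooth_on (chart_image c) (chart_field c \<xi>)"
proof -
  have "smooth_on (chart_image c) (\<lambda>p. (0 :: (real^3) \<times> (real^'n)) + (0, p))"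
    by (intro smooth_on_affine bounded_linear_Pair bounded_linear_zero bounded_linear_ident
        open_chart_image assms)
  then show ?thesis
    unfolding chart_field_def
    by (intro smooth_on_compose[OF open_chart_image[OF assms] _ smooth_on_frechet_derivative[OF
        smooth_chart_flow[OF assms assms]]])
      (auto simp: zero_in_flow_dom assms)
qed

lemma flow_curve_has_derivative:
  assumes "c \<in> A" "(t, p) \<in> flow_dom c c"
  shows "((\<lambda>s. chart_flow c c (t + s *\<^sub>R \<xi>, p)) has_derivative
    (\<lambda>s. s *\<^sub>R frechet_derivative (chart_flow c c) (at (t, p)) (\<xi>, 0))) (at 0)"
proof -
  have l: "linear (frechet_derivative (chart_flow c c) (at (t, p)))"
    by (rule has_derivative_linear[OF chart_flow_has_derivative[OF assms(1,1,2)]])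
  have "((\<lambda>s. (t + s *\<^sub>R \<xi>, p)) has_derivative (\<lambda>s. (s *\<^sub>R \<xi>, 0))) (at 0)"
    by (auto intro!: derivative_eq_intros)
  moreover have "(chart_flow c c has_derivative frechet_derivative (chart_flow c c) (at (t, p)))
      (at (t + 0 *\<^sub>R \<xi>, p))"
    using chart_flow_has_derivative[OF assms(1,1,2)] by simp
  ultimately have "(chart_flow c c \<circ> (\<lambda>s. (t + s *\<^sub>R \<xi>, p)) has_derivative
      frechet_derivative (chart_flow c c) (at (t, p)) \<circ> (\<lambda>s. (s *\<^sub>R \<xi>, 0))) (at 0)"
    by (rule diff_chain_at)
  moreover have "frechet_derivative (chart_flow c c) (at (t, p)) (s *\<^sub>R \<xi>, 0) =
      s *\<^sub>R frechet_derivative (chart_flow c c) (at (t, p)) (\<xi>, 0)" for s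
    using linear_cmul[OF l, of s "(\<xi>, 0)"] by simp
  ultimately show ?thesis by (simp add: o_def)
qed

lemma flow_curve_chart:
  assumes "c \<in> A" "y \<in> fst c"
  shows "((\<lambda>s. snd c (flow (s *\<^sub>R \<xi>) y)) has_derivative (\<lambda>s. s *\<^sub>R chart_field c \<xi> (snd c y))) (at
      0)"
  using flow_curve_has_derivative[OF assms(1) zero_in_flow_dom[OF assms(1) chart_in[OF assms]], of
      \<xi>]
  by (simp add: chart_flow_def chart_field_def chart_inv_left assms)

lemma isCont_flow_curve: "isCont (\<lambda>s. flow (s *\<^sub>R \<xi>) y) s"
  by (intro isCont_flow_compose) auto

lemma fundamental_field_chart_at:
  "fundamental_field A act \<xi> y = chart_field (chart_at A y) \<xi> (coord_at A y)"
  using flow_curve_chart[OF chart_at, of y \<xi>]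
  by (auto simp: fundamental_field_def flow_def coord_at_def has_vector_derivative_def intro!:
      vector_derivative_at)

lemma chart_field_coord_change:
  assumes "c \<in> A" "d \<in> A" "y \<in> fst c" "y \<in> fst d"
  shows "coord_change c d y (chart_field c \<xi> (snd c y)) = chart_field d \<xi> (snd d y)"
proof -
  have "((\<lambda>s. snd d (flow (s *\<^sub>R \<xi>) y)) has_derivative
      (\<lambda>s. coord_change c d (flow (0 *\<^sub>R \<xi>) y) (s *\<^sub>R chart_field c \<xi> (snd c y)))) (at 0)"
    using assms by (intro change_chart flow_curve_chart isCont_flow_curve) (auto simp: flow_0)
  from has_derivative_unique[OF this flow_curve_chart[OF assms(2,4)]] show ?thesis
    by (auto simp: fun_eq_iff flow_0 dest!: spec[of _ 1])
qed

lemma vector_field_in_chart_fundamental: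
  assumes "c \<in> A" "p \<in> chart_image c"
  shows "vector_field_in_chart A c (fundamental_field A act \<xi>) p = chart_field c \<xi> p"
  using chart_field_coord_change[OF chart_at(1) assms(1) chart_at(2) chart_inv_in[OF assms], of \<xi>]
  by (simp add: vector_field_in_chart_def Let_def fundamental_field_chart_at chart_inv_right[OF
      assms] coord_at_def)

lemma linear_chart_field:
  assumes "c \<in> A" "p \<in> chart_image c"
  shows "linear (\<lambda>\<xi>. chart_field c \<xi> p)"
proof -
  have l: "linear (frechet_derivative (chart_flow c c) (at (0, p)))"
    by (rule has_derivative_linear[OF chart_flow_has_derivative[OF assms(1,1) zero_in_flow_dom[OF
        assms]]])
  have "linear (\<lambda>\<xi> :: real^3. (\<xi>, 0 :: real^'n))"
    by (auto intro!: linearI)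
  from linear_compose[OF this l] show ?thesis
    by (simp add: chart_field_def o_def)
qed

lemma linear_fundamental_field: "linear (\<lambda>\<xi>. fundamental_field A act \<xi> y)"
  unfolding fundamental_field_chart_at by (rule linear_chart_field[OF chart_at(1) coord_at_in])

lemma linear_space_deriv:
  assumes "c \<in> A" "(t, p) \<in> flow_dom c c"
  shows "linear (space_deriv c t p)"
proof -
  have l: "linear (frechet_derivative (chart_flow c c) (at (t, p)))"
    by (rule has_derivative_linear[OF chart_flow_has_derivative[OF assms(1,1,2)]])
  have "linear (\<lambda>v :: real^'n. (0 :: real^3, v))"
    by (auto intro!: linearI)
  from linear_compose[OF this l] show ?thesis
    by (simp add: space_deriv_def[abs_def] o_def)
qed

lemma space_deriv_0:
  assumes "c \<in> A" "p \<in> chart_image c"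
  shows "space_deriv c 0 p v = v"
proof -
  have "((\<lambda>q. (0 :: real^3, q)) has_derivative (\<lambda>v. (0, v))) (at p)"
    by (auto intro!: derivative_eq_intros)
  from diff_chain_at[OF this chart_flow_has_derivative[OF assms(1,1) zero_in_flow_dom[OF assms]]]
  have "((\<lambda>q. chart_flow c c (0, q)) has_derivative space_deriv c 0 p) (at p)"
    by (simp add: o_def space_deriv_def[abs_def])
  then have "((\<lambda>q. q) has_derivative space_deriv c 0 p) (at p)"
    by (rule has_derivative_transform_within_open[OF _ open_chart_image[OF assms(1)] assms(2)])
      (simp add: chart_flow_0 assms)
  then show ?thesis
    using has_derivative_unique[OF _ has_derivative_ident] by metis
qed

text \<open>By the group law, a time derivative taken at time \<open>t\<close> is a time derivative
  at zero starting from the moved point: orbit curves are integral curves of the fields.\<close>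

lemma chart_field_along_flow:
  assumes "c \<in> A" "(t, p) \<in> flow_dom c c"
  shows "frechet_derivative (chart_flow c c) (at (t, p)) (\<xi>, 0) = chart_field c \<xi> (chart_flow c c
      (t, p))"
proof -
  let ?y = "flow t (chart_inv c p)"
  have y: "?y \<in> fst c" using assms by (simp add: flow_dom_iff)
  have "chart_flow c c (t + s *\<^sub>R \<xi>, p) = snd c (flow (s *\<^sub>R \<xi>) ?y)" for s
    by (simp add: chart_flow_def flow_add add.commute[of t])
  from has_derivative_unique[OF flow_curve_has_derivative[OF assms, of \<xi>]
      flow_curve_chart[OF assms(1) y, of \<xi>, folded this]]
  show ?thesis by (auto simp: fun_eq_iff chart_flow_def dest!: spec[of _ 1])
qed

lemma smooth_flow_derivative:
  "c \<in> A \<Longrightarrow> smooth_on (flow_dom c c) (\<lambda>z. frechet_derivative (chart_flow c c) (at z) w)"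
  by (rule smooth_on_frechet_derivative[OF smooth_chart_flow])

lemma chart_field_derivative:
  assumes "c \<in> A" "p \<in> chart_image c"
  shows "frechet_derivative (chart_field c \<xi>) (at p) v =
    frechet_derivative (\<lambda>z. frechet_derivative (chart_flow c c) (at z) (\<xi>, 0)) (at (0, p)) (0, v)"
proof -
  have "((\<lambda>q. (0 :: real^3, q)) has_derivative (\<lambda>v. (0, v))) (at p)"
    by (auto intro!: derivative_eq_intros)
  from diff_chain_at[OF this smooth_on_has_derivative[OF smooth_flow_derivative[OF assms(1), of
      "(\<xi>, 0)"] zero_in_flow_dom[OF assms]]]
  show ?thesis
    by (simp add: o_def chart_field_def[abs_def] frechet_derivative_at[symmetric])
qed

text \<open>Symmetry of the mixed time-space derivative of \<open>chart_flow\<close>. This is the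
  linearised flow that enters the Lie derivative.\<close>

lemma space_deriv_derivative:
  assumes "c \<in> A" "p \<in> chart_image c"
  shows "((\<lambda>s. space_deriv c (s *\<^sub>R \<xi>) p v) has_derivative
    (\<lambda>s. s *\<^sub>R frechet_derivative (chart_field c \<xi>) (at p) v)) (at 0)"
proof -
  let ?f = "\<lambda>z. frechet_derivative (chart_flow c c) (at z) (0, v)"
  note z = zero_in_flow_dom[OF assms]
  have d: "(?f has_derivative frechet_derivative ?f (at (0, p))) (at (0 *\<^sub>R \<xi>, p))"
    using smooth_on_has_derivative[OF smooth_flow_derivative[OF assms(1)] z] by simp
  have "((\<lambda>s. (s *\<^sub>R \<xi>, p)) has_derivative (\<lambda>s. (s *\<^sub>R \<xi>, 0))) (at 0)"
    by (auto intro!: derivative_eq_intros)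
  from diff_chain_at[OF this d]
  have "((\<lambda>s. space_deriv c (s *\<^sub>R \<xi>) p v) has_derivative (\<lambda>s. frechet_derivative ?f (at (0, p))
      (s *\<^sub>R \<xi>, 0))) (at 0)"
    by (simp add: o_def space_deriv_def)
  moreover have "frechet_derivative ?f (at (0, p)) (s *\<^sub>R \<xi>, 0) = s *\<^sub>R frechet_derivative ?f (at
      (0, p)) (\<xi>, 0)" for s
    using linear_cmul[OF has_derivative_linear[OF smooth_on_has_derivative[OF
        smooth_flow_derivative[OF assms(1)] z]], of "(0, v)" s "(\<xi>, 0)"]
    by simp
  moreover have "frechet_derivative ?f (at (0, p)) (\<xi>, 0) = frechet_derivative (chart_field c \<xi>)
      (at p) v"
    unfolding chart_field_derivative[OF assms]
    by (rule symmetric_second_derivative[OF open_flow_dom[OF assms(1,1)] z smooth_chart_flow[OF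
        assms(1,1)]])
  ultimately show ?thesis by simp
qed

text \<open>Both sides are second time derivatives of \<open>chart_flow\<close> in the directions
  \<xi> and \<eta>: by \<open>chart_field_along_flow\<close> the first derivative is the field at
  the moved point, and the second is symmetric.\<close>

lemma chart_field_commute:
  assumes "c \<in> A" "p \<in> chart_image c"
  shows "frechet_derivative (chart_field c \<xi>) (at p) (chart_field c \<eta> p) =
    frechet_derivative (chart_field c \<eta>) (at p) (chart_field c \<xi> p)"
proof -
  note z = zero_in_flow_dom[OF assms]
  have "frechet_derivative (\<lambda>z. frechet_derivative (chart_flow c c) (at z) (\<xi>, 0)) (at (0, p)) (\<eta>,
      0)
     = frechet_derivative (chart_field c \<xi>) (at p) (chart_field c \<eta> p)" for \<xi> \<eta>
  proof -
    have "(chart_field c \<xi> has_derivative frechet_derivative (chart_field c \<xi>) (at p)) (at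
        (chart_flow c c (0, p)))"
      using smooth_on_has_derivative[OF smooth_chart_field[OF assms(1)] assms(2)] by (simp add:
          chart_flow_0 assms)
    from diff_chain_at[OF chart_flow_has_derivative[OF assms(1,1) z] this]
    have "((\<lambda>z. chart_field c \<xi> (chart_flow c c z)) has_derivative
       (\<lambda>w. frechet_derivative (chart_field c \<xi>) (at p) (frechet_derivative (chart_flow c c) (at
           (0, p)) w))) (at (0, p))"
      by (simp add: o_def)
    then have "((\<lambda>z. frechet_derivative (chart_flow c c) (at z) (\<xi>, 0)) has_derivative
       (\<lambda>w. frechet_derivative (chart_field c \<xi>) (at p) (frechet_derivative (chart_flow c c) (at
           (0, p)) w))) (at (0, p))"
      by (rule has_derivative_transform_within_open[OF _ open_flow_dom[OF assms(1,1)] z])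
        (auto simp: chart_field_along_flow[OF assms(1)])
    from frechet_derivative_at[OF this] show ?thesis
      by (metis chart_field_def)
  qed
  moreover have "frechet_derivative (\<lambda>z. frechet_derivative (chart_flow c c) (at z) (\<xi>, 0)) (at
      (0, p)) (\<eta>, 0)
     = frechet_derivative (\<lambda>z. frechet_derivative (chart_flow c c) (at z) (\<eta>, 0)) (at (0, p)) (\<xi>,
         0)"
    by (rule symmetric_second_derivative[OF open_flow_dom[OF assms(1,1)] z smooth_chart_flow[OF
        assms(1,1)]])
  ultimately show ?thesis by simp
qed

lemma flow_has_derivative:
  assumes "c \<in> A" "d \<in> A" "y \<in> fst c" "flow t y \<in> fst d"
  shows "((\<lambda>p. snd d (flow t (chart_inv c p))) has_derivative
    (\<lambda>v. frechet_derivative (chart_flow c d) (at (t, snd c y)) (0, v))) (at (snd c y))"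
proof -
  have "(t, snd c y) \<in> flow_dom c d"
    using assms by (simp add: flow_dom_iff chart_in chart_inv_left)
  note d = chart_flow_has_derivative[OF assms(1,2) this]
  have "((\<lambda>q. (t, q)) has_derivative (\<lambda>v. (0, v))) (at (snd c y))"
    by (auto intro!: derivative_eq_intros)
  from diff_chain_at[OF this d] show ?thesis
    by (simp add: o_def chart_flow_def)
qed

lemma tangent_map_flow:
  "((\<lambda>p. snd (chart_at A (flow t y)) (flow t (chart_inv (chart_at A y) p))) has_derivative
    tangent_map A (act (torus_exp t)) y) (at (coord_at A y))"
  using flow_has_derivative[OF chart_at(1) chart_at(1) chart_at(2) chart_at(2), where y = y and t
      = t]
    frechet_derivative_at[OF flow_has_derivative[OF chart_at(1) chart_at(1) chart_at(2)
        chart_at(2), where y = y and t = t]]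
  by (simp add: tangent_map_def o_def flow_def coord_at_def)

lemma isCont_flow_chart_inv:
  assumes "c \<in> A" "y \<in> fst c"
  shows "isCont (\<lambda>p. flow t (chart_inv c p)) (snd c y)"
  by (intro isCont_flow_compose isCont_chart_inv chart_in assms) auto

text \<open>The bridge from invariance, stated through reference charts, to calculus in one chart.
  Both sides differentiate the same map, from the chart \<open>c\<close> into the reference chart of
  the image point.\<close>

lemma tangent_map_space_deriv:
  assumes c: "c \<in> A" and y: "y \<in> fst c" "flow t y \<in> fst c"
  shows "tangent_map A (act (torus_exp t)) y (coord_change c (chart_at A y) y v) =
    coord_change c (chart_at A (flow t y)) (flow t y) (space_deriv c t (snd c y) v)"
proof -
  let ?d = "chart_at A (flow t y)" and ?e = "chart_at A y"
  have "((\<lambda>p. snd c (flow t (chart_inv c p))) has_derivative space_deriv c t (snd c y)) (at (snd c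
      y))"
    using flow_has_derivative[OF c c y] by (simp add: space_deriv_def[abs_def])
  then have "((\<lambda>p. snd ?d (flow t (chart_inv c p))) has_derivative
     (\<lambda>v. coord_change c ?d (flow t (chart_inv c (snd c y))) (space_deriv c t (snd c y) v))) (at
         (snd c y))"
    using y by (intro change_chart c chart_at isCont_flow_chart_inv) (auto simp: chart_inv_left[OF
        c] chart_at)
  then have 1: "((\<lambda>p. snd ?d (flow t (chart_inv c p))) has_derivative
     (\<lambda>v. coord_change c ?d (flow t y) (space_deriv c t (snd c y) v))) (at (snd c y))"
    using y by (simp add: chart_inv_left[OF c])
  have "((\<lambda>p. snd ?d (flow t (chart_inv c p))) has_derivative
     (\<lambda>v. tangent_map A (act (torus_exp t)) y (coord_change c ?e y v))) (at (snd c y))"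
    using tangent_map_flow[of t y] unfolding coord_at_def
    by (intro change_chart_dom[where h = "\<lambda>z. snd ?d (flow t z)"] c chart_at y)
  from has_derivative_unique[OF this 1] show ?thesis by metis
qed

lemma bij_space_deriv:
  assumes c: "c \<in> A" and y: "y \<in> fst c" "flow t y \<in> fst c"
  shows "bij (space_deriv c t (snd c y))"
proof -
  have inv: "space_deriv c (- t) (snd c (flow t y)) (space_deriv c t (snd c y) v) = v"
    if y: "y \<in> fst c" "flow t y \<in> fst c" for y t v
  proof -
    have 1: "((\<lambda>p. snd c (flow t (chart_inv c p))) has_derivative space_deriv c t (snd c y)) (at
        (snd c y))"
      using flow_has_derivative[OF c c y] by (simp add: space_deriv_def[abs_def])
    have "((\<lambda>p. snd c (flow (- t) (chart_inv c p))) has_derivative space_deriv c (- t) (snd c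
        (flow t y))) (at (snd c (flow t y)))"
      using flow_has_derivative[OF c c y(2), of "- t"] y by (simp add: space_deriv_def[abs_def]
          flow_minus)
    then have 2: "((\<lambda>p. snd c (flow (- t) (chart_inv c p))) has_derivative space_deriv c (- t)
        (snd c (flow t y)))
        (at (snd c (flow t (chart_inv c (snd c y)))))"
      using y by (simp add: chart_inv_left[OF c])
    have "((\<lambda>p. snd c (flow (- t) (chart_inv c (snd c (flow t (chart_inv c p)))))) has_derivative
        (\<lambda>v. space_deriv c (- t) (snd c (flow t y)) (space_deriv c t (snd c y) v))) (at (snd c y))"
      using diff_chain_at[OF 1 2] by (simp add: o_def)
    then have "((\<lambda>p. p) has_derivative
        (\<lambda>v. space_deriv c (- t) (snd c (flow t y)) (space_deriv c t (snd c y) v))) (at (snd c y))"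
    proof (rule has_derivative_transform_within_open[where s = "snd c ` (fst c \<inter> flow t -` fst c)"])
      have "continuous_on UNIV (flow t)"
        by (intro continuous_at_imp_continuous_on ballI isCont_flow_compose) auto
      then have "open (flow t -` fst c)"
        using open_vimage open_chart[OF c] by blast
      then show "open (snd c ` (fst c \<inter> flow t -` fst c))"
        by (rule open_chart_preimage[OF c])
      show "snd c y \<in> snd c ` (fst c \<inter> flow t -` fst c)" using y by auto
    qed (auto simp: chart_inv_left[OF c] flow_minus)
    from has_derivative_unique[OF this has_derivative_ident] show ?thesis by metis
  qed
  show ?thesis
  proof (rule o_bij[of "space_deriv c (- t) (snd c (flow t y))"])
    show "space_deriv c (- t) (snd c (flow t y)) \<circ> space_deriv c t (snd c y) = id"
      using inv[OF y] by (simp add: fun_eq_iff)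
    show "space_deriv c t (snd c y) \<circ> space_deriv c (- t) (snd c (flow t y)) = id"
      using inv[of "flow t y" "- t"] y by (simp add: fun_eq_iff flow_minus)
  qed
qed

end

section \<open>Invariant three-forms\<close>

definition trilinear ::
  "('a::real_vector \<Rightarrow> 'b::real_vector \<Rightarrow> 'c::real_vector \<Rightarrow> real) \<Rightarrow> bool" where
  "trilinear T \<longleftrightarrow> (\<forall>v w. linear (\<lambda>u. T u v w)) \<and> (\<forall>u w. linear (\<lambda>v. T u v w)) \<and> (\<forall>u v. linear (\<lambda>w.
      T u v w))"

lemma linear_basis_expansion:
  fixes f :: "'a::euclidean_space \<Rightarrow> real"
  assumes "linear f"
  shows "f u = (\<Sum>i\<in>Basis. (u \<bullet> i) * f i)"
proof -
  have "f u = f (\<Sum>i\<in>Basis. (u \<bullet> i) *\<^sub>R i)" by (simp only: euclidean_representation)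
  then show ?thesis by (simp add: linear_sum[OF assms] linear_cmul[OF assms])
qed

lemma trilinear_expansion:
  fixes T :: "'a::euclidean_space \<Rightarrow> 'b::euclidean_space \<Rightarrow> 'c::euclidean_space \<Rightarrow> real"
  assumes "trilinear T"
  shows "T u v w = (\<Sum>i\<in>Basis. \<Sum>j\<in>Basis. \<Sum>k\<in>Basis. (u \<bullet> i) * ((v \<bullet> j) * ((w \<bullet> k) * T i j k)))"
proof -
  have 1: "T u v w = (\<Sum>i\<in>Basis. (u \<bullet> i) * T i v w)"
    using assms by (intro linear_basis_expansion) (simp add: trilinear_def)
  have 2: "T x v w = (\<Sum>j\<in>Basis. (v \<bullet> j) * T x j w)" for x
    using assms by (intro linear_basis_expansion) (simp add: trilinear_def)
  have 3: "T x y w = (\<Sum>k\<in>Basis. (w \<bullet> k) * T x y k)" for x y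
    using assms by (intro linear_basis_expansion) (simp add: trilinear_def)
  show ?thesis unfolding 1 unfolding 2 unfolding 3 by (simp add: sum_distrib_left)
qed

lemma alternating3_trilinear: "alternating3 \<omega> \<Longrightarrow> trilinear \<omega>"
  unfolding trilinear_def using alternating3_linear by blast

text \<open>Differentiability of \<omega> is given for constant arguments only. Expansion in bases
  turns the expression into a finite sum of products of differentiable functions.\<close>

lemma trilinear_has_derivative:
  fixes \<omega> :: "'p::real_normed_vector \<Rightarrow> 'a::euclidean_space \<Rightarrow> 'b::euclidean_space \<Rightarrow>
      'c::euclidean_space \<Rightarrow> real"
    and \<gamma> :: "'x::real_normed_vector \<Rightarrow> 'p"
  assumes S: "open S" "p \<in> S" and lin: "\<And>q. q \<in> S \<Longrightarrow> trilinear (\<omega> q)"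
    and D: "\<And>u v w. ((\<lambda>q. \<omega> q u v w) has_derivative D u v w) (at p)"
    and \<gamma>: "(\<gamma> has_derivative \<gamma>') (at x0)" "\<gamma> x0 = p"
    and a: "(a has_derivative a') (at x0)" and b: "(b has_derivative b') (at x0)" and c: "(c
        has_derivative c') (at x0)"
  shows "((\<lambda>x. \<omega> (\<gamma> x) (a x) (b x) (c x)) has_derivative
    (\<lambda>h. D (a x0) (b x0) (c x0) (\<gamma>' h) + \<omega> p (a' h) (b x0) (c x0) + \<omega> p (a x0) (b' h) (c x0)
        + \<omega> p (a x0) (b x0) (c' h))) (at x0)"
proof -
  \<comment> \<open>Multilinearity of \<open>D\<close> in its arguments is inherited from \<omega>
    by uniqueness of the derivative.\<close>
  have Dex: "D u v w h = (\<Sum>i\<in>Basis. \<Sum>j\<in>Basis. \<Sum>k\<in>Basis. (u \<bullet> i) * ((v \<bullet> j) * ((w \<bullet> k) * D i j k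
      h)))" for u v w h
  proof -
    have "((\<lambda>q. \<Sum>i\<in>Basis. \<Sum>j\<in>Basis. \<Sum>k\<in>Basis. (u \<bullet> i) * ((v \<bullet> j) * ((w \<bullet> k) * \<omega> q i j k)))
        has_derivative
        (\<lambda>h. \<Sum>i\<in>Basis. \<Sum>j\<in>Basis. \<Sum>k\<in>Basis. (u \<bullet> i) * ((v \<bullet> j) * ((w \<bullet> k) * D i j k h)))) (at p)"
      by (intro has_derivative_sum has_derivative_mult_right D)
    then have "((\<lambda>q. \<omega> q u v w) has_derivative
        (\<lambda>h. \<Sum>i\<in>Basis. \<Sum>j\<in>Basis. \<Sum>k\<in>Basis. (u \<bullet> i) * ((v \<bullet> j) * ((w \<bullet> k) * D i j k h)))) (at p)"
      by (rule has_derivative_transform_within_open[OF _ S]) (simp add: trilinear_expansion[OF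
          lin, symmetric])
    from has_derivative_unique[OF D this] show ?thesis by metis
  qed
  have comp: "((\<lambda>x. \<omega> (\<gamma> x) i j k) has_derivative (\<lambda>h. D i j k (\<gamma>' h))) (at x0)" for i j k
    using diff_chain_at[OF \<gamma>(1)] D[of i j k] \<gamma>(2) by (fastforce simp: o_def)
  have "((\<lambda>x. (a x \<bullet> i) * ((b x \<bullet> j) * ((c x \<bullet> k) * \<omega> (\<gamma> x) i j k))) has_derivative
     (\<lambda>h. (a x0 \<bullet> i) * ((b x0 \<bullet> j) * ((c x0 \<bullet> k) * D i j k (\<gamma>' h)))
       + (a' h \<bullet> i) * ((b x0 \<bullet> j) * ((c x0 \<bullet> k) * \<omega> p i j k))
       + (a x0 \<bullet> i) * ((b' h \<bullet> j) * ((c x0 \<bullet> k) * \<omega> p i j k))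
       + (a x0 \<bullet> i) * ((b x0 \<bullet> j) * ((c' h \<bullet> k) * \<omega> p i j k)))) (at x0)" for i j k
    by (rule has_derivative_eq_rhs[OF has_derivative_mult[OF has_derivative_inner_left[OF a]
          has_derivative_mult[OF has_derivative_inner_left[OF b]
            has_derivative_mult[OF has_derivative_inner_left[OF c] comp]]]])
      (simp add: fun_eq_iff \<gamma>(2) algebra_simps)
  then have "((\<lambda>x. \<Sum>i\<in>Basis. \<Sum>j\<in>Basis. \<Sum>k\<in>Basis. (a x \<bullet> i) * ((b x \<bullet> j) * ((c x \<bullet> k) * \<omega> (\<gamma> x) i j
      k))) has_derivative
     (\<lambda>h. \<Sum>i\<in>Basis. \<Sum>j\<in>Basis. \<Sum>k\<in>Basis. (a x0 \<bullet> i) * ((b x0 \<bullet> j) * ((c x0 \<bullet> k) * D i j k (\<gamma>' h)))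
       + (a' h \<bullet> i) * ((b x0 \<bullet> j) * ((c x0 \<bullet> k) * \<omega> p i j k))
       + (a x0 \<bullet> i) * ((b' h \<bullet> j) * ((c x0 \<bullet> k) * \<omega> p i j k))
       + (a x0 \<bullet> i) * ((b x0 \<bullet> j) * ((c' h \<bullet> k) * \<omega> p i j k)))) (at x0)"
    by (intro has_derivative_sum)
  then have E: "((\<lambda>x. \<Sum>i\<in>Basis. \<Sum>j\<in>Basis. \<Sum>k\<in>Basis. (a x \<bullet> i) * ((b x \<bullet> j) * ((c x \<bullet> k) * \<omega> (\<gamma> x)
      i j k))) has_derivative
     (\<lambda>h. D (a x0) (b x0) (c x0) (\<gamma>' h) + \<omega> p (a' h) (b x0) (c x0) + \<omega> p (a x0) (b' h) (c x0)
        + \<omega> p (a x0) (b x0) (c' h))) (at x0)"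
    unfolding sum.distrib Dex[symmetric] trilinear_expansion[OF lin[OF S(2)], symmetric] .
  have "\<forall>\<^sub>F x in at x0. \<gamma> x \<in> S"
    using topological_tendstoD[OF has_derivative_continuous[OF \<gamma>(1), unfolded continuous_within]
        S(1)] S(2) \<gamma>(2) by blast
  then have ev: "\<forall>\<^sub>F x in at x0. (\<Sum>i\<in>Basis. \<Sum>j\<in>Basis. \<Sum>k\<in>Basis. (a x \<bullet> i) * ((b x \<bullet> j) * ((c x \<bullet>
      k) * \<omega> (\<gamma> x) i j k)))
     = \<omega> (\<gamma> x) (a x) (b x) (c x)"
    by eventually_elim (simp add: trilinear_expansion[OF lin, symmetric])
  show ?thesis
    by (rule has_derivative_transform_eventually[OF E ev])
      (use S(2) \<gamma>(2) in \<open>simp_all add: trilinear_expansion[OF lin, symmetric]\<close>)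
qed

lemma bilinear_has_derivative:
  fixes g :: "'p::real_normed_vector \<Rightarrow> 'a::euclidean_space \<Rightarrow> 'a \<Rightarrow> real"
    and \<gamma> :: "'x::real_normed_vector \<Rightarrow> 'p"
  assumes S: "open S" "p \<in> S" and lin: "\<And>q v. q \<in> S \<Longrightarrow> linear (\<lambda>u. g q u v)" "\<And>q u. q \<in> S \<Longrightarrow> linear
      (\<lambda>v. g q u v)"
    and D: "\<And>u v. ((\<lambda>q. g q u v) has_derivative D u v) (at p)"
    and \<gamma>: "(\<gamma> has_derivative \<gamma>') (at x0)" "\<gamma> x0 = p"
    and a: "(a has_derivative a') (at x0)" and b: "(b has_derivative b') (at x0)"
  shows "((\<lambda>x. g (\<gamma> x) (a x) (b x)) has_derivative
    (\<lambda>h. D (a x0) (b x0) (\<gamma>' h) + g p (a' h) (b x0) + g p (a x0) (b' h))) (at x0)"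
proof -
  \<comment> \<open>A bilinear form becomes trilinear with a real third argument, which is then held
    at 1.\<close>
  have "((\<lambda>x. (\<lambda>q u v (w::real). g q u v * w) (\<gamma> x) (a x) (b x) ((\<lambda>_. 1) x)) has_derivative
    (\<lambda>h. (\<lambda>u v w h. D u v h * w) (a x0) (b x0) ((\<lambda>_. 1) x0) (\<gamma>' h) + (\<lambda>q u v (w::real). g q u v *
        w) p (a' h) (b x0) ((\<lambda>_. 1) x0)
       + (\<lambda>q u v (w::real). g q u v * w) p (a x0) (b' h) ((\<lambda>_. 1) x0)
       + (\<lambda>q u v (w::real). g q u v * w) p (a x0) (b x0) ((\<lambda>_. 0) h))) (at x0)"
  proof (rule trilinear_has_derivative[OF S _ _ \<gamma> a b])
    show "trilinear (\<lambda>u v (w::real). g q u v * w)" if "q \<in> S" for q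
      unfolding trilinear_def using lin[OF that] by (auto intro: linear_mult_const linear_times)
    show "((\<lambda>q. g q u v * w) has_derivative (\<lambda>h. D u v h * w)) (at p)" for u v w
      by (intro has_derivative_mult_left D)
    show "((\<lambda>_. 1 :: real) has_derivative (\<lambda>_. 0)) (at x0)" by simp
  qed
  then show ?thesis by simp
qed

context smooth_manifold
begin

lemma form3_in_chart_pullback:
  "form3_in_chart A c \<omega> p =
    pullback3 (coord_change c (chart_at A (chart_inv c p)) (chart_inv c p)) (\<omega> (chart_inv c p))"
  by (simp add: fun_eq_iff form3_in_chart_def pullback3_def Let_def)

lemma chart_change_to_ref:
  assumes "c \<in> A" "p \<in> chart_image c"
  shows "linear (coord_change c (chart_at A (chart_inv c p)) (chart_inv c p))"
    and "bij (coord_change c (chart_at A (chart_inv c p)) (chart_inv c p))"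
  using assms by (auto intro: linear_coord_change bij_coord_change chart_at chart_inv_in)

lemma form3_in_chart_alternating:
  assumes "smooth_3form A \<omega>" "c \<in> A" "p \<in> chart_image c"
  shows "alternating3 (form3_in_chart A c \<omega> p)"
  unfolding form3_in_chart_pullback
  using assms by (intro alternating3_pullback chart_change_to_ref) (auto simp: smooth_3form_def)

lemma form3_in_chart_ref: "form3_in_chart A (chart_at A x) \<omega> (coord_at A x) = \<omega> x"
  using chart_at[of x] by (simp add: fun_eq_iff form3_in_chart_def Let_def chart_inv_coord_at
      coord_change_id)

lemma form3_has_derivative:
  assumes "smooth_3form A \<omega>" "c \<in> A" "p \<in> chart_image c"
  shows "((\<lambda>q. form3_in_chart A c \<omega> q u v w) has_derivative
    frechet_derivative (\<lambda>q. form3_in_chart A c \<omega> q u v w) (at p)) (at p)"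
  using assms by (intro smooth_on_has_derivative) (auto simp: smooth_3form_def)

end

context torus_manifold
begin

lemma flow_dom_segment:
  assumes "c \<in> A" "p \<in> chart_image c"
  obtains I where "open I" "0 \<in> I" "\<And>s. s \<in> I \<Longrightarrow> (s *\<^sub>R \<xi>, p) \<in> flow_dom c c"
proof
  let ?I = "(\<lambda>s. (s *\<^sub>R \<xi>, p)) -` flow_dom c c"
  show "open ?I" by (intro open_vimage open_flow_dom assms continuous_intros)
  show "0 \<in> ?I" using zero_in_flow_dom[OF assms] by simp
qed auto

lemma chart_flow_curve_has_derivative:
  assumes "c \<in> A" "p \<in> chart_image c"
  shows "((\<lambda>s. chart_flow c c (s *\<^sub>R \<xi>, p)) has_derivative (\<lambda>s. s *\<^sub>R chart_field c \<xi> p)) (at 0)"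
  using flow_curve_has_derivative[OF assms(1) zero_in_flow_dom[OF assms], of \<xi>] by (simp add:
      chart_field_def)

lemma chart_field_has_derivative:
  "c \<in> A \<Longrightarrow> p \<in> chart_image c \<Longrightarrow>
    (chart_field c \<xi> has_derivative frechet_derivative (chart_field c \<xi>) (at p)) (at p)"
  by (rule smooth_on_has_derivative[OF smooth_chart_field])

lemma form3_in_chart_fields:
  assumes "c \<in> A" "p \<in> chart_image c"
  shows "form3_in_chart A c \<omega> p (chart_field c \<xi>1 p) (chart_field c \<xi>2 p) (chart_field c \<xi>3 p) =
    \<omega> (chart_inv c p) (fundamental_field A act \<xi>1 (chart_inv c p))
      (fundamental_field A act \<xi>2 (chart_inv c p)) (fundamental_field A act \<xi>3 (chart_inv c p))"
  using chart_field_coord_change[OF assms(1) chart_at(1) chart_inv_in[OF assms] chart_at(2)]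
  by (simp add: form3_in_chart_def Let_def fundamental_field_chart_at coord_at_def
      chart_inv_right[OF assms])

end

section \<open>Lie derivatives and contraction with the generating fields\<close>

locale torus_form = torus_manifold A act
  for A :: "('m::{t2_space,second_countable_topology}, 'n::finite) chart set" and act +
  fixes \<omega> :: "'m \<Rightarrow> 'n form3"
  assumes smooth_form: "smooth_3form A \<omega>" and invariant: "preserves_3form A act \<omega>"
begin

lemma invariant_flow:
  "\<omega> (flow t y) (tangent_map A (act (torus_exp t)) y u) (tangent_map A (act (torus_exp t)) y v)
     (tangent_map A (act (torus_exp t)) y w) = \<omega> y u v w"
  using invariant torus_exp_in unfolding preserves_3form_def Let_def flow_def by blast

lemma form3_in_chart_flow:
  assumes "c \<in> A" "(t, p) \<in> flow_dom c c"
  shows "pullback3 (space_deriv c t p) (form3_in_chart A c \<omega> (chart_flow c c (t, p))) =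
      form3_in_chart A c \<omega> p"
proof -
  let ?y = "chart_inv c p"
  have p: "p \<in> chart_image c" "flow t ?y \<in> fst c" using assms(2) by (auto simp: flow_dom_iff)
  have T: "coord_change c (chart_at A (flow t ?y)) (flow t ?y) (space_deriv c t p v) =
     tangent_map A (act (torus_exp t)) ?y (coord_change c (chart_at A ?y) ?y v)" for v
    using tangent_map_space_deriv[OF assms(1) chart_inv_in[OF assms(1) p(1)] p(2)]
    by (simp add: chart_inv_right[OF assms(1) p(1)])
  show ?thesis
    by (simp add: fun_eq_iff pullback3_def form3_in_chart_def Let_def chart_inv_chart_flow assms T
        invariant_flow)
qed

text \<open>The form at the moved point, evaluated on the moved vectors, does not change along the
  flow; its derivative at time zero is the Lie derivative on vectors that are constant in the
  chart.\<close>

lemma lie_derivative_zero: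
  fixes c p and \<xi> :: "real^3"
  assumes c: "c \<in> A" and p: "p \<in> chart_image c"
  defines "X' \<equiv> frechet_derivative (chart_field c \<xi>) (at p)"
  shows "frechet_derivative (\<lambda>q. form3_in_chart A c \<omega> q u v w) (at p) (chart_field c \<xi> p)
    + form3_in_chart A c \<omega> p (X' u) v w + form3_in_chart A c \<omega> p u (X' v) w + form3_in_chart A c \<omega>
        p u v (X' w) = 0"
proof -
  let ?f = "form3_in_chart A c \<omega>"
  let ?S = "\<lambda>s u. space_deriv c (s *\<^sub>R \<xi>) p u"
  note alt = form3_in_chart_alternating[OF smooth_form c]
  have d: "((\<lambda>s. ?f (chart_flow c c (s *\<^sub>R \<xi>, p)) (?S s u) (?S s v) (?S s w)) has_derivative
     (\<lambda>s. frechet_derivative (\<lambda>q. ?f q (?S 0 u) (?S 0 v) (?S 0 w)) (at p) (s *\<^sub>R chart_field c \<xi> p)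
       + ?f p (s *\<^sub>R X' u) (?S 0 v) (?S 0 w) + ?f p (?S 0 u) (s *\<^sub>R X' v) (?S 0 w) + ?f p (?S 0 u)
           (?S 0 v) (s *\<^sub>R X' w))) (at 0)"
    unfolding X'_def
    by (rule trilinear_has_derivative[OF open_chart_image[OF c] p alternating3_trilinear[OF alt]
          form3_has_derivative[OF smooth_form c p] chart_flow_curve_has_derivative[OF c p] _
          space_deriv_derivative[OF c p] space_deriv_derivative[OF c p] space_deriv_derivative[OF
              c p]])
      (simp_all add: chart_flow_0 c p)
  obtain I where I: "open I" "0 \<in> I" "\<And>s. s \<in> I \<Longrightarrow> (s *\<^sub>R \<xi>, p) \<in> flow_dom c c"
    by (rule flow_dom_segment[OF c p]) blast
  have "((\<lambda>s. ?f p u v w) has_derivative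
     (\<lambda>s. frechet_derivative (\<lambda>q. ?f q (?S 0 u) (?S 0 v) (?S 0 w)) (at p) (s *\<^sub>R chart_field c \<xi> p)
       + ?f p (s *\<^sub>R X' u) (?S 0 v) (?S 0 w) + ?f p (?S 0 u) (s *\<^sub>R X' v) (?S 0 w) + ?f p (?S 0 u)
           (?S 0 v) (s *\<^sub>R X' w))) (at 0)"
    by (rule has_derivative_transform_within_open[OF d I(1,2)])
      (use form3_in_chart_flow[OF c I(3)] in \<open>simp add: pullback3_def fun_eq_iff\<close>)
  from fun_cong[OF has_derivative_unique[OF this has_derivative_const], of 1] show ?thesis
    by (simp add: space_deriv_0[OF c p])
qed

definition ext_deriv_in_chart :: "('m, 'n) chart \<Rightarrow> real^'n \<Rightarrow> 'n form4" where
  "ext_deriv_in_chart c p v0 v1 v2 v3 =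
     (let D = (\<lambda>v a b d. frechet_derivative (\<lambda>q. form3_in_chart A c \<omega> q a b d) (at p) v)
      in D v0 v1 v2 v3 - D v1 v0 v2 v3 + D v2 v0 v1 v3 - D v3 v0 v1 v2)"

lemma ext_deriv3_in_chart: "ext_deriv3 A \<omega> x = ext_deriv_in_chart (chart_at A x) (coord_at A x)"
  by (simp add: fun_eq_iff ext_deriv3_def ext_deriv_in_chart_def)

text \<open>As the fields commute and their flows preserve the form, all derivatives of the fields cancel.\<close>

lemma contraction_has_derivative:
  assumes c: "c \<in> A" and p: "p \<in> chart_image c"
  shows "((\<lambda>q. form3_in_chart A c \<omega> q (chart_field c \<xi>1 q) (chart_field c \<xi>2 q) (chart_field c \<xi>3
      q)) has_derivative
    (\<lambda>h. ext_deriv_in_chart c p h (chart_field c \<xi>1 p) (chart_field c \<xi>2 p) (chart_field c \<xi>3 p)))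
        (at p)"
proof -
  let ?f = "form3_in_chart A c \<omega>"
  let ?X = "\<lambda>\<xi>. chart_field c \<xi> p"
  let ?X' = "\<lambda>\<xi>. frechet_derivative (chart_field c \<xi>) (at p)"
  note alt = form3_in_chart_alternating[OF smooth_form c]
  have d: "((\<lambda>q. ?f q (chart_field c \<xi>1 q) (chart_field c \<xi>2 q) (chart_field c \<xi>3 q)) has_derivative
    (\<lambda>h. frechet_derivative (\<lambda>q. ?f q (?X \<xi>1) (?X \<xi>2) (?X \<xi>3)) (at p) h
      + ?f p (?X' \<xi>1 h) (?X \<xi>2) (?X \<xi>3) + ?f p (?X \<xi>1) (?X' \<xi>2 h) (?X \<xi>3) + ?f p (?X \<xi>1) (?X \<xi>2)
          (?X' \<xi>3 h))) (at p)"
    by (rule trilinear_has_derivative[OF open_chart_image[OF c] p alternating3_trilinear[OF alt]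
          form3_has_derivative[OF smooth_form c p] has_derivative_ident refl
          chart_field_has_derivative[OF c p] chart_field_has_derivative[OF c p]
              chart_field_has_derivative[OF c p]])
  have comm: "?X' \<xi>2 (?X \<xi>1) = ?X' \<xi>1 (?X \<xi>2)" "?X' \<xi>3 (?X \<xi>1) = ?X' \<xi>1 (?X \<xi>3)" "?X' \<xi>3 (?X \<xi>2) =
      ?X' \<xi>2 (?X \<xi>3)"
    by (rule chart_field_commute[OF c p])+
  have sk: "?f p b a d = - ?f p a b d" "?f p a d b = - ?f p a b d" for a b d
    using alt[OF p] unfolding alternating3_def by blast+
  show ?thesis
  proof (rule has_derivative_eq_rhs[OF d], rule ext)
    fix h
    \<comment> \<open>Solving \<open>L1\<close>, \<open>L2\<close>, \<open>L3\<close> for their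
      first terms replaces the last three terms of the exterior derivative. The terms
      differentiating one field along another cancel in pairs by \<open>comm\<close> and skew
      symmetry; those differentiating a field along \<open>h\<close> are the ones of the product
      rule.\<close>
    note L1 = lie_derivative_zero[OF c p, where \<xi> = \<xi>1 and u = h and v = "?X \<xi>2" and w = "?X \<xi>3"]
    note L2 = lie_derivative_zero[OF c p, where \<xi> = \<xi>2 and u = h and v = "?X \<xi>1" and w = "?X \<xi>3"]
    note L3 = lie_derivative_zero[OF c p, where \<xi> = \<xi>3 and u = h and v = "?X \<xi>1" and w = "?X \<xi>2"]
    note s = sk(1)[of "?X' \<xi>2 h" "?X \<xi>1" "?X \<xi>3"] sk(1)[of "?X' \<xi>3 h" "?X \<xi>1" "?X \<xi>2"]
      sk(2)[of "?X \<xi>1" "?X' \<xi>3 h" "?X \<xi>2"] sk(2)[of h "?X' \<xi>1 (?X \<xi>2)" "?X \<xi>3"]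
      sk(2)[of h "?X' \<xi>2 (?X \<xi>3)" "?X \<xi>1"] sk(2)[of h "?X' \<xi>1 (?X \<xi>3)" "?X \<xi>2"]
    show "frechet_derivative (\<lambda>q. ?f q (?X \<xi>1) (?X \<xi>2) (?X \<xi>3)) (at p) h
      + ?f p (?X' \<xi>1 h) (?X \<xi>2) (?X \<xi>3) + ?f p (?X \<xi>1) (?X' \<xi>2 h) (?X \<xi>3) + ?f p (?X \<xi>1) (?X \<xi>2)
          (?X' \<xi>3 h)
      = ext_deriv_in_chart c p h (?X \<xi>1) (?X \<xi>2) (?X \<xi>3)"
      unfolding ext_deriv_in_chart_def Let_def
      using L1 L2 L3 s unfolding comm by linarith
  qed
qed

lemma contraction_derivative_at:
  "((\<lambda>y. \<omega> y (fundamental_field A act \<xi>1 y) (fundamental_field A act \<xi>2 y) (fundamental_field A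
      act \<xi>3 y)) \<circ> chart_inv (chart_at A x)
    has_derivative (\<lambda>h. ext_deriv3 A \<omega> x h (fundamental_field A act \<xi>1 x) (fundamental_field A act
        \<xi>2 x)
      (fundamental_field A act \<xi>3 x))) (at (coord_at A x))"
  unfolding ext_deriv3_in_chart fundamental_field_chart_at[of _ x]
  by (rule has_derivative_transform_within_open[OF contraction_has_derivative[OF chart_at(1)
      coord_at_in]
        open_chart_image[OF chart_at(1)] coord_at_in])
    (simp add: form3_in_chart_fields[OF chart_at(1)])

lemma critical_point_contraction:
  "critical_point A (\<lambda>y. \<omega> y (fundamental_field A act \<xi>1 y) (fundamental_field A act \<xi>2 y)
      (fundamental_field A act \<xi>3 y)) x
    \<longleftrightarrow> (\<forall>h. ext_deriv3 A \<omega> x h (fundamental_field A act \<xi>1 x) (fundamental_field A act \<xi>2 x)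
      (fundamental_field A act \<xi>3 x) = 0)"
proof -
  note d = contraction_derivative_at[of \<xi>1 \<xi>2 \<xi>3 x]
  show ?thesis
    unfolding critical_point_def
  proof (intro iffI allI)
    fix h
    assume "((\<lambda>y. \<omega> y (fundamental_field A act \<xi>1 y) (fundamental_field A act \<xi>2 y)
        (fundamental_field A act \<xi>3 y))
      \<circ> chart_inv (chart_at A x) has_derivative (\<lambda>_. 0)) (at (coord_at A x))"
    from fun_cong[OF has_derivative_unique[OF d this]]
    show "ext_deriv3 A \<omega> x h (fundamental_field A act \<xi>1 x) (fundamental_field A act \<xi>2 x)
      (fundamental_field A act \<xi>3 x) = 0" .
  next
    assume "\<forall>h. ext_deriv3 A \<omega> x h (fundamental_field A act \<xi>1 x) (fundamental_field A act \<xi>2 x)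
      (fundamental_field A act \<xi>3 x) = 0"
    then show "((\<lambda>y. \<omega> y (fundamental_field A act \<xi>1 y) (fundamental_field A act \<xi>2 y)
        (fundamental_field A act \<xi>3 y))
      \<circ> chart_inv (chart_at A x) has_derivative (\<lambda>_. 0)) (at (coord_at A x))"
      using d by simp
  qed
qed

end

section \<open>Orbits as submanifolds\<close>

text \<open>The component \<open>b\<close> of the velocity normal to \<open>T\<close> is orthogonal
  to the curve near time zero, hence also to the velocity, so that
  \<open>b \<bullet> b = 0\<close>.\<close>

lemma subspace_vector_derivative:
  fixes w :: "real \<Rightarrow> 'a::euclidean_space"
  assumes T: "subspace T" and d: "(w has_vector_derivative v) (at 0)"
    and ev: "\<forall>\<^sub>F s in at 0. w s \<in> T" and w0: "w 0 \<in> T"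
  shows "v \<in> T"
proof -
  obtain a b where ab: "a \<in> span T" "\<And>x. x \<in> span T \<Longrightarrow> orthogonal b x" "v = a + b"
    by (rule orthogonal_subspace_decomp_exists[of T v]) blast
  have sp: "span T = T" using T by (simp add: span_eq_iff)
  have ob: "x \<bullet> b = 0" if "x \<in> T" for x
    using ab(2)[of x] sp that by (simp add: orthogonal_def inner_commute)
  have "((\<lambda>s. w s \<bullet> b) has_derivative (\<lambda>s. (s *\<^sub>R v) \<bullet> b)) (at 0)"
    using d unfolding has_vector_derivative_def by (rule has_derivative_inner_left)
  moreover have "\<forall>\<^sub>F s in at 0. w s \<bullet> b = 0"
    using ev by eventually_elim (rule ob)
  ultimately have "((\<lambda>s. 0) has_derivative (\<lambda>s. (s *\<^sub>R v) \<bullet> b)) (at (0::real))"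
    using has_derivative_transform_eventually[of "\<lambda>s. w s \<bullet> b" _ 0 UNIV "\<lambda>s. 0"] ob[OF w0] by simp
  from fun_cong[OF has_derivative_unique[OF this has_derivative_const], of 1]
  have "v \<bullet> b = 0" by simp
  moreover have "a \<bullet> b = 0" using ab(1) sp ob by simp
  ultimately have "b \<bullet> b = 0" unfolding ab(3) by (simp add: inner_add_left)
  then show ?thesis using ab sp by simp
qed

context torus_manifold
begin

lemma mem_torus_orbit: "z \<in> torus_orbit act y \<longleftrightarrow> (\<exists>t. z = flow t y)"
  unfolding torus_orbit_def flow_def using torus_exp_in by (auto elim!: torus_exp_surj)

lemma torus_orbit_compact_time:
  assumes "z \<in> torus_orbit act y"
  obtains t where "z = flow t y" "t \<in> cbox (\<chi> i. - pi) (\<chi> i. pi)"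
proof -
  obtain u where u: "u \<in> torus3" "z = act u y"
    using assms unfolding torus_orbit_def by blast
  obtain t where "u = torus_exp t" "t \<in> cbox (\<chi> i. - pi) (\<chi> i. pi)"
    by (rule torus_exp_surj[OF u(1)]) blast
  then show ?thesis using that u by (simp add: flow_def)
qed

lemma flow_in_torus_orbit: "flow t z \<in> torus_orbit act y \<longleftrightarrow> z \<in> torus_orbit act y"
proof -
  have "flow t z \<in> torus_orbit act y" if "z \<in> torus_orbit act y" for t z
    using that by (metis mem_torus_orbit flow_add)
  then show ?thesis by (metis flow_minus(1))
qed

lemma self_in_torus_orbit: "y \<in> torus_orbit act y"
  by (metis mem_torus_orbit flow_0)

lemma torus_orbit_eq: "y \<in> torus_orbit act x \<Longrightarrow> torus_orbit act y = torus_orbit act x"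
proof -
  assume "y \<in> torus_orbit act x"
  then obtain t where t: "y = flow t x" by (auto simp: mem_torus_orbit)
  have "z \<in> torus_orbit act y \<longleftrightarrow> z \<in> torus_orbit act x" for z
    unfolding mem_torus_orbit t by (metis flow_add diff_add_cancel)
  then show ?thesis by blast
qed

text \<open>Along the orbit the slice map is the torus flow of the base point, and transversally it is the
  identity in the chart; compactness of the torus keeps the orbit from returning close to \<open>y\<close>.\<close>

lemma orbit_slice:
  assumes inj: "inj (\<lambda>\<xi>. fundamental_field A act \<xi> y)"
  defines "c \<equiv> chart_at A y" and "p \<equiv> coord_at A y"
    and "T \<equiv> range (\<lambda>\<xi>. fundamental_field A act \<xi> y)"
  obtains B F G where "open B" "0 \<in> B" "F ` B \<subseteq> chart_image c" "open (F ` B)"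
    "homeomorphism B (F ` B) F G" "smooth_on B F" "smooth_on (F ` B) G" "F 0 = p"
    "frechet_derivative F (at 0) = (\<lambda>v. v)"
    "\<And>q. q \<in> B \<Longrightarrow> chart_inv c (F q) \<in> torus_orbit act y \<longleftrightarrow> q \<in> T"
proof -
  define J where "J \<xi> = fundamental_field A act \<xi> y" for \<xi>
  have c: "c \<in> A" "y \<in> fst c" "p \<in> chart_image c" and y: "chart_inv c p = y" "snd c y = p"
    unfolding c_def p_def by (simp_all add: chart_at coord_at_in chart_inv_coord_at, simp add:
        coord_at_def)
  have J: "J \<xi> = chart_field c \<xi> p" for \<xi>
    by (simp add: J_def c_def p_def fundamental_field_chart_at)
  have linJ: "linear J" using linear_fundamental_field[of y] by (simp add: J_def[abs_def])
  have "inj J" using inj by (simp add: J_def[abs_def])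
  then obtain K where K: "linear K" "K \<circ> J = id"
    using linear_injective_left_inverse[OF linJ] by blast
  have KJ: "K (J \<xi>) = \<xi>" for \<xi> using K(2) by (metis comp_apply id_apply)
  \<comment> \<open>\<open>K\<close> reads off a torus time and \<open>R\<close> is the projection
    with kernel \<open>T\<close>. A vector thus splits into a time and a transversal part, and the
    slice map flows the transversal point for that time.\<close>
  define R where "R q = q - J (K q)" for q
  have linR: "linear R"
    unfolding R_def using linear_compose_sub[OF linear_id linear_compose[OF K(1) linJ]] by (simp
        add: o_def id_def)
  have RJ: "R (J \<xi>) = 0" for \<xi> by (simp add: R_def KJ)
  have KR: "K (R q) = 0" for q by (simp add: R_def linear_diff[OF K(1)] KJ)
  have RR: "R (R q) = R q" for q by (simp add: R_def[of "R q"] KR linear_0[OF linJ])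
  have R0: "R q = 0 \<longleftrightarrow> q \<in> T" for q
    using RJ by (auto simp: R_def T_def J_def[symmetric] image_iff)
  define F where "F q = chart_flow c c (K q, p + R q)" for q
  define D0 where "D0 = (\<lambda>q. (K q, p + R q)) -` flow_dom c c"
  have bl: "bounded_linear (\<lambda>q. (K q, R q))"
    by (intro bounded_linear_Pair linear_conv_bounded_linear[THEN iffD1] K linR)
  have af: "(0, p) + (K q, R q) = (K q, p + R q)" for q by simp
  have "continuous_on UNIV (\<lambda>q. (K q, p + R q))"
    by (intro continuous_on_Pair continuous_on_add continuous_on_const linear_continuous_on
        linear_conv_bounded_linear[THEN iffD1] K linR)
  then have D0: "open D0" "0 \<in> D0"
    using linear_0[OF K(1)] linear_0[OF linR] zero_in_flow_dom[OF c(1,3)]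
    by (auto simp: D0_def intro!: open_vimage open_flow_dom c)
  have smooth_F: "smooth_on D0 F"
    unfolding F_def using smooth_on_affine[OF bl D0(1), of "(0, p)"] unfolding af
    by (rule smooth_on_compose[OF D0(1) _ smooth_chart_flow[OF c(1,1)]]) (auto simp: D0_def)
  have "(F has_derivative (\<lambda>v. v)) (at 0)"
  proof -
    let ?D = "frechet_derivative (chart_flow c c) (at (0, p))"
    note d = chart_flow_has_derivative[OF c(1,1) zero_in_flow_dom[OF c(1,3)]]
    have "((\<lambda>q. (K q, p + R q)) has_derivative (\<lambda>v. (K v, R v))) (at 0)"
      using has_derivative_add[OF has_derivative_const bounded_linear_imp_has_derivative[OF bl],
          of "(0, p)"]
      by simp
    moreover have "(chart_flow c c has_derivative ?D) (at (K 0, p + R 0))"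
      using d by (simp add: linear_0[OF K(1)] linear_0[OF linR])
    ultimately have "(F has_derivative (\<lambda>v. ?D (K v, R v))) (at 0)"
      unfolding F_def using diff_chain_at by (fastforce simp: o_def)
    moreover have "?D (K v, R v) = v" for v
    proof -
      have "?D (K v, R v) = ?D (K v, 0) + ?D (0, R v)"
        using linear_add[OF has_derivative_linear[OF d], of "(K v, 0)" "(0, R v)"] by simp
      also have "\<dots> = J (K v) + R v"
        using space_deriv_0[OF c(1,3), of "R v"] by (simp add: J chart_field_def space_deriv_def)
      finally show ?thesis by (simp add: R_def)
    qed
    ultimately show ?thesis by simp
  qed
  then have DF: "frechet_derivative F (at 0) = (\<lambda>v. v)"
    by (rule frechet_derivative_at[symmetric])
  obtain U' V G where U': "open U'" "U' \<subseteq> D0" "0 \<in> U'" "open V" "homeomorphism U' V F G"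
      "smooth_on V G"
    using smooth_local_inverse[OF D0(1) smooth_F D0(2) DF] .
  have FD0: "p + R q \<in> chart_image c" "F q \<in> chart_image c"
    "chart_inv c (F q) = flow (K q) (chart_inv c (p + R q))" if "q \<in> D0" for q
    using that c by (auto simp: D0_def F_def flow_dom_iff chart_inv_chart_flow intro!:
        chart_flow_in)
  have injF: "inj_on F U'" using U'(5) by (metis homeomorphism_apply1 inj_on_inverseI)
  have "\<exists>r>0. ball 0 r \<subseteq> U' \<and> (\<forall>q\<in>ball 0 r. chart_inv c (F q) \<in> torus_orbit act y \<longrightarrow> R q = 0)"
  proof (rule ccontr)
    assume neg: "\<not> ?thesis"
    obtain r0 where r0: "r0 > 0" "ball 0 r0 \<subseteq> U'"
      using U'(1,3) open_contains_ball by blast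
    define e where "e n = min r0 (inverse (real (Suc n)))" for n
    have e: "e n > 0" "ball 0 (e n) \<subseteq> U'" for n
      using r0 by (auto simp: e_def)
    have "\<exists>q\<in>ball 0 (e n). chart_inv c (F q) \<in> torus_orbit act y \<and> R q \<noteq> 0" for n
      using neg e by blast
    then obtain q where q: "\<And>n. q n \<in> ball 0 (e n)" "\<And>n. chart_inv c (F (q n)) \<in> torus_orbit act
        y" "\<And>n. R (q n) \<noteq> 0"
      by metis
    have "norm (q n) \<le> inverse (real (Suc n))" for n using q(1)[of n] by (simp add: e_def)
    then have "q \<longlonglongrightarrow> 0"
      using LIMSEQ_inverse_real_of_nat by (rule Lim_null_comparison[OF eventuallyI])
    have "q n \<in> D0" for n using q(1) e(2) U'(2) by blast
    note qD = FD0[OF this]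
    have "chart_inv c (p + R (q n)) \<in> torus_orbit act y" for n
      using q(2)[of n] unfolding qD(3) flow_in_torus_orbit .
    then have "\<exists>t. chart_inv c (p + R (q n)) = flow t y \<and> t \<in> cbox (\<chi> i. - pi) (\<chi> i. pi)" for n
      by (metis torus_orbit_compact_time)
    then obtain \<tau> where \<tau>: "\<And>n. chart_inv c (p + R (q n)) = flow (\<tau> n) y" "\<And>n. \<tau> n \<in> cbox (\<chi> i. -
        pi) (\<chi> i. pi)"
      by metis
    obtain l r where l: "strict_mono r" "(\<tau> \<circ> r) \<longlonglongrightarrow> l"
      using compact_cbox \<tau>(2) unfolding compact_def by metis
    have qr: "(\<lambda>n. q (r n)) \<longlonglongrightarrow> 0"
      using LIMSEQ_subseq_LIMSEQ[OF \<open>q \<longlonglongrightarrow> 0\<close> l(1)] by (simp add: o_def)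
    have "isCont R 0" using linR by (simp add: linear_continuous_at linear_conv_bounded_linear)
    from isCont_tendsto_compose[OF this qr]
    have Rq: "(\<lambda>n. R (q (r n))) \<longlonglongrightarrow> 0" by (simp add: linear_0[OF linR])
    then have "(\<lambda>n. p + R (q (r n))) \<longlonglongrightarrow> p" by (auto intro: tendsto_eq_intros)
    from isCont_tendsto_compose[OF isCont_chart_inv[OF c(1,3)] this]
    have "(\<lambda>n. flow (\<tau> (r n)) y) \<longlonglongrightarrow> y" by (simp add: \<tau>(1) y)
    moreover have "isCont (\<lambda>t. flow t y) l" by (intro isCont_flow_compose) auto
    from isCont_tendsto_compose[OF this l(2)]
    have "(\<lambda>n. flow (\<tau> (r n)) y) \<longlonglongrightarrow> flow l y" by (simp add: o_def)
    ultimately have ly: "flow l y = y" using LIMSEQ_unique by blast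
    \<comment> \<open>The limit time \<open>l\<close> fixes \<open>y\<close>, so subtracting it
      leaves arbitrarily small return times. Then \<open>J (\<sigma> n)\<close> and
      \<open>R (q (r n))\<close> are small vectors with the same image under \<open>F\<close>;
      injectivity identifies them, and applying \<open>R\<close> contradicts the choice of
      \<open>q\<close>.\<close>
    define \<sigma> where "\<sigma> n = \<tau> (r n) - l" for n
    have "\<sigma> \<longlonglongrightarrow> 0" unfolding \<sigma>_def using l(2) by (simp add: o_def LIM_zero)
    have \<sigma>y: "flow (\<tau> (r n)) y = flow (\<sigma> n) y" for n
      using flow_add[of "\<sigma> n" l y] ly by (simp add: \<sigma>_def)
    have "isCont J 0" using linJ by (simp add: linear_continuous_at linear_conv_bounded_linear)
    from isCont_tendsto_compose[OF this \<open>\<sigma> \<longlonglongrightarrow> 0\<close>]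
    have "(\<lambda>n. J (\<sigma> n)) \<longlonglongrightarrow> 0" by (simp add: linear_0[OF linJ])
    then have "\<forall>\<^sub>F n in sequentially. J (\<sigma> n) \<in> U'"
      using U'(1,3) by (rule topological_tendstoD)
    moreover have "\<forall>\<^sub>F n in sequentially. R (q (r n)) \<in> U'"
      using Rq U'(1,3) by (rule topological_tendstoD)
    ultimately have "\<forall>\<^sub>F n in sequentially. J (\<sigma> n) \<in> U' \<and> R (q (r n)) \<in> U'"
      by (rule eventually_conj)
    then obtain n where n: "J (\<sigma> n) \<in> U'" "R (q (r n)) \<in> U'"
      using eventually_happens by fastforce
    have "F (J (\<sigma> n)) = snd c (flow (\<sigma> n) y)"
      by (simp add: F_def KJ RJ chart_flow_def y)
    also have "\<dots> = snd c (chart_inv c (p + R (q (r n))))"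
      by (simp add: \<tau>(1) \<sigma>y)
    also have "\<dots> = p + R (q (r n))" by (rule chart_inv_right[OF c(1) qD(1)])
    also have "\<dots> = F (R (q (r n)))"
      by (simp add: F_def KR RR chart_flow_0[OF c(1) qD(1)])
    finally have "J (\<sigma> n) = R (q (r n))"
      using injF n by (auto dest: inj_onD)
    then have "R (q (r n)) = 0" using RJ RR by metis
    then show False using q(3) by blast
  qed
  then obtain r where r: "r > 0" "ball 0 r \<subseteq> U'"
    "\<And>q. q \<in> ball 0 r \<Longrightarrow> chart_inv c (F q) \<in> torus_orbit act y \<Longrightarrow> R q = 0" by blast
  let ?B = "ball (0 :: real^'n) r"
  have BD: "?B \<subseteq> D0" using r(2) U'(2) by blast
  have FV: "F ` ?B \<subseteq> V" using r(2) U'(5) by (auto simp: homeomorphism_def)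
  have FB: "F ` ?B = V \<inter> G -` ?B"
  proof
    show "F ` ?B \<subseteq> V \<inter> G -` ?B"
    proof
      fix z assume "z \<in> F ` ?B"
      then obtain q where q: "q \<in> ?B" "z = F q" by blast
      then have "G z = q" using homeomorphism_apply1[OF U'(5), of q] r(2) by blast
      then show "z \<in> V \<inter> G -` ?B" using q FV by blast
    qed
    show "V \<inter> G -` ?B \<subseteq> F ` ?B"
    proof
      fix z assume z: "z \<in> V \<inter> G -` ?B"
      then have "z = F (G z)" using homeomorphism_apply2[OF U'(5), of z] by simp
      then show "z \<in> F ` ?B" using z by blast
    qed
  qed
  have oF: "open (F ` ?B)"
    unfolding FB using smooth_on_continuous[OF U'(6)] by (rule continuous_open_preimage) (use U'
        in auto)
  show ?thesis
  proof (rule that[of ?B F G])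
    show "F ` ?B \<subseteq> chart_image c" using FD0(2) BD by blast
    show "homeomorphism ?B (F ` ?B) F G"
      by (rule homeomorphism_of_subsets[OF U'(5) r(2)]) (use FV in auto)
    show "smooth_on ?B F" by (rule smooth_on_subset[OF smooth_F BD])
    show "smooth_on (F ` ?B) G" by (rule smooth_on_subset[OF U'(6) FV])
    show "F 0 = p" by (simp add: F_def linear_0[OF K(1)] linear_0[OF linR] chart_flow_0[OF c(1,3)])
    show "chart_inv c (F q) \<in> torus_orbit act y \<longleftrightarrow> q \<in> T" if "q \<in> ?B" for q
    proof
      assume "chart_inv c (F q) \<in> torus_orbit act y"
      then show "q \<in> T" using r(3)[OF that] R0 by blast
    next
      assume "q \<in> T"
      then have "R q = 0" using R0 by blast
      then have "chart_inv c (F q) = flow (K q) y" using FD0(3)[of q] BD that y by auto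
      then show "chart_inv c (F q) \<in> torus_orbit act y" by (auto simp: mem_torus_orbit)
    qed
  qed (use r oF DF in auto)
qed

text \<open>The transition maps to and from the new chart are old ones composed with
  \<open>F\<close> or \<open>G\<close>, so smoothness of both makes the chart compatible with the
  atlas.\<close>

lemma slice_chart:
  assumes c: "c \<in> A" and B: "open B" "F ` B \<subseteq> chart_image c" "open (F ` B)"
    "homeomorphism B (F ` B) F G" "smooth_on B F" "smooth_on (F ` B) G"
  defines "d \<equiv> (chart_inv c ` F ` B, G \<circ> snd c)"
  shows "smooth_atlas (insert d A)" "chart_image d = B" "\<And>q. q \<in> B \<Longrightarrow> chart_inv d q = chart_inv c
      (F q)"
    "\<And>z. z \<in> fst d \<longleftrightarrow> z \<in> fst c \<and> snd c z \<in> F ` B"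
proof -
  have GF: "G (F q) = q" if "q \<in> B" for q using B(4) that by (simp add: homeomorphism_apply1)
  have FG: "F (G x) = x" "G x \<in> B" if "x \<in> F ` B" for x
    using B(4) that by (simp add: homeomorphism_apply2, auto simp: homeomorphism_def)
  have Fc: "F q \<in> chart_image c" if "q \<in> B" for q using that B(2) by blast
  show fst_d: "z \<in> fst d \<longleftrightarrow> z \<in> fst c \<and> snd c z \<in> F ` B" for z
  proof
    assume "z \<in> fst d"
    then show "z \<in> fst c \<and> snd c z \<in> F ` B"
      using Fc by (auto simp: d_def chart_inv_in[OF c] chart_inv_right[OF c])
  next
    assume "z \<in> fst c \<and> snd c z \<in> F ` B"
    then show "z \<in> fst d" unfolding d_def by (metis chart_inv_left[OF c] fst_conv imageI)
  qed
  have snd_d: "snd d z = G (snd c z)" for z by (simp add: d_def)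
  have Fd: "chart_inv c (F q) \<in> fst d" if "q \<in> B" for q using that by (auto simp: d_def)
  have sF: "snd d (chart_inv c (F q)) = q" if "q \<in> B" for q
    using that by (simp add: snd_d chart_inv_right[OF c] Fc GF)
  show img: "chart_image d = B"
    unfolding chart_image_def
  proof
    show "snd d ` fst d \<subseteq> B" using fst_d FG(2) by (auto simp: snd_d)
    show "B \<subseteq> snd d ` fst d" using Fd sF by (metis imageI subsetI)
  qed
  have inj: "inj_on (snd d) (fst d)"
    by (rule inj_on_inverseI[of _ "\<lambda>q. chart_inv c (F q)"]) (auto simp: snd_d fst_d FG(1)
        chart_inv_left[OF c])
  show inv: "chart_inv d q = chart_inv c (F q)" if "q \<in> B" for q
    unfolding chart_inv_def[of d] using inj Fd[OF that] sF[OF that] by (metis inv_into_f_eq)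
  have "fst d = fst c \<inter> snd c -` (F ` B)" using fst_d by blast
  then have od: "open (fst d)"
    using continuous_open_preimage[OF continuous_chart[OF c] open_chart[OF c] B(3)] by simp
  have hd: "homeomorphism (fst d) (chart_image d) (snd d) (chart_inv d)"
    unfolding homeomorphism_def
  proof (intro conjI ballI)
    show "continuous_on (fst d) (snd d)"
    proof -
      have f: "continuous_on (fst d) (snd c)"
        using continuous_on_subset[OF continuous_chart[OF c]] fst_d by blast
      have g: "continuous_on (F ` B) G" using B(4) by (simp add: homeomorphism_def)
      have "continuous_on (fst d) (\<lambda>z. G (snd c z))"
        by (rule continuous_on_compose2[OF g f]) (use fst_d in auto)
      then show ?thesis by (simp add: d_def o_def)
    qed
    show "continuous_on (chart_image d) (chart_inv d)"
    proof -
      have "continuous_on B (\<lambda>q. chart_inv c (F q))"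
        by (rule continuous_on_compose2[OF continuous_chart_inv[OF c] smooth_on_continuous[OF
            B(5)] B(2)])
      then show ?thesis unfolding img by (rule continuous_on_eq) (simp add: inv)
    qed
    show "snd d ` fst d = chart_image d" by (simp add: chart_image_def)
    show "chart_inv d ` chart_image d = fst d"
      unfolding img using inv Fd by (auto simp: d_def image_iff)
    show "chart_inv d (snd d z) = z" if "z \<in> fst d" for z
      using that FG by (auto simp: snd_d fst_d inv chart_inv_left[OF c])
    show "snd d (chart_inv d q) = q" if "q \<in> chart_image d" for q
      using that unfolding img by (simp add: inv sF)
  qed
  have da: "smooth_on (snd d ` (fst d \<inter> fst a)) (snd a \<circ> chart_inv d)" if a: "a \<in> A" for a
  proof -
    have S: "snd d ` (fst d \<inter> fst a) = B \<inter> F -` (snd c ` (fst c \<inter> fst a))" (is "?S = _")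
    proof
      show "?S \<subseteq> B \<inter> F -` (snd c ` (fst c \<inter> fst a))"
      proof
        fix q assume "q \<in> ?S"
        then obtain z where z: "z \<in> fst d" "z \<in> fst a" "q = G (snd c z)" by (auto simp: snd_d)
        then have "z \<in> fst c" "q \<in> B" "F q = snd c z" using FG by (simp_all add: fst_d)
        then show "q \<in> B \<inter> F -` (snd c ` (fst c \<inter> fst a))" using z(2) by auto
      qed
      show "B \<inter> F -` (snd c ` (fst c \<inter> fst a)) \<subseteq> ?S"
      proof
        fix q assume q: "q \<in> B \<inter> F -` (snd c ` (fst c \<inter> fst a))"
        then obtain z where z: "z \<in> fst c" "z \<in> fst a" "F q = snd c z" by blast
        have "z \<in> fst d" using z(1) z(3)[symmetric] q by (simp add: fst_d)
        moreover have "snd d z = q" using z(3)[symmetric] q by (simp add: snd_d GF)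
        ultimately show "q \<in> ?S" using z(2) by blast
      qed
    qed
    have oS: "open ?S" unfolding S
      by (rule continuous_open_preimage[OF smooth_on_continuous[OF B(5)] B(1)
          open_chart_preimage[OF c open_chart[OF a]]])
    have "smooth_on ?S (\<lambda>q. (snd a \<circ> chart_inv c) (F q))"
      by (rule smooth_on_compose[OF oS smooth_on_subset[OF B(5)] smooth_transition[OF c a]]) (use
          S in auto)
    then show ?thesis
      by (subst smooth_on_cong[OF oS, where g = "\<lambda>q. (snd a \<circ> chart_inv c) (F q)"]) (auto simp: S
          inv)
  qed
  have ad: "smooth_on (snd a ` (fst a \<inter> fst d)) (snd d \<circ> chart_inv a)" if a: "a \<in> A" for a
  proof -
    let ?S = "snd a ` (fst a \<inter> fst d)"
    have oS: "open ?S" by (rule open_chart_preimage[OF a od])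
    have "smooth_on ?S (\<lambda>q. G ((snd c \<circ> chart_inv a) q))"
      by (rule smooth_on_compose[OF oS smooth_on_subset[OF smooth_transition[OF a c]] B(6)])
        (auto simp: fst_d chart_inv_left[OF a])
    then show ?thesis by (simp add: d_def o_def)
  qed
  have dd: "smooth_on (snd d ` (fst d \<inter> fst d)) (snd d \<circ> chart_inv d)"
  proof -
    have "smooth_on B (\<lambda>q. q)" using smooth_on_affine[OF bounded_linear_ident B(1), of 0] by simp
    then have "smooth_on B (snd d \<circ> chart_inv d)"
      by (subst smooth_on_cong[OF B(1), where g = "\<lambda>q. q"]) (auto simp: inv sF)
    then show ?thesis using img by (simp add: chart_image_def)
  qed
  show "smooth_atlas (insert d A)"
    unfolding smooth_atlas_def
  proof (intro conjI ballI)
    show "(\<Union>c\<in>insert d A. fst c) = UNIV" using atlas by (auto simp: smooth_atlas_def)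
  next
    fix a b assume "a \<in> insert d A" "b \<in> insert d A"
    then show "smooth_on (snd a ` (fst a \<inter> fst b)) (snd b \<circ> chart_inv a)"
      using da ad dd smooth_transition by blast
  next
    fix a assume a: "a \<in> insert d A"
    have od': "open (chart_image d)" using img B(1) by simp
    show "open (fst a)"
    proof (cases "a = d")
      case True
      show ?thesis unfolding True by (rule od)
    next
      case False
      then have "a \<in> A" using a by blast
      then show ?thesis by (rule open_chart)
    qed
    show "open (chart_image a)"
    proof (cases "a = d")
      case True
      show ?thesis unfolding True by (rule od')
    next
      case False
      then have "a \<in> A" using a by blast
      then show ?thesis by (rule open_chart_image)
    qed
    show "homeomorphism (fst a) (chart_image a) (snd a) (chart_inv a)"
    proof (cases "a = d")
      case True
      show ?thesis unfolding True by (rule hd)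
    next
      case False
      then have "a \<in> A" using a by blast
      then show ?thesis by (rule chart_homeomorphism)
    qed
  qed
qed

lemma embedded_orbit:
  assumes "\<And>y. y \<in> torus_orbit act x \<Longrightarrow> inj (\<lambda>\<xi>. fundamental_field A act \<xi> y)"
  shows "embedded_submanifold A 3 (torus_orbit act x)"
  unfolding embedded_submanifold_def
proof
  fix y assume y: "y \<in> torus_orbit act x"
  let ?c = "chart_at A y" and ?T = "range (\<lambda>\<xi>. fundamental_field A act \<xi> y)"
  obtain B F G where B: "open B" "0 \<in> B" "F ` B \<subseteq> chart_image ?c" "open (F ` B)"
    "homeomorphism B (F ` B) F G" "smooth_on B F" "smooth_on (F ` B) G" "F 0 = coord_at A y"
    "frechet_derivative F (at 0) = (\<lambda>v. v)"
    "\<And>q. q \<in> B \<Longrightarrow> chart_inv ?c (F q) \<in> torus_orbit act y \<longleftrightarrow> q \<in> ?T"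
    by (rule orbit_slice[OF assms[OF y]]) blast
  define d where "d = (chart_inv ?c ` F ` B, G \<circ> snd ?c)"
  note s = slice_chart[OF chart_at(1) B(1,3,4,5,6,7), folded d_def]
  have T: "subspace ?T" "dim ?T = 3"
    using linear_subspace_image[OF linear_fundamental_field subspace_UNIV]
      dim_image_eq[OF linear_fundamental_field, where S = UNIV] assms[OF y] by (simp_all add:
          span_UNIV)
  have "y \<in> fst d"
    unfolding s(4) using B(8) imageI[OF B(2), of F] chart_at(2)[of y] by (simp add: coord_at_def)
  moreover have "snd d ` (fst d \<inter> torus_orbit act x) = chart_image d \<inter> ?T"
  proof -
    \<comment> \<open>The enlarged atlas is again a smooth manifold, so
      \<open>chart_preimage\<close> applies to the new chart.\<close>
    interpret e: smooth_manifold "insert d A" by unfold_locales (rule s(1))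
    show ?thesis
      unfolding e.chart_preimage[OF insertI1] using s(2,3) B(10) torus_orbit_eq[OF y] by auto
  qed
  ultimately show "\<exists>c S. smooth_atlas (insert c A) \<and> y \<in> fst c \<and> subspace S \<and> dim S = 3 \<and>
      snd c ` (fst c \<inter> torus_orbit act x) = chart_image c \<inter> S"
    using s(1) T by blast
qed

section \<open>Tangent spaces of orbits\<close>

lemma inverse_derivative_id:
  assumes "open W" "smooth_on W G" "p \<in> W" "\<And>x. x \<in> W \<Longrightarrow> F (G x) = x"
    "(F has_derivative (\<lambda>v. v)) (at (G p))"
  shows "frechet_derivative G (at p) = (\<lambda>v. v)"
proof -
  have "((\<lambda>x. F (G x)) has_derivative frechet_derivative G (at p)) (at p)"
    using diff_chain_at[OF smooth_on_has_derivative[OF assms(2,3)] assms(5)] by (simp add: o_def)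
  then have "((\<lambda>x. x) has_derivative frechet_derivative G (at p)) (at p)"
    by (rule has_derivative_transform_within_open[OF _ assms(1,3)]) (rule assms(4))
  from has_derivative_unique[OF this has_derivative_ident] show ?thesis .
qed

text \<open>The inverse of the slice map straightens the orbit near \<open>y\<close> into the linear
  space \<open>T\<close> without changing velocities at \<open>p\<close>; only these two properties
  are kept.\<close>

lemma orbit_slice_retraction:
  assumes inj: "inj (\<lambda>\<xi>. fundamental_field A act \<xi> y)"
  defines "c \<equiv> chart_at A y" and "p \<equiv> coord_at A y"
    and "T \<equiv> range (\<lambda>\<xi>. fundamental_field A act \<xi> y)"
  obtains W G where "open W" "p \<in> W" "smooth_on W G" "frechet_derivative G (at p) = (\<lambda>v. v)"
    "\<And>z. z \<in> fst c \<Longrightarrow> snd c z \<in> W \<Longrightarrow> z \<in> torus_orbit act y \<Longrightarrow> G (snd c z) \<in> T"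
proof -
  have c: "c \<in> A" by (simp add: c_def chart_at)
  obtain B F G where B: "open B" "0 \<in> B" "F ` B \<subseteq> chart_image c" "open (F ` B)"
    "homeomorphism B (F ` B) F G" "smooth_on B F" "smooth_on (F ` B) G" "F 0 = p"
    "frechet_derivative F (at 0) = (\<lambda>v. v)"
    "\<And>q. q \<in> B \<Longrightarrow> chart_inv c (F q) \<in> torus_orbit act y \<longleftrightarrow> q \<in> T"
    by (rule orbit_slice[OF inj, folded c_def p_def T_def]) blast
  have FG: "F (G x) = x" "G x \<in> B" if "x \<in> F ` B" for x
    using homeomorphism_apply2[OF B(5) that] homeomorphism_image2[OF B(5)] that by blast+
  have p: "p \<in> F ` B" using imageI[OF B(2), of F] B(8) by simp
  have "G p = 0" using homeomorphism_apply1[OF B(5,2)] B(8) by simp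
  then have "(F has_derivative (\<lambda>v. v)) (at (G p))"
    using smooth_on_has_derivative[OF B(6,2)] B(9) by simp
  then have "frechet_derivative G (at p) = (\<lambda>v. v)"
    by (intro inverse_derivative_id[OF B(4,7) p FG(1)])
  moreover have "G (snd c z) \<in> T" if "z \<in> fst c" "snd c z \<in> F ` B" "z \<in> torus_orbit act y" for z
    using that FG[OF that(2)] B(10)[of "G (snd c z)"] by (simp add: chart_inv_left[OF c])
  ultimately show ?thesis using that B(4,7) p by blast
qed

text \<open>A curve in the orbit comes without a lift to the torus, so it cannot be differentiated
  through the action. Its straightening by \<open>G\<close> lies in \<open>T\<close> and has the
  same velocity, which \<open>subspace_vector_derivative\<close> places in \<open>T\<close>.\<close>

lemma submanifold_tangent_orbit:
  assumes inj: "inj (\<lambda>\<xi>. fundamental_field A act \<xi> y)"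
  shows "submanifold_tangent A (torus_orbit act y) y = range (\<lambda>\<xi>. fundamental_field A act \<xi> y)"
proof
  let ?c = "chart_at A y" and ?T = "range (\<lambda>\<xi>. fundamental_field A act \<xi> y)"
  show "?T \<subseteq> submanifold_tangent A (torus_orbit act y) y"
  proof
    fix v assume "v \<in> ?T"
    then obtain \<xi> where v: "v = fundamental_field A act \<xi> y" by blast
    have "((snd ?c \<circ> (\<lambda>s. flow (s *\<^sub>R \<xi>) y)) has_vector_derivative v) (at 0)"
      using flow_curve_chart[OF chart_at, of y \<xi>]
      by (simp add: has_vector_derivative_def o_def v fundamental_field_chart_at coord_at_def)
    then show "v \<in> submanifold_tangent A (torus_orbit act y) y"
      unfolding submanifold_tangent_def using isCont_flow_curve[where \<xi> = \<xi> and y = y and s = 0]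
      by (auto intro!: exI[of _ "\<lambda>s. flow (s *\<^sub>R \<xi>) y"] simp: flow_0 mem_torus_orbit)
  qed
  show "submanifold_tangent A (torus_orbit act y) y \<subseteq> ?T"
  proof
    fix v assume "v \<in> submanifold_tangent A (torus_orbit act y) y"
    then obtain \<gamma> where \<gamma>: "\<gamma> 0 = y" "\<And>s. \<gamma> s \<in> torus_orbit act y" "isCont \<gamma> 0"
      "((snd ?c \<circ> \<gamma>) has_vector_derivative v) (at 0)"
      unfolding submanifold_tangent_def by blast
    obtain W G where W: "open W" "coord_at A y \<in> W" "smooth_on W G" "frechet_derivative G (at
        (coord_at A y)) = (\<lambda>v. v)"
      "\<And>z. z \<in> fst ?c \<Longrightarrow> snd ?c z \<in> W \<Longrightarrow> z \<in> torus_orbit act y \<Longrightarrow> G (snd ?c z) \<in> ?T"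
      by (rule orbit_slice_retraction[OF inj]) blast
    have p: "snd ?c (\<gamma> 0) = coord_at A y" by (simp add: \<gamma>(1) coord_at_def)
    have "\<forall>\<^sub>F s in at 0. \<gamma> s \<in> fst ?c"
      using topological_tendstoD[OF \<gamma>(3)[unfolded isCont_def] open_chart[OF chart_at(1)]] \<gamma>(1)
          chart_at(2)[of y] by simp
    moreover have "isCont (\<lambda>s. snd ?c (\<gamma> s)) 0"
      using \<gamma>(3) isCont_chart[OF chart_at(1) chart_at(2)] by (intro isCont_o2[OF \<gamma>(3)]) (simp add:
          \<gamma>(1))
    then have "\<forall>\<^sub>F s in at 0. snd ?c (\<gamma> s) \<in> W"
      using topological_tendstoD[OF _ W(1), of "\<lambda>s. snd ?c (\<gamma> s)"] W(2) p unfolding isCont_def by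
          simp
    ultimately have ev: "\<forall>\<^sub>F s in at 0. G (snd ?c (\<gamma> s)) \<in> ?T"
      by eventually_elim (use W(5) \<gamma>(2) in blast)
    have "((\<lambda>s. G (snd ?c (\<gamma> s))) has_vector_derivative v) (at 0)"
    proof -
      have "(G has_derivative (\<lambda>v. v)) (at ((snd ?c \<circ> \<gamma>) 0))"
        using smooth_on_has_derivative[OF W(3,2)] W(4) p by simp
      from diff_chain_at[OF \<gamma>(4)[unfolded has_vector_derivative_def] this]
      show ?thesis by (simp add: has_vector_derivative_def o_def)
    qed
    moreover have "G (snd ?c (\<gamma> 0)) \<in> ?T"
      using W(2) W(5)[of y] \<gamma>(1) p chart_at(2)[of y] self_in_torus_orbit[of y] by simp
    ultimately show "v \<in> ?T"
      using subspace_vector_derivative[OF _ _ ev] linear_subspace_image[OF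
          linear_fundamental_field subspace_UNIV]
      by blast
  qed
qed

text \<open>Two tangent extensions of a vector differ by a field \<open>Z\<close> vanishing at
  \<open>p\<close>. The derivative of \<open>G\<close> carries \<open>Z\<close> into
  \<open>T\<close> along the orbit, and differentiating there leaves only \<open>Z'\<close>, because
  \<open>Z p = 0\<close> kills the second derivative of \<open>G\<close>. This is why the second
  fundamental form is well defined.\<close>

lemma tangential_derivative:
  assumes inj: "inj (\<lambda>\<xi>. fundamental_field A act \<xi> y)"
  defines "c \<equiv> chart_at A y" and "p \<equiv> coord_at A y"
  assumes V: "open V" "y \<in> V" and Z: "(Z has_derivative Z') (at p)" "Z p = 0"
    and tan: "\<And>z. z \<in> V \<Longrightarrow> z \<in> fst c \<Longrightarrow> z \<in> torus_orbit act y \<Longrightarrow> \<exists>\<xi>. Z (snd c z) = chart_field c \<xi>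
        (snd c z)"
  shows "Z' (fundamental_field A act \<eta> y) \<in> range (\<lambda>\<xi>. fundamental_field A act \<xi> y)" (is "_ \<in> ?T")
proof -
  have c: "c \<in> A" "y \<in> fst c" "p \<in> chart_image c" and y: "chart_inv c p = y" "snd c y = p"
    unfolding c_def p_def by (simp_all add: chart_at coord_at_in chart_inv_coord_at, simp add:
        coord_at_def)
  have subT: "subspace ?T" by (rule linear_subspace_image[OF linear_fundamental_field
      subspace_UNIV])
  obtain W G where W: "open W" "p \<in> W" "smooth_on W G" "frechet_derivative G (at p) = (\<lambda>v. v)"
    "\<And>z. z \<in> fst c \<Longrightarrow> snd c z \<in> W \<Longrightarrow> z \<in> torus_orbit act y \<Longrightarrow> G (snd c z) \<in> ?T"
    by (rule orbit_slice_retraction[OF inj, folded c_def p_def]) blast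
  \<comment> \<open>The image is the velocity of \<open>G\<close> along an orbit curve, which stays
    in \<open>T\<close>.\<close>
  have push: "frechet_derivative G (at (snd c z)) (chart_field c \<xi> (snd c z)) \<in> ?T"
    if z: "z \<in> fst c" "snd c z \<in> W" "z \<in> torus_orbit act y" for z \<xi>
  proof (rule subspace_vector_derivative[OF subT])
    have f0: "snd c (flow (0 *\<^sub>R \<xi>) z) = snd c z" by (simp add: flow_0)
    have "(G has_derivative frechet_derivative G (at (snd c z))) (at (snd c (flow (0 *\<^sub>R \<xi>) z)))"
      using smooth_on_has_derivative[OF W(3) z(2)] f0 by simp
    from diff_chain_at[OF flow_curve_chart[OF c(1) z(1)] this]
    show "((\<lambda>s. G (snd c (flow (s *\<^sub>R \<xi>) z))) has_vector_derivative
        frechet_derivative G (at (snd c z)) (chart_field c \<xi> (snd c z))) (at 0)"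
      using linear_cmul[OF has_derivative_linear[OF smooth_on_has_derivative[OF W(3) z(2)]]]
      by (simp add: has_vector_derivative_def o_def)
    have i: "isCont (\<lambda>s. flow (s *\<^sub>R \<xi>) z) 0" by (rule isCont_flow_curve)
    have "\<forall>\<^sub>F s in at 0. flow (s *\<^sub>R \<xi>) z \<in> fst c"
      using topological_tendstoD[OF i[unfolded isCont_def] open_chart[OF c(1)]] z(1) by (simp add:
          flow_0)
    moreover have "isCont (\<lambda>s. snd c (flow (s *\<^sub>R \<xi>) z)) 0"
      using isCont_chart[OF c(1) z(1)] by (intro isCont_o2[OF i]) (simp add: flow_0)
    then have "\<forall>\<^sub>F s in at 0. snd c (flow (s *\<^sub>R \<xi>) z) \<in> W"
      using topological_tendstoD[OF _ W(1), of "\<lambda>s. snd c (flow (s *\<^sub>R \<xi>) z)"] z(2) f0 unfolding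
          isCont_def by simp
    ultimately show "\<forall>\<^sub>F s in at 0. G (snd c (flow (s *\<^sub>R \<xi>) z)) \<in> ?T"
      by eventually_elim (use W(5) z(3) flow_in_torus_orbit in blast)
    show "G (snd c (flow (0 *\<^sub>R \<xi>) z)) \<in> ?T" using W(5) z f0 by simp
  qed
  let ?z = "\<lambda>s. flow (s *\<^sub>R \<eta>) y"
  let ?q = "\<lambda>s. snd c (?z s)"
  have q0: "?q 0 = p" "?z 0 = y" by (simp_all add: flow_0 y)
  have dq: "(?q has_derivative (\<lambda>s. s *\<^sub>R fundamental_field A act \<eta> y)) (at 0)"
    using flow_curve_chart[OF c(1,2), of \<eta>] y by (simp add: fundamental_field_chart_at c_def p_def)
  have dZ: "((\<lambda>s. Z (?q s)) has_derivative (\<lambda>s. Z' (s *\<^sub>R fundamental_field A act \<eta> y))) (at 0)"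
    using diff_chain_at[OF dq] Z(1) q0 by (fastforce simp: o_def)
  have dG: "((\<lambda>s. frechet_derivative G (at (?q s)) b) has_derivative
     (\<lambda>s. frechet_derivative (\<lambda>x. frechet_derivative G (at x) b) (at p) (s *\<^sub>R fundamental_field A
         act \<eta> y))) (at 0)" for b
    using diff_chain_at[OF dq] smooth_on_has_derivative[OF smooth_on_frechet_derivative[OF W(3)]
        W(2), of b] q0
    by (fastforce simp: o_def)
  have "((\<lambda>s. \<Sum>b\<in>Basis. (Z (?q s) \<bullet> b) *\<^sub>R frechet_derivative G (at (?q s)) b) has_derivative
     (\<lambda>s. \<Sum>b\<in>Basis. (Z' (s *\<^sub>R fundamental_field A act \<eta> y) \<bullet> b) *\<^sub>R b)) (at 0)"
    by (rule has_derivative_eq_rhs[OF has_derivative_sum[OF has_derivative_scaleR[OF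
        has_derivative_inner_left[OF dZ] dG]]])
      (simp add: flow_0 y Z(2) W(4) fun_eq_iff)
  then have "((\<lambda>s. \<Sum>b\<in>Basis. (Z (?q s) \<bullet> b) *\<^sub>R frechet_derivative G (at (?q s)) b)
      has_vector_derivative
      Z' (fundamental_field A act \<eta> y)) (at 0)"
    unfolding has_vector_derivative_def euclidean_representation
    by (simp only: linear_cmul[OF has_derivative_linear[OF Z(1)]])
  then show ?thesis
  proof (rule subspace_vector_derivative[OF subT])
    have i: "isCont ?z 0" by (rule isCont_flow_curve)
    have "\<forall>\<^sub>F s in at 0. ?z s \<in> fst c"
      using topological_tendstoD[OF i[unfolded isCont_def] open_chart[OF c(1)]] c(2) q0 by simp
    moreover have "\<forall>\<^sub>F s in at 0. ?z s \<in> V"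
      using topological_tendstoD[OF i[unfolded isCont_def] V(1)] V(2) q0 by simp
    moreover have "isCont ?q 0"
      using isCont_chart[OF c(1,2)] by (intro isCont_o2[OF i]) (simp add: flow_0)
    then have "\<forall>\<^sub>F s in at 0. ?q s \<in> W"
      using topological_tendstoD[OF _ W(1), of ?q] W(2) q0 unfolding isCont_def by simp
    ultimately show "\<forall>\<^sub>F s in at 0. (\<Sum>b\<in>Basis. (Z (?q s) \<bullet> b) *\<^sub>R frechet_derivative G (at (?q s))
        b) \<in> ?T"
    proof eventually_elim
      case (elim s)
      have N: "?z s \<in> torus_orbit act y" by (auto simp: mem_torus_orbit)
      then obtain \<xi> where "Z (?q s) = chart_field c \<xi> (?q s)" using tan elim by blast
      then have "frechet_derivative G (at (?q s)) (Z (?q s)) \<in> ?T"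
        using push[OF elim(1,3) N] by simp
      then show ?case
        by (subst frechet_derivative_basis[symmetric]) (auto intro: smooth_on_differentiable[OF
            W(3) elim(3)])
    qed
    show "(\<Sum>b\<in>Basis. (Z (?q 0) \<bullet> b) *\<^sub>R frechet_derivative G (at (?q 0)) b) \<in> ?T"
      by (simp add: flow_0 y Z(2) subspace_0[OF subT])
  qed
qed

end

section \<open>Minimality of associative orbits\<close>

lemma G2_metric_isometry:
  assumes "G2_form \<phi>"
  obtains e :: "real^7 \<Rightarrow> real^7" where "linear e" "bij e" "\<And>u v. G2_metric \<phi> u v = e u \<bullet> e v"
proof -
  obtain e where e: "linear e" "bij e" "\<phi> = pullback3 e phi0"
    using assms by (rule G2_form_cases)
  then show ?thesis
    using that[of e] by (simp add: G2_metric_pullback pullback_metric_def)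
qed

lemma inner_productD:
  assumes "inner_product g"
  shows "linear (\<lambda>u. g u v)" "linear (\<lambda>v. g u v)" "g u v = g v u" "g u u = 0 \<longleftrightarrow> u = 0"
proof -
  show 1: "linear (\<lambda>u. g u v)" and sym: "g u v = g v u" for u v
    using assms unfolding inner_product_def by blast+
  have "(\<lambda>v. g u v) = (\<lambda>v. g v u)" using sym by blast
  then show "linear (\<lambda>v. g u v)" using 1[of u] by simp
  show "g u u = 0 \<longleftrightarrow> u = 0"
    using assms linear_0[OF 1[of u]] unfolding inner_product_def by (metis less_irrefl)
qed

lemma inner_product_eqI:
  assumes "inner_product g" "\<And>w. g u w = g v w"
  shows "u = v"
proof -
  have "g (u - v) (u - v) = 0"
    using linear_diff[OF inner_productD(1)[OF assms(1)]] assms(2) by simp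
  then show ?thesis using inner_productD(4)[OF assms(1)] by simp
qed

text \<open>Riesz representation; it supplies the unique existence behind the \<open>THE\<close> in
  \<open>christoffel\<close>.\<close>

lemma inner_product_representation:
  fixes g :: "'n::finite form2"
  assumes g: "inner_product g" and l: "linear l"
  shows "\<exists>!G. \<forall>w. g G w = l w"
proof -
  note ip = inner_productD[OF g]
  let ?T = "\<lambda>G. (\<chi> i. g G (axis i 1)) :: real^'n"
  have exp: "g G w = (\<Sum>i\<in>UNIV. w $ i * g G (axis i 1))" for G w
    by (rule linear_axis_expansion[OF ip(2)])
  have lT: "linear ?T"
    by (rule linearI) (simp_all add: vec_eq_iff linear_add[OF ip(1)] linear_cmul[OF ip(1)])
  have "G = 0" if "?T G = 0" for G
  proof -
    have "g G (axis i 1) = 0" for i using that by (simp add: vec_eq_iff)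
    then have "g G G = 0" by (subst exp) simp
    then show ?thesis using ip(4) by simp
  qed
  then have "inj ?T" using linear_injective_0[OF lT] by blast
  then have "surj ?T" by (rule linear_injective_imp_surjective[OF lT]) simp
  from surjD[OF this, of "\<chi> i. l (axis i 1)"]
  obtain G where G: "(\<chi> i. l (axis i 1)) = ?T G" by blast
  then have "g G (axis i 1) = l (axis i 1)" for i by (simp add: vec_eq_iff)
  then have GG: "g G w = l w" for w
    unfolding exp[of G w] linear_axis_expansion[OF l, of w] by simp
  show ?thesis
  proof (rule ex1I)
    show "\<forall>w. g G w = l w" using GG by blast
    show "H = G" if "\<forall>w. g H w = l w" for H
      by (rule inner_product_eqI[OF g]) (simp add: that GG)
  qed
qed

lemma normal_part_unique:
  assumes g: "inner_product g" and T: "subspace T"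
    and n: "\<forall>t\<in>T. g n t = 0" "W - n \<in> T"
  shows "normal_part g T W = n"
  unfolding normal_part_def
proof (rule the_equality)
  show "(\<forall>t\<in>T. g n t = 0) \<and> W - n \<in> T" using n by blast
next
  fix m assume m: "(\<forall>t\<in>T. g m t = 0) \<and> W - m \<in> T"
  have "(W - n) - (W - m) \<in> T" using n m subspace_diff[OF T] by blast
  then have "m - n \<in> T" by simp
  then have "g (m - n) (m - n) = 0"
    using n m linear_diff[OF inner_productD(1)[OF g], of m n "m - n"] by simp
  then show "m = n" using inner_productD(4)[OF g] by simp
qed

text \<open>The condition defining \<open>normal_part\<close> sees \<open>W\<close> only modulo
  \<open>T\<close>.\<close>

lemma normal_part_cong:
  assumes "subspace T" "W - W' \<in> T"
  shows "normal_part g T W = normal_part g T W'"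
proof -
  have "W - n \<in> T \<longleftrightarrow> W' - n \<in> T" for n
    using subspace_diff[OF assms(1) _ assms(2), of "W - n"] subspace_add[OF assms(1) assms(2), of
        "W' - n"] by auto
  then show ?thesis by (simp add: normal_part_def)
qed

text \<open>Existence is carried over from orthogonal projection in Euclidean space by the isometry
  \<open>e\<close>; uniqueness is \<open>normal_part_unique\<close>.\<close>

lemma normal_part_G2:
  assumes "G2_form \<phi>" and T: "subspace T"
  shows "\<forall>t\<in>T. G2_metric \<phi> (normal_part (G2_metric \<phi>) T W) t = 0" "W - normal_part (G2_metric \<phi>) T
      W \<in> T"
proof -
  obtain e :: "real^7 \<Rightarrow> real^7" where e: "linear e" "bij e" "\<And>u v. G2_metric \<phi> u v = e u \<bullet> e v"
    by (rule G2_metric_isometry[OF assms(1)]) blast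
  obtain a b where ab: "a \<in> span (e ` T)" "\<And>x. x \<in> span (e ` T) \<Longrightarrow> orthogonal b x" "e W = a + b"
    by (rule orthogonal_subspace_decomp_exists[of "e ` T" "e W"]) blast
  have sp: "span (e ` T) = e ` T"
    using linear_subspace_image[OF e(1) T] by (simp add: span_eq_iff)
  have inv: "e (inv e x) = x" for x using e(2) by (simp add: bij_is_surj surj_f_inv_f)
  obtain t where t: "t \<in> T" "a = e t" using ab(1) sp by blast
  have "e (W - inv e b) = e t"
    using ab(3) t(2) by (simp add: linear_diff[OF e(1)] inv)
  then have "W - inv e b = t" using e(2) by (simp add: bij_is_inj inj_eq)
  then have n: "\<forall>t\<in>T. G2_metric \<phi> (inv e b) t = 0" "W - inv e b \<in> T"
    using t(1) ab(2) sp by (auto simp: e(3) inv orthogonal_def)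
  then show "\<forall>t\<in>T. G2_metric \<phi> (normal_part (G2_metric \<phi>) T W) t = 0" "W - normal_part (G2_metric
      \<phi>) T W \<in> T"
    using normal_part_unique[OF inner_product_G2_metric[OF assms(1)] T n] by simp_all
qed

lemma orthonormal_basis_G2:
  assumes "G2_form \<phi>" and T: "subspace T"
  shows "\<exists>B. orthonormal_basis_of (G2_metric \<phi>) T B"
proof -
  obtain e :: "real^7 \<Rightarrow> real^7" where e: "linear e" "bij e" "\<And>u v. G2_metric \<phi> u v = e u \<bullet> e v"
    by (rule G2_metric_isometry[OF assms(1)]) blast
  obtain C where C: "C \<subseteq> e ` T" "pairwise orthogonal C" "\<And>x. x \<in> C \<Longrightarrow> norm x = 1" "independent C"
      "span C = e ` T"
    by (rule orthonormal_basis_subspace[OF linear_subspace_image[OF e(1) T]]) blast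
  have inv: "e (inv e x) = x" "inv e (e x) = x" for x
    using e(2) by (simp_all add: bij_is_surj surj_f_inv_f bij_is_inj)
  have linv: "linear (inv e)"
  proof (rule linearI)
    fix x y c
    have "e (inv e (x + y)) = e (inv e x + inv e y)" by (simp add: inv linear_add[OF e(1)])
    then show "inv e (x + y) = inv e x + inv e y" by (simp only: inj_eq[OF bij_is_inj[OF e(2)]])
    have "e (inv e (c *\<^sub>R x)) = e (c *\<^sub>R inv e x)" by (simp add: inv linear_cmul[OF e(1)])
    then show "inv e (c *\<^sub>R x) = c *\<^sub>R inv e x" by (simp only: inj_eq[OF bij_is_inj[OF e(2)]])
  qed
  have "span (inv e ` C) = T"
    using span_linear_image[OF linv, of C] C(5) by (simp add: image_image inv)
  moreover have "finite (inv e ` C)" using independent_bound[OF C(4)] by simp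
  moreover have "G2_metric \<phi> (inv e a) (inv e b) = (if inv e a = inv e b then 1 else 0)" if "a \<in>
      C" "b \<in> C" for a b
  proof (cases "a = b")
    case True
    then show ?thesis using C(3)[OF that(1)] by (simp add: e(3) inv norm_eq_1)
  next
    case False
    then have "inv e a \<noteq> inv e b" using inv(1)[of a] inv(1)[of b] by auto
    then show ?thesis using C(2) that False by (simp add: e(3) inv pairwise_def orthogonal_def)
  qed
  ultimately have "orthonormal_basis_of (G2_metric \<phi>) T (inv e ` C)"
    unfolding orthonormal_basis_of_def by blast
  then show ?thesis by blast
qed

lemma card_orthonormal_basis_G2:
  assumes "G2_form \<phi>" and B: "orthonormal_basis_of (G2_metric \<phi>) T B"
  shows "card B = dim T"
proof -
  obtain e :: "real^7 \<Rightarrow> real^7" where e: "linear e" "bij e" "\<And>u v. G2_metric \<phi> u v = e u \<bullet> e v"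
    by (rule G2_metric_isometry[OF assms(1)]) blast
  have inj: "inj e" using e(2) by (rule bij_is_inj)
  have eB: "e a \<bullet> e b = (if a = b then 1 else 0)" if "a \<in> B" "b \<in> B" for a b
    using B that by (simp add: orthonormal_basis_of_def e(3))
  have "pairwise orthogonal (e ` B)"
    by (auto simp: pairwise_def orthogonal_def eB)
  moreover have "0 \<notin> e ` B" using eB by fastforce
  ultimately have "independent (e ` B)" by (rule pairwise_orthogonal_independent)
  then have "card (e ` B) = dim (e ` B)" by (simp add: dim_eq_card_independent)
  also have "\<dots> = dim B" by (rule dim_image_eq[OF e(1) inj_on_subset[OF inj subset_UNIV]])
  also have "\<dots> = dim T" using B dim_span[of B] by (simp add: orthonormal_basis_of_def)
  finally show ?thesis using card_image[OF inj_on_subset[OF inj subset_UNIV], of B] by simp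
qed

lemma span_full:
  fixes \<xi>1 \<xi>2 \<xi>3 :: "real^3"
  assumes "\<not> linearly_dependent3 \<xi>1 \<xi>2 \<xi>3"
  shows "span {\<xi>1, \<xi>2, \<xi>3} = UNIV"
  using assms dim_span_triple[of \<xi>1 \<xi>2 \<xi>3] dim_eq_full[of "{\<xi>1, \<xi>2, \<xi>3}"] by simp

section \<open>Invariance of fields and critical points along an orbit\<close>

context torus_manifold
begin

lemma vector_field_fundamental_has_derivative:
  assumes c: "c \<in> A" and p: "p \<in> chart_image c"
  shows "frechet_derivative (vector_field_in_chart A c (fundamental_field A act \<xi>)) (at p) =
    frechet_derivative (chart_field c \<xi>) (at p)"
  by (rule frechet_derivative_cong_open(1)[OF open_chart_image[OF c] p]) (rule
      vector_field_in_chart_fundamental[OF c])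

lemma smooth_fundamental_field: "smooth_vector_field_on A UNIV (fundamental_field A act \<xi>)"
  unfolding smooth_vector_field_on_def
proof
  fix c assume c: "c \<in> A"
  have "snd c ` (fst c \<inter> UNIV) = chart_image c" by (simp add: chart_image_def)
  then show "smooth_on (snd c ` (fst c \<inter> UNIV)) (vector_field_in_chart A c (fundamental_field A
      act \<xi>))"
    using smooth_chart_field[OF c, of \<xi>] smooth_on_cong[OF open_chart_image[OF c]
        vector_field_in_chart_fundamental[OF c, where \<xi> = \<xi>]]
    by simp
qed

text \<open>The torus is abelian, so \<open>flow t\<close> carries the orbit curve of \<xi> through
  \<open>x\<close> to the one through \<open>flow t x\<close>, and hence velocity to
  velocity.\<close>

lemma fundamental_field_flow:
  "fundamental_field A act \<xi> (flow t x) = tangent_map A (act (torus_exp t)) x (fundamental_field A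
      act \<xi> x)"
proof -
  let ?c = "chart_at A x" and ?d = "chart_at A (flow t x)"
  let ?T = "tangent_map A (act (torus_exp t)) x"
  note l = has_derivative_linear[OF tangent_map_flow[of t x]]
  have "((\<lambda>p. snd ?d (flow t (chart_inv ?c p))) has_derivative ?T) (at (snd ?c (flow (0 *\<^sub>R \<xi>) x)))"
    using tangent_map_flow[of t x] by (simp add: flow_0 coord_at_def)
  from diff_chain_at[OF flow_curve_chart[OF chart_at] this]
  have 1: "((\<lambda>s. snd ?d (flow t (chart_inv ?c (snd ?c (flow (s *\<^sub>R \<xi>) x))))) has_derivative
     (\<lambda>s. ?T (s *\<^sub>R chart_field ?c \<xi> (snd ?c x)))) (at 0)" by (simp add: o_def)
  have i: "isCont (\<lambda>s. flow (s *\<^sub>R \<xi>) x) 0" by (rule isCont_flow_curve)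
  have "\<forall>\<^sub>F s in at 0. flow (s *\<^sub>R \<xi>) x \<in> fst ?c"
    using topological_tendstoD[OF i[unfolded isCont_def] open_chart[OF chart_at(1)]]
        chart_at(2)[of x] by (simp add: flow_0)
  then have 2: "\<forall>\<^sub>F s in at 0. snd ?d (flow t (chart_inv ?c (snd ?c (flow (s *\<^sub>R \<xi>) x)))) = snd ?d
      (flow (s *\<^sub>R \<xi>) (flow t x))"
    by eventually_elim (simp add: chart_inv_left[OF chart_at(1)] flow_add[symmetric] add.commute)
  have "((\<lambda>s. snd ?d (flow (s *\<^sub>R \<xi>) (flow t x))) has_derivative
     (\<lambda>s. ?T (s *\<^sub>R chart_field ?c \<xi> (snd ?c x)))) (at 0)"
    by (rule has_derivative_transform_eventually[OF 1 2])
      (simp_all add: flow_0 chart_inv_left[OF chart_at(1) chart_at(2)])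
  from fun_cong[OF has_derivative_unique[OF this flow_curve_chart[OF chart_at]], of 1]
  show ?thesis by (simp add: fundamental_field_chart_at coord_at_def)
qed

text \<open>Near \<open>flow t x\<close> the function equals its composite with
  \<open>flow (- t)\<close>, and the chain rule passes through the zero derivative at
  \<open>x\<close>.\<close>

lemma critical_point_flow:
  assumes f: "\<And>t y. f (flow t y) = f y" and crit: "critical_point A f x"
  shows "critical_point A f (flow t x)"
proof -
  let ?c = "chart_at A x" and ?y = "flow t x"
  let ?d = "chart_at A ?y"
  have 1: "((\<lambda>p. snd ?c (flow (- t) (chart_inv ?d p))) has_derivative tangent_map A (act
      (torus_exp (- t))) ?y) (at (coord_at A ?y))"
    using tangent_map_flow[of "- t" ?y] by (simp add: flow_minus)
  have "(f \<circ> chart_inv ?c has_derivative (\<lambda>_. 0)) (at (snd ?c (flow (- t) (chart_inv ?d (coord_at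
      A ?y)))))"
    using crit by (simp add: critical_point_def chart_inv_coord_at flow_minus coord_at_def[of A x])
  from diff_chain_at[OF 1 this]
  have 2: "((\<lambda>p. f (chart_inv ?c (snd ?c (flow (- t) (chart_inv ?d p))))) has_derivative (\<lambda>_. 0))
      (at (coord_at A ?y))"
    by (simp add: o_def)
  have i: "isCont (\<lambda>p. flow (- t) (chart_inv ?d p)) (coord_at A ?y)"
    unfolding coord_at_def by (rule isCont_flow_chart_inv[OF chart_at])
  have "\<forall>\<^sub>F p in at (coord_at A ?y). flow (- t) (chart_inv ?d p) \<in> fst ?c"
    using topological_tendstoD[OF i[unfolded isCont_def] open_chart[OF chart_at(1)]]
        chart_at(2)[of x]
    by (simp add: chart_inv_coord_at flow_minus)
  then have 3: "\<forall>\<^sub>F p in at (coord_at A ?y). f (chart_inv ?c (snd ?c (flow (- t) (chart_inv ?d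
      p)))) = (f \<circ> chart_inv ?d) p"
    by eventually_elim (simp add: chart_inv_left[OF chart_at(1)] f)
  show ?thesis
    unfolding critical_point_def
    by (rule has_derivative_transform_eventually[OF 2 3])
      (simp_all add: chart_inv_coord_at flow_minus chart_inv_left[OF chart_at] f)
qed

end

section \<open>The induced metric and its Killing fields\<close>

locale torus_G2 = torus_form A act \<phi>
  for A :: "('m::{t2_space,second_countable_topology}, 7) chart set" and act and \<phi> +
  assumes G2: "\<And>x. G2_form (\<phi> x)"
begin

abbreviation chart_form :: "('m, 7) chart \<Rightarrow> real^7 \<Rightarrow> 7 form3" where
  "chart_form c \<equiv> form3_in_chart A c \<phi>"

abbreviation metric :: "'m \<Rightarrow> 7 form2" where
  "metric y \<equiv> G2_metric (\<phi> y)"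

lemma G2_chart_form:
  assumes "c \<in> A" "p \<in> chart_image c"
  shows "G2_form (chart_form c p)"
  unfolding form3_in_chart_pullback
  by (intro G2_form_pullback(1) G2 chart_change_to_ref assms)

text \<open>Naturality exhibits the chart components as the metric of a form varying smoothly in one
  chart, which is the setting of \<open>G2_metric_differentiable\<close>.\<close>

lemma metric_in_chart_eq:
  assumes "c \<in> A" "p \<in> chart_image c"
  shows "metric_in_chart A c metric p u v = G2_metric (chart_form c p) u v"
  unfolding form3_in_chart_pullback
  by (simp add: metric_in_chart_def Let_def G2_form_pullback(2)[OF G2 chart_change_to_ref[OF
      assms]])

lemma chart_metric_has_derivative:
  assumes "c \<in> A" "p \<in> chart_image c"
  shows "((\<lambda>q. G2_metric (chart_form c q) u v) has_derivative
    frechet_derivative (\<lambda>q. G2_metric (chart_form c q) u v) (at p)) (at p)"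
proof -
  have "(\<lambda>q. G2_metric (chart_form c q) u v) differentiable (at p)"
    using form3_has_derivative[OF smooth_form assms] G2_chart_form[OF assms(1)]
    by (intro G2_metric_differentiable[OF open_chart_image[OF assms(1)] assms(2)]) (auto simp:
        differentiable_def)
  then show ?thesis by (simp add: frechet_derivative_works)
qed

lemma chart_metric_inner_product:
  "c \<in> A \<Longrightarrow> p \<in> chart_image c \<Longrightarrow> inner_product (G2_metric (chart_form c p))"
  by (intro inner_product_G2_metric G2_chart_form)

lemma chart_metric_flow:
  assumes "c \<in> A" "(t, p) \<in> flow_dom c c"
  shows "G2_metric (chart_form c (chart_flow c c (t, p))) (space_deriv c t p u) (space_deriv c t p
      v)
    = G2_metric (chart_form c p) u v"
proof -
  have p: "p \<in> chart_image c" "flow t (chart_inv c p) \<in> fst c" using assms(2) by (auto simp: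
      flow_dom_iff)
  have "bij (space_deriv c t p)"
    using bij_space_deriv[OF assms(1) chart_inv_in[OF assms(1) p(1)] p(2)] by (simp add:
        chart_inv_right[OF assms(1) p(1)])
  then have "G2_metric (pullback3 (space_deriv c t p) (chart_form c (chart_flow c c (t, p)))) u v =
     G2_metric (chart_form c (chart_flow c c (t, p))) (space_deriv c t p u) (space_deriv c t p v)"
    by (intro G2_form_pullback(2) G2_chart_form linear_space_deriv chart_flow_in assms)
  then show ?thesis by (simp add: form3_in_chart_flow[OF assms])
qed

text \<open>The Killing equation in a chart, obtained by differentiating the isometry property
  \<open>chart_metric_flow\<close> at time zero.\<close>

lemma lie_derivative_metric_zero:
  fixes c p and \<xi> :: "real^3"
  assumes c: "c \<in> A" and p: "p \<in> chart_image c"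
  defines "X' \<equiv> frechet_derivative (chart_field c \<xi>) (at p)"
  shows "frechet_derivative (\<lambda>q. G2_metric (chart_form c q) u v) (at p) (chart_field c \<xi> p)
    + G2_metric (chart_form c p) (X' u) v + G2_metric (chart_form c p) u (X' v) = 0"
proof -
  let ?g = "\<lambda>q. G2_metric (chart_form c q)"
  let ?S = "\<lambda>s u. space_deriv c (s *\<^sub>R \<xi>) p u"
  note ip = inner_productD[OF chart_metric_inner_product[OF c]]
  have d: "((\<lambda>s. ?g (chart_flow c c (s *\<^sub>R \<xi>, p)) (?S s u) (?S s v)) has_derivative
     (\<lambda>s. frechet_derivative (\<lambda>q. ?g q (?S 0 u) (?S 0 v)) (at p) (s *\<^sub>R chart_field c \<xi> p)
       + ?g p (s *\<^sub>R X' u) (?S 0 v) + ?g p (?S 0 u) (s *\<^sub>R X' v))) (at 0)"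
    unfolding X'_def
    by (rule bilinear_has_derivative[OF open_chart_image[OF c] p ip(1) ip(2)
          chart_metric_has_derivative[OF c p] chart_flow_curve_has_derivative[OF c p] _
          space_deriv_derivative[OF c p] space_deriv_derivative[OF c p]])
      (simp_all add: chart_flow_0 c p)
  obtain I where I: "open I" "0 \<in> I" "\<And>s. s \<in> I \<Longrightarrow> (s *\<^sub>R \<xi>, p) \<in> flow_dom c c"
    by (rule flow_dom_segment[OF c p]) blast
  have "((\<lambda>s. ?g p u v) has_derivative
     (\<lambda>s. frechet_derivative (\<lambda>q. ?g q (?S 0 u) (?S 0 v)) (at p) (s *\<^sub>R chart_field c \<xi> p)
       + ?g p (s *\<^sub>R X' u) (?S 0 v) + ?g p (?S 0 u) (s *\<^sub>R X' v))) (at 0)"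
    by (rule has_derivative_transform_within_open[OF d I(1,2)]) (rule chart_metric_flow[OF c I(3)])
  from fun_cong[OF has_derivative_unique[OF this has_derivative_const], of 1] show ?thesis
    by (simp add: space_deriv_0[OF c p])
qed

text \<open>The differential of the squared length of a generating field, written out by the product
  rule so that it can be matched with the Christoffel terms.\<close>

definition field_norm_deriv :: "('m, 7) chart \<Rightarrow> real^3 \<Rightarrow> real^7 \<Rightarrow> real^7 \<Rightarrow> real" where
  "field_norm_deriv c \<xi> p h =
    frechet_derivative (\<lambda>q. G2_metric (chart_form c q) (chart_field c \<xi> p) (chart_field c \<xi> p))
        (at p) h
    + 2 * G2_metric (chart_form c p) (chart_field c \<xi> p) (frechet_derivative (chart_field c \<xi>) (at
        p) h)"

lemma field_norm_has_derivative:
  assumes c: "c \<in> A" and p: "p \<in> chart_image c"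
  shows "((\<lambda>q. G2_metric (chart_form c q) (chart_field c \<xi> q) (chart_field c \<xi> q)) has_derivative
    field_norm_deriv c \<xi> p) (at p)"
proof -
  note ip = inner_productD[OF chart_metric_inner_product[OF c]]
  show ?thesis
    by (rule has_derivative_eq_rhs[OF bilinear_has_derivative[OF open_chart_image[OF c] p ip(1)
        ip(2)
          chart_metric_has_derivative[OF c p] has_derivative_ident refl
          chart_field_has_derivative[OF c p] chart_field_has_derivative[OF c p]]])
      (simp_all add: field_norm_deriv_def fun_eq_iff
        ip(3)[OF p, of "chart_field c \<xi> p" "frechet_derivative (chart_field c \<xi>) (at p) _"])
qed

lemma linear_chart_metric_derivative:
  assumes c: "c \<in> A" and p: "p \<in> chart_image c"
  shows "linear (\<lambda>w. frechet_derivative (\<lambda>q. G2_metric (chart_form c q) v w) (at p) h)"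
proof -
  let ?g = "\<lambda>q. G2_metric (chart_form c q)"
  note ip = inner_productD[OF chart_metric_inner_product[OF c]]
  note d = chart_metric_has_derivative[OF c p]
  show ?thesis
  proof (rule linearI)
    fix a b
    have "((\<lambda>q. ?g q v (a + b)) has_derivative (\<lambda>h. frechet_derivative (\<lambda>q. ?g q v a) (at p) h
        + frechet_derivative (\<lambda>q. ?g q v b) (at p) h)) (at p)"
      by (rule has_derivative_transform_within_open[OF has_derivative_add[OF d d]
          open_chart_image[OF c] p])
        (simp add: linear_add[OF ip(2)])
    from fun_cong[OF has_derivative_unique[OF d this], of h]
    show "frechet_derivative (\<lambda>q. ?g q v (a + b)) (at p) h = frechet_derivative (\<lambda>q. ?g q v a) (at
        p) h
        + frechet_derivative (\<lambda>q. ?g q v b) (at p) h" .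
  next
    fix r a
    have "((\<lambda>q. ?g q v (r *\<^sub>R a)) has_derivative (\<lambda>h. r *\<^sub>R frechet_derivative (\<lambda>q. ?g q v a) (at
        p) h)) (at p)"
      by (rule has_derivative_transform_within_open[OF has_derivative_scaleR_right[OF d]
          open_chart_image[OF c] p])
        (simp add: linear_cmul[OF ip(2)])
    from fun_cong[OF has_derivative_unique[OF d this], of h]
    show "frechet_derivative (\<lambda>q. ?g q v (r *\<^sub>R a)) (at p) h = r *\<^sub>R frechet_derivative (\<lambda>q. ?g q
        v a) (at p) h" .
  qed
qed

lemma christoffel_metric:
  fixes y :: 'm
  defines "D \<equiv> \<lambda>a b d. frechet_derivative (\<lambda>q. G2_metric (chart_form (chart_at A y) q) b d) (at
      (coord_at A y)) a"
  shows "2 * metric y (christoffel A metric y u v) w = D u v w + D v u w - D w u v"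
proof -
  let ?c = "chart_at A y" and ?p = "coord_at A y"
  note c = chart_at(1)[of y] and p = coord_at_in[of y]
  have D: "frechet_derivative (\<lambda>q. metric_in_chart A ?c metric q b d) (at ?p) a = D a b d" for a b d
    unfolding D_def
    by (rule fun_cong[OF frechet_derivative_cong_open(1)[OF open_chart_image[OF c] p]]) (rule
        metric_in_chart_eq[OF c])
  have l1: "linear (\<lambda>w. D u v w)" "linear (\<lambda>w. D v u w)"
    unfolding D_def by (rule linear_chart_metric_derivative[OF c p])+
  have l2: "linear (\<lambda>w. D w u v)"
    unfolding D_def by (rule has_derivative_linear[OF chart_metric_has_derivative[OF c p]])
  have "linear (\<lambda>w. (D u v w + D v u w - D w u v) / 2)"
    using linear_compose_scale_right[OF linear_compose_sub[OF linear_compose_add[OF l1] l2], of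
        "1/2"] by simp
  from inner_product_representation[OF inner_product_G2_metric[OF G2] this]
  have "\<exists>!G. \<forall>w. 2 * metric y G w = D u v w + D v u w - D w u v"
    by (simp add: field_simps)
  from theI'[OF this] show ?thesis
    by (simp add: christoffel_def Let_def D)
qed

lemma cov_deriv_killing:
  fixes y :: 'm and \<xi> :: "real^3"
  defines "U \<equiv> fundamental_field A act \<xi>"
  shows "2 * metric y (cov_deriv A metric y (U y) U) w = - field_norm_deriv (chart_at A y) \<xi>
      (coord_at A y) w"
proof -
  let ?c = "chart_at A y" and ?p = "coord_at A y"
  note c = chart_at(1)[of y] and p = coord_at_in[of y]
  note ip = inner_productD[OF inner_product_G2_metric[OF G2[of y]]]
  let ?X' = "frechet_derivative (chart_field ?c \<xi>) (at ?p)"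
  let ?D = "\<lambda>a b d. frechet_derivative (\<lambda>q. G2_metric (chart_form ?c q) b d) (at ?p) a"
  have Uy: "chart_field ?c \<xi> ?p = U y" by (simp add: U_def fundamental_field_chart_at)
  have "2 * metric y (cov_deriv A metric y (U y) U) w =
     2 * metric y (?X' (U y)) w + 2 * metric y (christoffel A metric y (U y) (U y)) w"
    by (simp add: cov_deriv_def linear_add[OF ip(1)] U_def
        vector_field_fundamental_has_derivative[OF c p])
  also have "\<dots> = 2 * metric y (?X' (U y)) w + (2 * ?D (U y) (U y) w - ?D w (U y) (U y))"
    by (simp add: christoffel_metric)
  \<comment> \<open>The Killing equation; doubled, its first term cancels the derivative of the
    field along itself, and what remains is the negative of the differential of the squared
    length.\<close>
  also have "?D (U y) (U y) w = - metric y (?X' (U y)) w - metric y (U y) (?X' w)"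
    using lie_derivative_metric_zero[OF c p, where \<xi> = \<xi> and u = "U y" and v = w]
    by (simp add: Uy form3_in_chart_ref)
  finally show ?thesis
    by (simp add: field_norm_deriv_def Uy form3_in_chart_ref)
qed

text \<open>The generating field is one admissible extension. For any other, the Christoffel terms
  agree because the values at \<open>y\<close> do, and the difference of the covariant derivatives
  is tangent by \<open>tangential_derivative\<close>.\<close>

lemma second_fundamental_form_orbit:
  fixes y :: 'm and \<xi> :: "real^3"
  assumes inj: "\<And>z. z \<in> torus_orbit act y \<Longrightarrow> inj (\<lambda>\<xi>. fundamental_field A act \<xi> z)"
  defines "T \<equiv> range (\<lambda>\<xi>. fundamental_field A act \<xi> y)" and "U \<equiv> fundamental_field A act \<xi>"
  shows "second_fundamental_form A metric (torus_orbit act y) y (U y) (U y) =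
    normal_part (metric y) T (cov_deriv A metric y (U y) U)"
proof -
  let ?N = "torus_orbit act y" and ?c = "chart_at A y" and ?p = "coord_at A y"
  note c = chart_at(1)[of y] and p = coord_at_in[of y]
  have N: "submanifold_tangent A ?N z = range (\<lambda>\<xi>. fundamental_field A act \<xi> z)" if "z \<in> ?N" for z
    using submanifold_tangent_orbit[OF inj[OF that]] torus_orbit_eq[OF that] by simp
  have Ny: "submanifold_tangent A ?N y = T" using N[OF self_in_torus_orbit] by (simp add: T_def)
  have subT: "subspace T" unfolding T_def by (rule linear_subspace_image[OF
      linear_fundamental_field subspace_UNIV])
  show ?thesis
    unfolding second_fundamental_form_def Ny
  proof (rule the_equality)
    show "\<exists>V Y. open V \<and> y \<in> V \<and> smooth_vector_field_on A V Y \<and>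
        (\<forall>x\<in>V \<inter> ?N. Y x \<in> submanifold_tangent A ?N x) \<and> Y y = U y \<and>
        normal_part (metric y) T (cov_deriv A metric y (U y) U) = normal_part (metric y) T
            (cov_deriv A metric y (U y) Y)"
      using smooth_fundamental_field[of \<xi>] N
      by (intro exI[of _ UNIV] exI[of _ U]) (auto simp: U_def)
  next
    fix n assume "\<exists>V Y. open V \<and> y \<in> V \<and> smooth_vector_field_on A V Y \<and>
        (\<forall>x\<in>V \<inter> ?N. Y x \<in> submanifold_tangent A ?N x) \<and> Y y = U y \<and>
        n = normal_part (metric y) T (cov_deriv A metric y (U y) Y)"
    then obtain V Y where Y: "open V" "y \<in> V" "smooth_vector_field_on A V Y"
        "\<And>x. x \<in> V \<Longrightarrow> x \<in> ?N \<Longrightarrow> Y x \<in> submanifold_tangent A ?N x" "Y y = U y"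
        "n = normal_part (metric y) T (cov_deriv A metric y (U y) Y)" by blast
    let ?vf = "vector_field_in_chart A ?c"
    have pV: "?p \<in> snd ?c ` (fst ?c \<inter> V)" using Y(2) chart_at(2)[of y] by (auto simp: coord_at_def)
    have dY: "(?vf Y has_derivative frechet_derivative (?vf Y) (at ?p)) (at ?p)"
      using Y(3) c unfolding smooth_vector_field_on_def by (intro smooth_on_has_derivative[OF _
          pV]) blast
    define Z where "Z q = ?vf Y q - chart_field ?c \<xi> q" for q
    define Z' where "Z' h = frechet_derivative (?vf Y) (at ?p) h - frechet_derivative (chart_field
        ?c \<xi>) (at ?p) h" for h
    have dZ: "(Z has_derivative Z') (at ?p)"
      unfolding Z_def Z'_def by (rule has_derivative_diff[OF dY chart_field_has_derivative[OF c p]])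
    have "?vf Y ?p = Y y"
      using coord_change_id[OF c chart_at(2)] by (simp add: vector_field_in_chart_def Let_def
          chart_inv_coord_at)
    then have Z0: "Z ?p = 0" by (simp add: Z_def Y(5) U_def fundamental_field_chart_at)
    have "\<exists>\<eta>. Z (snd ?c z) = chart_field ?c \<eta> (snd ?c z)" if z: "z \<in> V" "z \<in> fst ?c" "z \<in> ?N" for z
    proof -
      obtain \<eta> where \<eta>: "Y z = fundamental_field A act \<eta> z"
        using Y(4)[OF z(1,3)] N[OF z(3)] by auto
      have zc: "snd ?c z \<in> chart_image ?c" "chart_inv ?c (snd ?c z) = z"
        using z(2) c by (auto simp: chart_in chart_inv_left)
      have "?vf Y (snd ?c z) = ?vf (fundamental_field A act \<eta>) (snd ?c z)"
        by (simp add: vector_field_in_chart_def Let_def zc(2) \<eta>)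
      then have "Z (snd ?c z) = chart_field ?c (\<eta> - \<xi>) (snd ?c z)"
        by (simp add: Z_def vector_field_in_chart_fundamental[OF c zc(1)] linear_diff[OF
            linear_chart_field[OF c zc(1)]])
      then show ?thesis by blast
    qed
    from tangential_derivative[OF inj[OF self_in_torus_orbit] Y(1,2) dZ Z0 this]
    have "Z' (U y) \<in> T" unfolding T_def U_def by blast
    moreover have "cov_deriv A metric y (U y) Y - cov_deriv A metric y (U y) U = Z' (U y)"
      by (simp add: cov_deriv_def Z'_def Y(5) U_def vector_field_fundamental_has_derivative[OF c p])
    ultimately show "n = normal_part (metric y) T (cov_deriv A metric y (U y) U)"
      unfolding Y(6) by (intro normal_part_cong[OF subT]) simp
  qed
qed

abbreviation moment :: "real^3 \<Rightarrow> real^3 \<Rightarrow> real^3 \<Rightarrow> 'm \<Rightarrow> real" where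
  "moment \<xi>1 \<xi>2 \<xi>3 y \<equiv> \<phi> y (fundamental_field A act \<xi>1 y) (fundamental_field A act \<xi>2 y)
      (fundamental_field A act \<xi>3 y)"

lemma moment_flow: "moment \<xi>1 \<xi>2 \<xi>3 (flow t x) = moment \<xi>1 \<xi>2 \<xi>3 x"
  by (simp add: fundamental_field_flow invariant_flow)

lemma range_fundamental_field:
  assumes "\<not> linearly_dependent3 \<xi>1 \<xi>2 \<xi>3"
  shows "range (\<lambda>\<xi>. fundamental_field A act \<xi> y) =
    span {fundamental_field A act \<xi>1 y, fundamental_field A act \<xi>2 y, fundamental_field A act \<xi>3 y}"
  using span_linear_image[OF linear_fundamental_field, of y "{\<xi>1, \<xi>2, \<xi>3}"] span_full[OF assms] by
      simp

text \<open>A non-zero value of \<phi> makes the generators independent at \<open>y\<close>, so the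
  orbit is an immersed three-torus quotient there and the slice construction applies.\<close>

lemma inj_fundamental_field:
  assumes nd: "\<not> linearly_dependent3 \<xi>1 \<xi>2 \<xi>3" and m: "moment \<xi>1 \<xi>2 \<xi>3 y \<noteq> 0"
  shows "inj (\<lambda>\<xi>. fundamental_field A act \<xi> y)"
proof -
  let ?L = "\<lambda>\<xi>. fundamental_field A act \<xi> y"
  note L = linear_fundamental_field[of y]
  have i: "\<not> linearly_dependent3 (?L \<xi>1) (?L \<xi>2) (?L \<xi>3)"
    using m alternating3_dependent[OF G2_form_alternating[OF G2]] by blast
  have "\<xi> = 0" if "?L \<xi> = 0" for \<xi>
  proof -
    have "\<xi> \<in> span {\<xi>1, \<xi>2, \<xi>3}" using span_full[OF nd] by simp
    then obtain a b c where \<xi>: "\<xi> = a *\<^sub>R \<xi>1 + b *\<^sub>R \<xi>2 + c *\<^sub>R \<xi>3"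
      unfolding span_triple by blast
    then have "a *\<^sub>R ?L \<xi>1 + b *\<^sub>R ?L \<xi>2 + c *\<^sub>R ?L \<xi>3 = 0"
      using that by (simp add: linear_add[OF L] linear_cmul[OF L])
    from independent3_coeffs[OF i this] show ?thesis using \<xi> by simp
  qed
  then show ?thesis using linear_injective_0[OF L] by blast
qed

end

section \<open>Critical points of the multi-moment map and their orbits\<close>

locale torus_nearly_parallel = torus_G2 A act \<phi>
  for A :: "('m::{t2_space,second_countable_topology}, 7) chart set" and act and \<phi> +
  assumes nearly_parallel: "nearly_parallel_G2 A \<phi>"
begin

text \<open>Here \<open>d\<phi> = 4 \<star>\<phi>\<close> turns a condition on derivatives into
  algebra at the single point \<open>x\<close>.\<close>

lemma critical_point_star3:
  "critical_point A (moment \<xi>1 \<xi>2 \<xi>3) x \<longleftrightarrow>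
    (\<forall>h. star3 (\<phi> x) h (fundamental_field A act \<xi>1 x) (fundamental_field A act \<xi>2 x)
        (fundamental_field A act \<xi>3 x) = 0)"
  using nearly_parallel unfolding critical_point_contraction nearly_parallel_G2_def by simp

lemma critical_point_zero:
  assumes "moment \<xi>1 \<xi>2 \<xi>3 x = 0"
  shows "critical_point A (moment \<xi>1 \<xi>2 \<xi>3) x \<longleftrightarrow>
    linearly_dependent3 (fundamental_field A act \<xi>1 x) (fundamental_field A act \<xi>2 x)
        (fundamental_field A act \<xi>3 x)"
  unfolding critical_point_star3 using star3_zero(1,2)[OF G2[of x]] assms by blast

lemma critical_point_nonzero:
  assumes "moment \<xi>1 \<xi>2 \<xi>3 x \<noteq> 0"
  shows "critical_point A (moment \<xi>1 \<xi>2 \<xi>3) x \<longleftrightarrow>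
    associative_plane (\<phi> x) (span {fundamental_field A act \<xi>1 x, fundamental_field A act \<xi>2 x,
        fundamental_field A act \<xi>3 x})"
  unfolding critical_point_star3 using star3_zero(3)[OF G2[of x] assms] by blast

text \<open>The product of the lengths of the generating fields dominates \<open>\<phi>\<close> evaluated on them, with equality at
  \<open>y\<close>; as \<open>\<phi>\<close> on the fields is critical at \<open>y\<close>, so is that product.\<close>

lemma field_norm_deriv_sum:
  fixes y :: 'm and \<eta>1 \<eta>2 \<eta>3 :: "real^3"
  defines "U \<equiv> \<lambda>\<xi>. fundamental_field A act \<xi> y"
  assumes assoc: "associative_plane (\<phi> y) (span {U \<eta>1, U \<eta>2, U \<eta>3})"
    and n: "metric y (U \<eta>1) (U \<eta>1) = 1" "metric y (U \<eta>2) (U \<eta>2) = 1" "metric y (U \<eta>3) (U \<eta>3) = 1"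
    and o: "metric y (U \<eta>1) (U \<eta>2) = 0" "metric y (U \<eta>1) (U \<eta>3) = 0" "metric y (U \<eta>2) (U \<eta>3) = 0"
  shows "field_norm_deriv (chart_at A y) \<eta>1 (coord_at A y) w + field_norm_deriv (chart_at A y) \<eta>2
      (coord_at A y) w
    + field_norm_deriv (chart_at A y) \<eta>3 (coord_at A y) w = 0"
proof -
  let ?c = "chart_at A y" and ?p = "coord_at A y"
  note c = chart_at(1)[of y] and p = coord_at_in[of y]
  define N where "N \<eta> q = G2_metric (chart_form ?c q) (chart_field ?c \<eta> q) (chart_field ?c \<eta> q)"
      for \<eta> q
  define f where "f q = chart_form ?c q (chart_field ?c \<eta>1 q) (chart_field ?c \<eta>2 q) (chart_field
      ?c \<eta>3 q)" for q
  have Up: "chart_field ?c \<eta> ?p = U \<eta>" for \<eta> by (simp add: U_def fundamental_field_chart_at)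
  have Np: "N \<eta>1 ?p = 1" "N \<eta>2 ?p = 1" "N \<eta>3 ?p = 1"
    by (simp_all add: N_def Up form3_in_chart_ref n)
  have fp: "f ?p = moment \<eta>1 \<eta>2 \<eta>3 y" by (simp add: f_def form3_in_chart_ref Up) (simp add: U_def)
  have f1: "(f ?p)\<^sup>2 = 1"
    unfolding fp using G2_form_associative_orthonormal[OF G2 assoc n(2,3,1) o] by (simp add: U_def)
  then have "moment \<eta>1 \<eta>2 \<eta>3 y \<noteq> 0" using fp by auto
  then have "critical_point A (moment \<eta>1 \<eta>2 \<eta>3) y"
    using critical_point_nonzero assoc by (simp add: U_def)
  then have "ext_deriv3 A \<phi> y h (U \<eta>1) (U \<eta>2) (U \<eta>3) = 0" for h
    unfolding critical_point_contraction U_def by blast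
  then have df: "(f has_derivative (\<lambda>h. 0)) (at ?p)"
    using contraction_has_derivative[OF c p, of \<eta>1 \<eta>2 \<eta>3]
    by (simp add: f_def[abs_def] Up ext_deriv3_in_chart)
  have dN: "(N \<eta> has_derivative field_norm_deriv ?c \<eta> ?p) (at ?p)" for \<eta>
    unfolding N_def[abs_def] by (rule field_norm_has_derivative[OF c p])
  \<comment> \<open>\<open>M\<close> has an interior minimum with value zero at \<open>?p\<close>.
    Since each \<open>N\<close> equals 1 there and \<open>f\<close> is critical, the differential of
    \<open>M\<close> is just the sum of the three differentials of squared lengths.\<close>
  define M where "M q = N \<eta>1 q * N \<eta>2 q * N \<eta>3 q - f q * f q" for q
  have "(M has_derivative (\<lambda>h. field_norm_deriv ?c \<eta>1 ?p h + field_norm_deriv ?c \<eta>2 ?p h +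
      field_norm_deriv ?c \<eta>3 ?p h)) (at ?p)"
    unfolding M_def[abs_def]
    by (rule has_derivative_eq_rhs[OF has_derivative_diff[OF has_derivative_mult[OF
        has_derivative_mult[OF dN dN] dN]
            has_derivative_mult[OF df df]]])
      (simp add: Np fun_eq_iff)
  moreover have "M ?p = 0" using f1 by (simp add: M_def Np power2_eq_square)
  moreover have "M q \<ge> 0" if "q \<in> chart_image ?c" for q
    using G2_form_comass[OF G2_chart_form[OF c that]] by (simp add: M_def N_def f_def
        power2_eq_square)
  ultimately have "(\<lambda>h. field_norm_deriv ?c \<eta>1 ?p h + field_norm_deriv ?c \<eta>2 ?p h +
      field_norm_deriv ?c \<eta>3 ?p h) = (\<lambda>h. 0)"
    by (intro differential_zero_maxmin[OF p open_chart_image[OF c]]) auto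
  then show ?thesis by metis
qed

text \<open>The orthonormal basis is an arbitrary choice in \<open>mean_curvature\<close>; each of
  its vectors is the value at \<open>y\<close> of a generating field, so the generators are adapted
  to it and the vanishing sum of covariant derivatives applies.\<close>

lemma mean_curvature_zero:
  assumes nd: "\<not> linearly_dependent3 \<xi>1 \<xi>2 \<xi>3"
    and inj: "\<And>z. z \<in> torus_orbit act y \<Longrightarrow> inj (\<lambda>\<xi>. fundamental_field A act \<xi> z)"
    and assoc: "associative_plane (\<phi> y) (range (\<lambda>\<xi>. fundamental_field A act \<xi> y))"
  shows "mean_curvature A metric (torus_orbit act y) y = 0"
proof -
  let ?N = "torus_orbit act y" and ?c = "chart_at A y" and ?p = "coord_at A y"
  define T where "T = range (\<lambda>\<xi>. fundamental_field A act \<xi> y)"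
  have subT: "subspace T" unfolding T_def by (rule linear_subspace_image[OF
      linear_fundamental_field subspace_UNIV])
  have N: "submanifold_tangent A ?N y = T"
    unfolding T_def by (rule submanifold_tangent_orbit[OF inj[OF self_in_torus_orbit]])
  define B where "B = (SOME B. orthonormal_basis_of (metric y) T B)"
  have B: "orthonormal_basis_of (metric y) T B"
    unfolding B_def using orthonormal_basis_G2[OF G2 subT] by (rule someI_ex)
  have "card B = 3"
    using card_orthonormal_basis_G2[OF G2 B] assoc by (simp add: associative_plane_def T_def)
  then obtain e1 e2 e3 where e: "B = {e1, e2, e3}" "e1 \<noteq> e2" "e1 \<noteq> e3" "e2 \<noteq> e3"
    by (auto simp: card_3_iff)
  have spB: "span {e1, e2, e3} = T" using B e(1) by (simp add: orthonormal_basis_of_def)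
  then have "e1 \<in> T" "e2 \<in> T" "e3 \<in> T" by (auto intro: span_base)
  then obtain \<eta>1 \<eta>2 \<eta>3 where \<eta>: "e1 = fundamental_field A act \<eta>1 y" "e2 = fundamental_field A act
      \<eta>2 y" "e3 = fundamental_field A act \<eta>3 y"
    unfolding T_def by blast
  have on: "metric y e1 e1 = 1" "metric y e2 e2 = 1" "metric y e3 e3 = 1" "metric y e1 e2 = 0"
      "metric y e1 e3 = 0" "metric y e2 e3 = 0"
    using B e by (auto simp: orthonormal_basis_of_def)
  define W where "W \<eta> = cov_deriv A metric y (fundamental_field A act \<eta> y) (fundamental_field A
      act \<eta>)" for \<eta>
  have II: "second_fundamental_form A metric ?N y (fundamental_field A act \<eta> y) (fundamental_field
      A act \<eta> y) =
     normal_part (metric y) T (W \<eta>)" for \<eta>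
    unfolding W_def T_def by (rule second_fundamental_form_orbit[OF inj])
  note ip = inner_productD[OF inner_product_G2_metric[OF G2[of y]]]
  have "metric y (W \<eta>1 + W \<eta>2 + W \<eta>3) w = metric y 0 w" for w
  proof -
    have "field_norm_deriv ?c \<eta>1 ?p w + field_norm_deriv ?c \<eta>2 ?p w + field_norm_deriv ?c \<eta>3 ?p w
        = 0"
      using assoc spB on unfolding T_def \<eta> by (intro field_norm_deriv_sum) auto
    then show ?thesis
      using cov_deriv_killing[of y \<eta>1 w] cov_deriv_killing[of y \<eta>2 w] cov_deriv_killing[of y \<eta>3 w]
      by (simp add: linear_add[OF ip(1)] linear_0[OF ip(1)] W_def)
  qed
  then have W0: "W \<eta>1 + W \<eta>2 + W \<eta>3 = 0"
    by (rule inner_product_eqI[OF inner_product_G2_metric[OF G2]])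
  let ?n = "\<lambda>\<eta>. normal_part (metric y) T (W \<eta>)"
  note np = normal_part_G2[OF G2[of y] subT]
  \<comment> \<open>The sum of the normal parts is itself normal, and it lies in \<open>T\<close>
    because the full vectors sum to zero; hence it vanishes, without using additivity of
    \<open>normal_part\<close>.\<close>
  let ?s = "?n \<eta>1 + ?n \<eta>2 + ?n \<eta>3"
  have "(W \<eta>1 - ?n \<eta>1) + (W \<eta>2 - ?n \<eta>2) + (W \<eta>3 - ?n \<eta>3) \<in> T"
    by (intro subspace_add[OF subT] np(2))
  moreover have "(W \<eta>1 - ?n \<eta>1) + (W \<eta>2 - ?n \<eta>2) + (W \<eta>3 - ?n \<eta>3) = - ?s"
    using W0 by (simp add: algebra_simps)
  ultimately have "- ?s \<in> T" by (simp only:)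
  from subspace_neg[OF subT this] have "?s \<in> T" by (simp only: minus_minus)
  then have "metric y ?s ?s = 0"
    using np(1) by (simp add: linear_add[OF ip(1)])
  then have "?s = 0" using ip(4) by simp
  moreover have "mean_curvature A metric ?N y = ?s"
    unfolding mean_curvature_def N B_def[symmetric] e(1) using e(2,3,4) by (simp add: \<eta> II
        add.assoc)
  ultimately show ?thesis by simp
qed

text \<open>The value of \<nu> and criticality are both invariant under the flow, so the pointwise
  results at \<open>x\<close> hold along the whole orbit.\<close>

lemma critical_orbit:
  assumes nd: "\<not> linearly_dependent3 \<xi>1 \<xi>2 \<xi>3"
    and m: "moment \<xi>1 \<xi>2 \<xi>3 x \<noteq> 0" and crit: "critical_point A (moment \<xi>1 \<xi>2 \<xi>3) x"
  shows "associative_submanifold A \<phi> (torus_orbit act x)"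
    and "minimal_submanifold A metric 3 (torus_orbit act x)"
proof -
  have inj: "inj (\<lambda>\<xi>. fundamental_field A act \<xi> y)"
    and assoc: "associative_plane (\<phi> y) (range (\<lambda>\<xi>. fundamental_field A act \<xi> y))" if y: "y \<in>
        torus_orbit act x" for y
  proof -
    obtain t where t: "y = flow t x" using y unfolding mem_torus_orbit by blast
    have my: "moment \<xi>1 \<xi>2 \<xi>3 y \<noteq> 0" using m by (simp add: t moment_flow)
    have "critical_point A (moment \<xi>1 \<xi>2 \<xi>3) y"
      unfolding t by (rule critical_point_flow[OF moment_flow crit])
    then show "associative_plane (\<phi> y) (range (\<lambda>\<xi>. fundamental_field A act \<xi> y))"
      using critical_point_nonzero[OF my] by (simp add: range_fundamental_field[OF nd])
    show "inj (\<lambda>\<xi>. fundamental_field A act \<xi> y)" by (rule inj_fundamental_field[OF nd my])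
  qed
  have emb: "embedded_submanifold A 3 (torus_orbit act x)" by (rule embedded_orbit[OF inj])
  have "submanifold_tangent A (torus_orbit act x) y = range (\<lambda>\<xi>. fundamental_field A act \<xi> y)"
    if "y \<in> torus_orbit act x" for y
    using submanifold_tangent_orbit[OF inj[OF that]] torus_orbit_eq[OF that] by simp
  then show "associative_submanifold A \<phi> (torus_orbit act x)"
    using emb assoc by (simp add: associative_submanifold_def)
  have "mean_curvature A metric (torus_orbit act x) y = 0" if y: "y \<in> torus_orbit act x" for y
    using mean_curvature_zero[OF nd _ assoc[OF y]] inj torus_orbit_eq[OF y] by simp
  then show "minimal_submanifold A metric 3 (torus_orbit act x)"
    using emb by (simp add: minimal_submanifold_def)
qed

end

theorem proposition1p1:
  fixes A :: "('m::{t2_space,second_countable_topology}, 7) chart set"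
    and \<phi> :: "'m \<Rightarrow> 7 form3"
    and act :: "complex^3 \<Rightarrow> 'm \<Rightarrow> 'm"
    and \<xi>\<^sub>1 \<xi>\<^sub>2 \<xi>\<^sub>3 :: "real^3"
    and U\<^sub>1 U\<^sub>2 U\<^sub>3 :: "'m \<Rightarrow> real^7"
    and \<nu> :: "'m \<Rightarrow> real"
  assumes "smooth_atlas A"
    and "connected (UNIV :: 'm set)"
    and "nearly_parallel_G2 A \<phi>"
    and "smooth_torus_action A act"
    and "effective_action act"
    and "preserves_3form A act \<phi>"
    and "\<not> linearly_dependent3 \<xi>\<^sub>1 \<xi>\<^sub>2 \<xi>\<^sub>3"
    and "U\<^sub>1 = fundamental_field A act \<xi>\<^sub>1"
    and "U\<^sub>2 = fundamental_field A act \<xi>\<^sub>2"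
    and "U\<^sub>3 = fundamental_field A act \<xi>\<^sub>3"
    and "\<nu> = (\<lambda>x. \<phi> x (U\<^sub>1 x) (U\<^sub>2 x) (U\<^sub>3 x))"
  shows "(\<forall>x. \<nu> x = 0 \<longrightarrow>
            (critical_point A \<nu> x \<longleftrightarrow> linearly_dependent3 (U\<^sub>1 x) (U\<^sub>2 x) (U\<^sub>3 x))) \<and>
         (\<forall>x. \<nu> x \<noteq> 0 \<longrightarrow>
            (critical_point A \<nu> x \<longleftrightarrow> associative_plane (\<phi> x) (span {U\<^sub>1 x, U\<^sub>2 x, U\<^sub>3 x}))) \<and>
         (\<forall>x. \<nu> x \<noteq> 0 \<and> critical_point A \<nu> x \<longrightarrow>
            associative_submanifold A \<phi> (torus_orbit act x) \<and>
            minimal_submanifold A (\<lambda>y. G2_metric (\<phi> y)) 3 (torus_orbit act x))"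
proof -
  interpret torus_nearly_parallel A act \<phi>
    using assms(1,3,4,6) by unfold_locales (simp_all add: nearly_parallel_G2_def G2_structure_def)
  show ?thesis
    unfolding assms(8-11)
    by (intro conjI allI impI critical_point_zero critical_point_nonzero)
      (blast intro: critical_orbit[OF assms(7)])+
qed

end
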